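(* Let $f:\Sigma\to M^3$ be a mixed type surface in a Lorentzian $3$-manifold $M^3$ and let $p\in\Sigma$ be a lightlike point of the admissible second kind. Then the balancing curvature $\kappa_B$ converges to $0$ or diverges to $\pm\infty$ at $p$. In particular, if $p$ is not an $L_3$-point, then $\kappa_B$ tends to $-\infty$ at $p$.
   Context: All objects are smooth. $(M^3,\bar g)$ is a Lorentzian $3$-manifold (signature $(+,+,-)$). A surface is an immersion $f:\Sigma\to M^3$ of a connected $2$-manifold; its first fundamental form is $ds^2=f^*\bar g$. A point is spacelike, timelike or lightlike if $ds^2$ there is positive definite, (non-degenerate) indefinite, or degenerate. $LD$ is the set of lightlike points. The surface is of mixed type if both the spacelike and the timelike point sets are non-empty. In local coordinates $ds^2=E\,du^2+2F\,du\,dv+G\,dv^2$, $\lambda=EG-F^2$. A lightlike point $p$ is non-degenerate if $d\lambda(p)\ne0$; then near $p$ the set $LD$ is the image of a regular curve $\gamma(t)$, $\gamma(0)=p$ (characteristic curve). At a lightlike point the null space $\{\boldsymbol v: ds^2(\boldsymbol v,\cdot)=0\}$ is one-dimensional; its nonzero elements are null vectors. A null vector field is a smooth vector field $\eta$ on an open set $U$ with $\eta_q$ a null vector for each $q\in LD\cap U$; $\eta(t)=\eta_{\gamma(t)}$. A non-degenerate lightlike point $p=\gamma(0)$ is of the first kind (resp. second kind) if $\gamma'(0),\eta(0)$ are linearly independent (resp. dependent). A point $p$ of the second kind is admissible if every neighborhood of $p$ contains a lightlike point of the first kind. With $\delta(t)=\det(\gamma'(t),\eta(t))$, $p=\gamma(0)$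 is an $L_3$-point if $\delta(0)=0$ and $\delta'(0)\ne0$. At a lightlike point $q$ of the first kind, a coordinate system $(U;u,v)$ centered at $q$ is adapted if $\partial_v$ is a null vector field and $LD\cap U=\{v=0\}$, and specially adapted if moreover $E(u,0)=1$ and $\lambda_v(u,0)=1$. Such coordinates exist. The balancing curvature is $$\kappa_B(q)=\Big(-\tfrac12E_{vv}+F_{uv}+\tfrac{E_v}{10}\big(G_{vv}-2(F_v)^2\big)\Big)\Big|_{u=v=0}$$ in any specially adapted coordinate system centered at $q$ (independent of the choice). Limits "at $p$" are limits along lightlike points of the first kind converging to $p$; "diverges to $\pm\infty$" means that the absolute value tends to $\infty$ (the sign may differ on the two sides of $p$ on the characteristic curve). *)

theory Defs
  imports "HOL-Analysis.Analysis"
begin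

section \<open>Smooth maps and smooth manifolds\<close>

text \<open>Both notions are meant for open sets: iterated Frechet derivatives exist and are continuous
  up to the given order.\<close>

primrec C_k_on :: "nat \<Rightarrow> 'a::real_normed_vector set \<Rightarrow> ('a \<Rightarrow> 'b::real_normed_vector) \<Rightarrow> bool" where
  "C_k_on 0 S f \<longleftrightarrow> continuous_on S f"
| "C_k_on (Suc k) S f \<longleftrightarrow>
     (\<forall>x\<in>S. f differentiable (at x)) \<and> (\<forall>v. C_k_on k S (\<lambda>x. frechet_derivative f (at x) v))"

definition smooth_on :: "'a::real_normed_vector set \<Rightarrow> ('a \<Rightarrow> 'b::real_normed_vector) \<Rightarrow> bool" where
  "smooth_on S f \<longleftrightarrow> (\<forall>k. C_k_on k S f)"

text \<open>A chart is a pair of a domain and a coordinate map, whose values outside the domain are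
  irrelevant. The underlying space of a manifold is a whole type.\<close>

type_synonym ('a, 'n) chart = "'a set \<times> ('a \<Rightarrow> real^'n)"

definition chart_inv :: "('a, 'n::finite) chart \<Rightarrow> real^'n \<Rightarrow> 'a" where
  "chart_inv c = inv_into (fst c) (snd c)"

definition is_chart :: "('a::topological_space, 'n::finite) chart \<Rightarrow> bool" where
  "is_chart c \<longleftrightarrow> open (fst c) \<and> open (snd c ` fst c) \<and>
     homeomorphism (fst c) (snd c ` fst c) (snd c) (chart_inv c)"

definition local_rep ::
    "('a \<Rightarrow> 'b) \<Rightarrow> ('a, 'n::finite) chart \<Rightarrow> ('b, 'm::finite) chart \<Rightarrow> real^'n \<Rightarrow> real^'m" where
  "local_rep f c d = snd d \<circ> f \<circ> chart_inv c"

definition compatible :: "('a, 'n::finite) chart \<Rightarrow> ('a, 'n) chart \<Rightarrow> bool" where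
  "compatible c d \<longleftrightarrow> smooth_on (snd c ` (fst c \<inter> fst d)) (local_rep id c d) \<and>
                      smooth_on (snd d ` (fst c \<inter> fst d)) (local_rep id d c)"

definition smooth_manifold ::
    "('a::{t2_space, second_countable_topology}, 'n::finite) chart set \<Rightarrow> bool" where
  "smooth_manifold A \<longleftrightarrow> (\<forall>c\<in>A. is_chart c) \<and> (\<Union>c\<in>A. fst c) = UNIV \<and>
     (\<forall>c\<in>A. \<forall>d\<in>A. compatible c d)"

text \<open>The maximal atlas: all local coordinate systems of the manifold with atlas \<open>A\<close>.\<close>

definition coord_systems ::
    "('a::topological_space, 'n::finite) chart set \<Rightarrow> ('a, 'n) chart set" where
  "coord_systems A = {c. is_chart c \<and> (\<forall>d\<in>A. compatible c d)}"

section \<open>Metric tensors, immersions and the first fundamental form\<close>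

text \<open>A symmetric covariant 2-tensor field is given by its component matrix in every coordinate
  system, at every point of the domain of that system.\<close>

type_synonym ('a, 'n) components = "('a, 'n) chart \<Rightarrow> 'a \<Rightarrow> real^'n^'n"

definition symmetric_tensor ::
    "('a::topological_space, 'n::finite) chart set \<Rightarrow> ('a, 'n) components \<Rightarrow> bool" where
  "symmetric_tensor A g \<longleftrightarrow>
     (\<forall>c\<in>coord_systems A.
        smooth_on (snd c ` fst c) (g c \<circ> chart_inv c) \<and>
        (\<forall>x\<in>fst c. transpose (g c x) = g c x)) \<and>
     (\<forall>c\<in>coord_systems A. \<forall>d\<in>coord_systems A. \<forall>x\<in>fst c \<inter> fst d.
        (let J = jacobian (local_rep id c d) (at (snd c x))
         in g c x = transpose J ** g d x ** J))"

definition lorentz_signature :: "real^3^3 \<Rightarrow> bool" where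
  "lorentz_signature m \<longleftrightarrow> (\<exists>P :: real^3^3. invertible P \<and>
     transpose P ** m ** P = (\<chi> i j. if i = j then (if i = 3 then -1 else 1) else 0))"

definition lorentzian_metric ::
    "('a::topological_space, 3) chart set \<Rightarrow> ('a, 3) components \<Rightarrow> bool" where
  "lorentzian_metric B g \<longleftrightarrow> symmetric_tensor B g \<and>
     (\<forall>c\<in>coord_systems B. \<forall>x\<in>fst c. lorentz_signature (g c x))"

definition smooth_map ::
    "('a::topological_space, 'n::finite) chart set \<Rightarrow> ('b::topological_space, 'm::finite) chart set \<Rightarrow>
     ('a \<Rightarrow> 'b) \<Rightarrow> bool" where
  "smooth_map A B f \<longleftrightarrow> continuous_on UNIV f \<and>
     (\<forall>c\<in>A. \<forall>d\<in>B. smooth_on (snd c ` (fst c \<inter> f -` fst d)) (local_rep f c d))"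

definition immersion ::
    "('a::topological_space, 'n::finite) chart set \<Rightarrow> ('b::topological_space, 'm::finite) chart set \<Rightarrow>
     ('a \<Rightarrow> 'b) \<Rightarrow> bool" where
  "immersion A B f \<longleftrightarrow> smooth_map A B f \<and>
     (\<forall>c\<in>A. \<forall>d\<in>B. \<forall>x\<in>fst c \<inter> f -` fst d.
        inj (frechet_derivative (local_rep f c d) (at (snd c x))))"

text \<open>The pullback of \<open>g\<close> by \<open>f\<close>; the result does not depend on the chart \<open>d\<close> around \<open>f x\<close>.\<close>

definition first_fundamental_form ::
    "('b::topological_space, 'm::finite) chart set \<Rightarrow> ('b, 'm) components \<Rightarrow> ('a \<Rightarrow> 'b) \<Rightarrow>
     ('a, 'n::finite) components" where
  "first_fundamental_form B g f c x =
     (let d = (SOME d. d \<in> B \<and> f x \<in> fst d);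
          J = jacobian (local_rep f c d) (at (snd c x))
      in transpose J ** g d (f x) ** J)"

section \<open>Causal character of points of a surface\<close>

text \<open>From here on \<open>A\<close> is an atlas of a surface and \<open>h\<close> its first fundamental form.\<close>

definition pos_def_form :: "real^2^2 \<Rightarrow> bool" where
  "pos_def_form m \<longleftrightarrow> (\<forall>v. v \<noteq> 0 \<longrightarrow> v \<bullet> (m *v v) > 0)"

definition null_vector :: "real^2^2 \<Rightarrow> real^2 \<Rightarrow> bool" where
  "null_vector m v \<longleftrightarrow> v \<noteq> 0 \<and> (\<forall>w. v \<bullet> (m *v w) = 0)"

definition degenerate_form :: "real^2^2 \<Rightarrow> bool" where
  "degenerate_form m \<longleftrightarrow> (\<exists>v. null_vector m v)"

definition indefinite_form :: "real^2^2 \<Rightarrow> bool" where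
  "indefinite_form m \<longleftrightarrow> (\<exists>v. v \<bullet> (m *v v) > 0) \<and> (\<exists>v. v \<bullet> (m *v v) < 0)"

definition spacelike_point ::
    "('a::topological_space, 2) chart set \<Rightarrow> ('a, 2) components \<Rightarrow> 'a \<Rightarrow> bool" where
  "spacelike_point A h x \<longleftrightarrow> (\<exists>c\<in>coord_systems A. x \<in> fst c \<and> pos_def_form (h c x))"

definition timelike_point ::
    "('a::topological_space, 2) chart set \<Rightarrow> ('a, 2) components \<Rightarrow> 'a \<Rightarrow> bool" where
  "timelike_point A h x \<longleftrightarrow>
     (\<exists>c\<in>coord_systems A. x \<in> fst c \<and> indefinite_form (h c x) \<and> \<not> degenerate_form (h c x))"

definition LD :: "('a::topological_space, 2) chart set \<Rightarrow> ('a, 2) components \<Rightarrow> 'a set" where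
  "LD A h = {x. \<exists>c\<in>coord_systems A. x \<in> fst c \<and> degenerate_form (h c x)}"

definition mixed_type ::
    "('a::topological_space, 2) chart set \<Rightarrow> ('a, 2) components \<Rightarrow> bool" where
  "mixed_type A h \<longleftrightarrow> (\<exists>x. spacelike_point A h x) \<and> (\<exists>x. timelike_point A h x)"

section \<open>Coefficient functions in local coordinates\<close>

definition coefE :: "('a, 2) components \<Rightarrow> ('a, 2) chart \<Rightarrow> real^2 \<Rightarrow> real" where
  "coefE h c w = h c (chart_inv c w) $ 1 $ 1"

definition coefF :: "('a, 2) components \<Rightarrow> ('a, 2) chart \<Rightarrow> real^2 \<Rightarrow> real" where
  "coefF h c w = h c (chart_inv c w) $ 1 $ 2"

definition coefG :: "('a, 2) components \<Rightarrow> ('a, 2) chart \<Rightarrow> real^2 \<Rightarrow> real" where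
  "coefG h c w = h c (chart_inv c w) $ 2 $ 2"

definition lam :: "('a, 2) components \<Rightarrow> ('a, 2) chart \<Rightarrow> real^2 \<Rightarrow> real" where
  "lam h c w = coefE h c w * coefG h c w - (coefF h c w)\<^sup>2"

definition d_u :: "(real^2 \<Rightarrow> real) \<Rightarrow> real^2 \<Rightarrow> real" where
  "d_u \<phi> w = frechet_derivative \<phi> (at w) (axis 1 1)"

definition d_v :: "(real^2 \<Rightarrow> real) \<Rightarrow> real^2 \<Rightarrow> real" where
  "d_v \<phi> w = frechet_derivative \<phi> (at w) (axis 2 1)"

section \<open>Kinds of lightlike points\<close>

definition nondegenerate_lightlike ::
    "('a::topological_space, 2) chart set \<Rightarrow> ('a, 2) components \<Rightarrow> 'a \<Rightarrow> bool" where
  "nondegenerate_lightlike A h p \<longleftrightarrow> p \<in> LD A h \<and>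
     (\<exists>c\<in>coord_systems A. p \<in> fst c \<and> frechet_derivative (lam h c) (at (snd c p)) \<noteq> (\<lambda>_. 0))"

definition velocity :: "('a, 2) chart \<Rightarrow> (real \<Rightarrow> 'a) \<Rightarrow> real \<Rightarrow> real^2" where
  "velocity c \<gamma> t = vector_derivative (snd c \<circ> \<gamma>) (at t)"

text \<open>A regular curve inside the domain of \<open>c\<close>, passing through \<open>p\<close> at time 0, whose image is the
  set of lightlike points near \<open>p\<close>.\<close>

definition characteristic_curve ::
    "('a::topological_space, 2) chart set \<Rightarrow> ('a, 2) components \<Rightarrow> ('a, 2) chart \<Rightarrow> 'a \<Rightarrow>
     (real \<Rightarrow> 'a) \<Rightarrow> bool" where
  "characteristic_curve A h c p \<gamma> \<longleftrightarrow> c \<in> coord_systems A \<and> \<gamma> 0 = p \<and>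
     (\<exists>e>0. \<gamma> ` {-e<..<e} \<subseteq> fst c \<and>
        smooth_on {-e<..<e} (snd c \<circ> \<gamma>) \<and>
        (\<forall>t\<in>{-e<..<e}. velocity c \<gamma> t \<noteq> 0) \<and>
        (\<exists>W. open W \<and> p \<in> W \<and> LD A h \<inter> W = \<gamma> ` {-e<..<e}))"

text \<open>Vector fields are given by their components with respect to the coordinate system \<open>c\<close>.\<close>

definition null_vector_field ::
    "('a::topological_space, 2) chart set \<Rightarrow> ('a, 2) components \<Rightarrow> ('a, 2) chart \<Rightarrow> 'a set \<Rightarrow>
     ('a \<Rightarrow> real^2) \<Rightarrow> bool" where
  "null_vector_field A h c U \<eta> \<longleftrightarrow> c \<in> coord_systems A \<and> open U \<and> U \<subseteq> fst c \<and>
     smooth_on (snd c ` U) (\<eta> \<circ> chart_inv c) \<and>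
     (\<forall>q\<in>LD A h \<inter> U. null_vector (h c q) (\<eta> q))"

definition char_data ::
    "('a::topological_space, 2) chart set \<Rightarrow> ('a, 2) components \<Rightarrow> 'a \<Rightarrow> ('a, 2) chart \<Rightarrow>
     (real \<Rightarrow> 'a) \<Rightarrow> ('a \<Rightarrow> real^2) \<Rightarrow> bool" where
  "char_data A h p c \<gamma> \<eta> \<longleftrightarrow> characteristic_curve A h c p \<gamma> \<and>
     (\<exists>U. p \<in> U \<and> null_vector_field A h c U \<eta>)"

definition lin_indep2 :: "real^2 \<Rightarrow> real^2 \<Rightarrow> bool" where
  "lin_indep2 x y \<longleftrightarrow> x \<noteq> y \<and> independent {x, y}"

definition first_kind ::
    "('a::topological_space, 2) chart set \<Rightarrow> ('a, 2) components \<Rightarrow> 'a \<Rightarrow> bool" where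
  "first_kind A h p \<longleftrightarrow> nondegenerate_lightlike A h p \<and>
     (\<exists>c \<gamma> \<eta>. char_data A h p c \<gamma> \<eta> \<and> lin_indep2 (velocity c \<gamma> 0) (\<eta> (\<gamma> 0)))"

definition second_kind ::
    "('a::topological_space, 2) chart set \<Rightarrow> ('a, 2) components \<Rightarrow> 'a \<Rightarrow> bool" where
  "second_kind A h p \<longleftrightarrow> nondegenerate_lightlike A h p \<and>
     (\<exists>c \<gamma> \<eta>. char_data A h p c \<gamma> \<eta> \<and> \<not> lin_indep2 (velocity c \<gamma> 0) (\<eta> (\<gamma> 0)))"

definition admissible_second_kind ::
    "('a::topological_space, 2) chart set \<Rightarrow> ('a, 2) components \<Rightarrow> 'a \<Rightarrow> bool" where
  "admissible_second_kind A h p \<longleftrightarrow> second_kind A h p \<and>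
     (\<forall>W. open W \<and> p \<in> W \<longrightarrow> (\<exists>q\<in>W. first_kind A h q))"

definition delta :: "('a, 2) chart \<Rightarrow> (real \<Rightarrow> 'a) \<Rightarrow> ('a \<Rightarrow> real^2) \<Rightarrow> real \<Rightarrow> real" where
  "delta c \<gamma> \<eta> t = det (vector [velocity c \<gamma> t, \<eta> (\<gamma> t)] :: real^2^2)"

definition L3_point ::
    "('a::topological_space, 2) chart set \<Rightarrow> ('a, 2) components \<Rightarrow> 'a \<Rightarrow> bool" where
  "L3_point A h p \<longleftrightarrow> nondegenerate_lightlike A h p \<and>
     (\<exists>c \<gamma> \<eta>. char_data A h p c \<gamma> \<eta> \<and> delta c \<gamma> \<eta> 0 = 0 \<and> deriv (delta c \<gamma> \<eta>) 0 \<noteq> 0)"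

section \<open>Balancing curvature\<close>

definition adapted ::
    "('a::topological_space, 2) chart set \<Rightarrow> ('a, 2) components \<Rightarrow> 'a \<Rightarrow> ('a, 2) chart \<Rightarrow> bool" where
  "adapted A h q c \<longleftrightarrow> c \<in> coord_systems A \<and> q \<in> fst c \<and> snd c q = 0 \<and>
     null_vector_field A h c (fst c) (\<lambda>_. axis 2 1) \<and>
     LD A h \<inter> fst c = {x \<in> fst c. snd c x $ 2 = 0}"

definition specially_adapted ::
    "('a::topological_space, 2) chart set \<Rightarrow> ('a, 2) components \<Rightarrow> 'a \<Rightarrow> ('a, 2) chart \<Rightarrow> bool" where
  "specially_adapted A h q c \<longleftrightarrow> adapted A h q c \<and>
     (\<forall>w\<in>snd c ` fst c. w $ 2 = 0 \<longrightarrow> coefE h c w = 1 \<and> d_v (lam h c) w = 1)"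

definition balancing_expr :: "('a, 2) components \<Rightarrow> ('a, 2) chart \<Rightarrow> real" where
  "balancing_expr h c =
     - (1/2) * d_v (d_v (coefE h c)) 0 + d_v (d_u (coefF h c)) 0
     + d_v (coefE h c) 0 / 10 * (d_v (d_v (coefG h c)) 0 - 2 * (d_v (coefF h c) 0)\<^sup>2)"

text \<open>Meaningful at lightlike points of the first kind, where the value is the same in all specially
  adapted coordinate systems centered at \<open>q\<close>.\<close>

definition balancing_curvature ::
    "('a::topological_space, 2) chart set \<Rightarrow> ('a, 2) components \<Rightarrow> 'a \<Rightarrow> real" where
  "balancing_curvature A h q = (THE k. \<exists>c. specially_adapted A h q c \<and> k = balancing_expr h c)"

end

theory Submission
  imports Defs
begin

text \<open>Near \<open>p\<close> there are coordinates \<open>(x, y)\<close> in which the lightlike set is the \<open>x\<close>-axis: the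
  discriminant \<open>\<lambda>\<close> of some coordinate system has nonzero differential, so it can serve as second
  coordinate. A point of the second kind has the null direction \<open>\<partial>\<^sub>x\<close>, hence \<open>E = F = 0\<close> there. A degenerate plane in
  Minkowski space is positive semidefinite, so \<open>G > 0\<close> near \<open>p\<close>, and completing the square gives
  \<open>ds\<^sup>2 = b\<^sup>2 (dy + r dx)\<^sup>2 + \<Lambda> dx\<^sup>2\<close> with \<open>b = sqrt G\<close>, \<open>r = F / G\<close> and \<open>\<Lambda> = \<lambda> / G\<close>. On the axis
  \<open>\<Lambda>\<close> vanishes, \<open>k = \<Lambda>\<^sub>y\<close> does not, and \<open>\<partial>\<^sub>x - r \<partial>\<^sub>y\<close> is null. So \<open>r\<close> measures the angle between the
  null direction and the lightlike set: it vanishes at \<open>p\<close>, not at points of the first kind, and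
  \<open>p\<close> is an \<open>L\<^sub>3\<close>-point as soon as \<open>r\<^sub>x \<noteq> 0\<close> there (\<open>L3_point_of_slope\<close>).

  The heart of the proof is the formula \<open>\<kappa>\<^sub>B = Q / (b\<^sup>2 r\<^sup>2 \<bar>k r\<bar>\<^bsup>2/3\<^esup>)\<close> at points of the first kind
  (\<open>special_formula\<close>, \<open>balancing_curvature_formula\<close>), in which \<open>Q\<close> is a smooth function built from derivatives of
  \<open>r, b, \<Lambda>\<close> up to the second order, with \<open>Q = (k / 5) (2 r\<^sub>x - k / b\<^sup>2)\<close> where \<open>r = 0\<close>. It holds for every specially
  adapted coordinate system: the defining conditions fix the Taylor coefficients of the coordinate
  change that matter, and the free ones cancel (\<open>balancing_jet_identity\<close>). A particular system is
  written down in \<open>specially_adapted_exists\<close>, so that \<open>\<kappa>\<^sub>B\<close> is well defined.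

  If \<open>r\<^sub>x = 0\<close> at \<open>p\<close>, in particular if \<open>p\<close> is not an \<open>L\<^sub>3\<close>-point, then \<open>Q\<close> tends to \<open>- k\<^sup>2 / (5 b\<^sup>2) < 0\<close> and the
  denominator to \<open>0\<close> from above. If \<open>r\<^sub>x \<noteq> 0\<close>, the denominator is comparable to \<open>\<bar>x\<bar>\<^bsup>8/3\<^esup>\<close>. The
  exponent is not an integer: either \<open>Q\<close> vanishes at most to second order and the quotient diverges,
  or \<open>Q = O(x\<^sup>3)\<close> and it tends to \<open>0\<close> (\<open>smooth_over_fractional_power\<close>).\<close>

section \<open>Calculus of smooth maps\<close>

lemma C_k_on_cong:
  assumes "open S" "\<And>x. x \<in> S \<Longrightarrow> f x = g x" "C_k_on k S f"
  shows "C_k_on k S g"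
  using assms(2,3)
proof (induction k arbitrary: f g)
  case 0 then show ?case by (simp cong: continuous_on_cong)
next
  case (Suc k)
  have D: "(g has_derivative F) (at x)" if "x \<in> S" "(f has_derivative F) (at x)" for x F
    using has_derivative_transform_within_open[OF that(2) assms(1) that(1)] Suc.prems(1) by blast
  have d: "g differentiable (at x)" if "x \<in> S" for x
    using D[OF that] Suc.prems(2) that unfolding C_k_on.simps differentiable_def by blast
  have e: "frechet_derivative f (at x) = frechet_derivative g (at x)" if "x \<in> S" for x
  proof (rule frechet_derivative_at[OF D[OF that]])
    show "(f has_derivative frechet_derivative f (at x)) (at x)"
      using Suc.prems(2) that by (simp only: C_k_on.simps flip: frechet_derivative_works)
  qed
  have "C_k_on k S (\<lambda>x. frechet_derivative g (at x) v)" for v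
    by (rule Suc.IH[of "\<lambda>x. frechet_derivative f (at x) v"]) (use Suc.prems(2) e in simp_all)
  then show ?case using d by simp
qed

lemma C_k_on_subset: "C_k_on k S f \<Longrightarrow> T \<subseteq> S \<Longrightarrow> C_k_on k T f"
  by (induction k arbitrary: f) (auto intro: continuous_on_subset)

lemma C_k_on_continuous: "C_k_on k S f \<Longrightarrow> continuous_on S f"
  by (cases k) (auto intro!: differentiable_imp_continuous_on differentiable_at_imp_differentiable_on)

lemma C_k_on_Suc_imp: "C_k_on (Suc k) S f \<Longrightarrow> C_k_on k S f"
proof (induction k arbitrary: f)
  case 0 then show ?case using C_k_on_continuous[of "Suc 0"] by simp
qed auto

text \<open>The derivative in the definition of \<open>C_k_on\<close> is a choice, accessible only through a proved derivative.
  With this rule, inductions on the order can work with explicit formulas instead.\<close>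

lemma C_k_on_SucI:
  assumes "open S" "\<And>x. x \<in> S \<Longrightarrow> (f has_derivative f' x) (at x)"
    and "\<And>v. C_k_on k S (\<lambda>x. f' x v)"
  shows "C_k_on (Suc k) S f"
proof -
  have e: "f' x = frechet_derivative f (at x)" if "x \<in> S" for x
    using assms(2)[OF that] by (rule frechet_derivative_at)
  have "C_k_on k S (\<lambda>x. frechet_derivative f (at x) v)" for v
    by (rule C_k_on_cong[OF assms(1) _ assms(3)[of v]]) (simp add: e)
  moreover have "f differentiable (at x)" if "x \<in> S" for x
    using assms(2)[OF that] by (rule differentiableI)
  ultimately show ?thesis by (simp only: C_k_on.simps) blast
qed

lemma C_k_on_Suc_has_derivative:
  "C_k_on (Suc k) S f \<Longrightarrow> x \<in> S \<Longrightarrow> (f has_derivative frechet_derivative f (at x)) (at x)"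
  using frechet_derivative_works[of f "at x"] by (simp only: C_k_on.simps)

lemma C_k_on_local:
  assumes "\<And>x. x \<in> S \<Longrightarrow> \<exists>T. open T \<and> x \<in> T \<and> C_k_on k T f"
  shows "C_k_on k S f"
  using assms
proof (induction k arbitrary: f)
  case 0
  have "isCont f x" if "x \<in> S" for x
    using 0[OF that] by (auto simp: continuous_on_eq_continuous_at)
  then show ?case by (simp add: continuous_at_imp_continuous_on)
next
  case (Suc k) 
  have "f differentiable (at x)" if "x \<in> S" for x using Suc.prems[OF that] by auto
  moreover have "C_k_on k S (\<lambda>x. frechet_derivative f (at x) v)" for v
    by (rule Suc.IH) (use Suc.prems in \<open>simp, blast\<close>)
  ultimately show ?case by auto
qed

lemma C_k_on_const: "C_k_on k S (\<lambda>x. c)"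
  by (induction k arbitrary: c) (auto simp: frechet_derivative_const)

lemma C_k_on_bounded_linear:
  assumes "bounded_linear L" "open S" "C_k_on k S f"
  shows "C_k_on k S (\<lambda>x. L (f x))"
  using assms(3)
proof (induction k arbitrary: f)
  case 0 then show ?case using bounded_linear.continuous_on[OF assms(1)] by auto
next
  case (Suc k)
  show ?case
  proof (rule C_k_on_SucI[OF assms(2)])
    show "((\<lambda>x. L (f x)) has_derivative (\<lambda>v. L (frechet_derivative f (at x) v))) (at x)"
      if "x \<in> S" for x
      by (rule bounded_linear.has_derivative[OF assms(1) C_k_on_Suc_has_derivative[OF Suc.prems that]])
    show "C_k_on k S (\<lambda>x. L (frechet_derivative f (at x) v))" for v
      by (rule Suc.IH) (use Suc.prems in simp)
  qed
qed

lemma C_k_on_id: "open S \<Longrightarrow> C_k_on k S (\<lambda>x. x)"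
  by (cases k) (auto intro!: C_k_on_SucI[where f'="\<lambda>x v. v"] C_k_on_const)

lemma C_k_on_add:
  assumes "open S" "C_k_on k S f" "C_k_on k S g"
  shows "C_k_on k S (\<lambda>x. f x + g x)"
  using assms(2,3)
proof (induction k arbitrary: f g)
  case (Suc k)
  show ?case
  proof (rule C_k_on_SucI[OF assms(1)])
    show "((\<lambda>x. f x + g x) has_derivative
        (\<lambda>v. frechet_derivative f (at x) v + frechet_derivative g (at x) v)) (at x)" if "x \<in> S" for x
      by (intro has_derivative_add 
        C_k_on_Suc_has_derivative[OF Suc.prems(1) that] C_k_on_Suc_has_derivative[OF Suc.prems(2) that])
    show "C_k_on k S (\<lambda>x. frechet_derivative f (at x) v + frechet_derivative g (at x) v)" for v
      by (rule Suc.IH) (use Suc.prems in simp_all)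
  qed
qed (auto intro: continuous_intros)

lemma C_k_on_bilinear:
  assumes "bounded_bilinear pr" "open S" "C_k_on k S f" "C_k_on k S g"
  shows "C_k_on k S (\<lambda>x. pr (f x) (g x))"
  using assms(3,4)
proof (induction k arbitrary: f g)
  case 0 then show ?case using bounded_bilinear.continuous_on[OF assms(1)] by auto
next
  case (Suc k)
  note p = C_k_on_Suc_imp[OF Suc.prems(1)] C_k_on_Suc_imp[OF Suc.prems(2)]
  show ?case
  proof (rule C_k_on_SucI[OF assms(2)])
    show "((\<lambda>x. pr (f x) (g x)) has_derivative (\<lambda>v. pr (f x) (frechet_derivative g (at x) v) +
        pr (frechet_derivative f (at x) v) (g x))) (at x)" if "x \<in> S" for x
      by (intro bounded_bilinear.FDERIV[OF assms(1)] 
        C_k_on_Suc_has_derivative[OF Suc.prems(1) that] C_k_on_Suc_has_derivative[OF Suc.prems(2) that])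
    show "C_k_on k S (\<lambda>x. pr (f x) (frechet_derivative g (at x) v) +
        pr (frechet_derivative f (at x) v) (g x))" for v
      by (intro C_k_on_add[OF assms(2)] Suc.IH p) (use Suc.prems in simp_all)
  qed
qed

lemma C_k_on_sum:
  assumes "open S" "finite I" "\<And>i. i \<in> I \<Longrightarrow> C_k_on k S (f i)"
  shows "C_k_on k S (\<lambda>x. \<Sum>i\<in>I. f i x)"
  using assms(2,3) by (induction I) (auto intro: C_k_on_add C_k_on_const assms(1))

text \<open>The derivative of a composition is again built from compositions, but with a point-dependent
  direction. Expanding that direction in the standard basis leaves only compositions with fixed
  directional derivatives, to which the induction hypothesis applies.\<close>

lemma C_k_on_compose:
  fixes f :: "'b::euclidean_space \<Rightarrow> 'c::real_normed_vector"
  assumes "open S" "open T" "g ` S \<subseteq> T" "C_k_on k T f" "C_k_on k S g"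
  shows "C_k_on k S (\<lambda>x. f (g x))"
  using assms(4,5)
proof (induction k arbitrary: f)
  case 0 then show ?case using assms(3) by (auto intro: continuous_on_compose2)
next
  case (Suc k)
  let ?D = "\<lambda>x v. \<Sum>b\<in>Basis. (frechet_derivative g (at x) v \<bullet> b) *\<^sub>R frechet_derivative f (at (g x)) b"
  have "((\<lambda>x. f (g x)) has_derivative ?D x) (at x)" if "x \<in> S" for x
  proof -
    have gx: "g x \<in> T" using assms(3) that by auto
    have *: "((\<lambda>x. f (g x)) has_derivative (\<lambda>v. frechet_derivative f (at (g x)) (frechet_derivative g (at x) v))) (at x)"
      by (rule has_derivative_compose[OF C_k_on_Suc_has_derivative[OF Suc.prems(2) that]
          C_k_on_Suc_has_derivative[OF Suc.prems(1) gx]])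
    have L: "linear (frechet_derivative f (at (g x)))"
      using C_k_on_Suc_has_derivative[OF Suc.prems(1) gx] has_derivative_linear by blast
    have "frechet_derivative f (at (g x)) w = (\<Sum>b\<in>Basis. (w \<bullet> b) *\<^sub>R frechet_derivative f (at (g x)) b)" for w
      by (subst euclidean_representation[symmetric, of w])
        (simp only: linear_sum[OF L] linear_cmul[OF L])
    then have "(\<lambda>v. frechet_derivative f (at (g x)) (frechet_derivative g (at x) v)) = ?D x"
      by blast
    then show ?thesis using * by (simp only:)
  qed
  then show ?case
  proof (rule C_k_on_SucI[OF assms(1)])
    fix v
    have 1: "C_k_on k S (\<lambda>x. frechet_derivative f (at (g x)) b)" for b
      using Suc.IH[of "\<lambda>y. frechet_derivative f (at y) b"] Suc.prems C_k_on_Suc_imp by auto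
    have 2: "C_k_on k S (\<lambda>x. frechet_derivative g (at x) v \<bullet> b)" for b
      by (rule C_k_on_bounded_linear[OF bounded_linear_inner_left assms(1)]) (use Suc.prems in simp)
    show "C_k_on k S (\<lambda>x. ?D x v)"
      by (intro C_k_on_sum C_k_on_bilinear[OF bounded_bilinear_scaleR] 1 2 assms(1) finite_Basis)
  qed auto
qed

lemma smooth_on_cong:
  "open S \<Longrightarrow> (\<And>x. x \<in> S \<Longrightarrow> f x = g x) \<Longrightarrow> smooth_on S f \<Longrightarrow> smooth_on S g"
  unfolding smooth_on_def using C_k_on_cong by blast

lemma smooth_on_eqI:
  assumes "open S" "smooth_on S g" "\<And>x. x \<in> S \<Longrightarrow> f x = g x"
  shows "smooth_on S f"
  by (rule smooth_on_cong[OF assms(1) _ assms(2)]) (simp add: assms(3))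

lemma smooth_on_subset: "smooth_on S f \<Longrightarrow> T \<subseteq> S \<Longrightarrow> smooth_on T f"
  unfolding smooth_on_def using C_k_on_subset by blast

lemma smooth_on_local:
  "(\<And>x. x \<in> S \<Longrightarrow> \<exists>T. open T \<and> x \<in> T \<and> smooth_on T f) \<Longrightarrow> smooth_on S f"
  unfolding smooth_on_def by (meson C_k_on_local)

lemma smooth_on_continuous: "smooth_on S f \<Longrightarrow> continuous_on S f"
  unfolding smooth_on_def using C_k_on.simps(1) by blast

lemma smooth_on_differentiable: "smooth_on S f \<Longrightarrow> x \<in> S \<Longrightarrow> f differentiable (at x)"
  unfolding smooth_on_def by (metis C_k_on.simps(2))

lemma smooth_on_has_derivative:
  "smooth_on S f \<Longrightarrow> x \<in> S \<Longrightarrow> (f has_derivative frechet_derivative f (at x)) (at x)"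
  using smooth_on_differentiable frechet_derivative_works by blast

lemma smooth_on_deriv: "smooth_on S f \<Longrightarrow> smooth_on S (\<lambda>x. frechet_derivative f (at x) v)"
  unfolding smooth_on_def by (metis C_k_on.simps(2))

lemma smooth_onI:
  assumes "open S" "\<And>x. x \<in> S \<Longrightarrow> (f has_derivative f' x) (at x)"
    and "\<And>v. smooth_on S (\<lambda>x. f' x v)"
  shows "smooth_on S f"
  using C_k_on_Suc_imp[OF C_k_on_SucI[OF assms(1,2)]] assms(3) by (auto simp only: smooth_on_def)

lemma smooth_on_const: "smooth_on S (\<lambda>x. c)"
  by (simp add: smooth_on_def C_k_on_const)

lemma smooth_on_id: "open S \<Longrightarrow> smooth_on S (\<lambda>x. x)"
  by (simp add: smooth_on_def C_k_on_id)

lemma smooth_on_add: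
  "open S \<Longrightarrow> smooth_on S f \<Longrightarrow> smooth_on S g \<Longrightarrow> smooth_on S (\<lambda>x. f x + g x)"
  by (simp add: smooth_on_def C_k_on_add)

lemma smooth_on_bounded_linear:
  "bounded_linear L \<Longrightarrow> open S \<Longrightarrow> smooth_on S f \<Longrightarrow> smooth_on S (\<lambda>x. L (f x))"
  using C_k_on_bounded_linear[of L S _ f] by (auto simp only: smooth_on_def)

lemma smooth_on_bilinear:
  "bounded_bilinear pr \<Longrightarrow> open S \<Longrightarrow> smooth_on S f \<Longrightarrow> smooth_on S g \<Longrightarrow>
    smooth_on S (\<lambda>x. pr (f x) (g x))"
  using C_k_on_bilinear[of pr S _ f g] by (auto simp only: smooth_on_def)

lemma smooth_on_compose:
  fixes f :: "'b::euclidean_space \<Rightarrow> 'c::real_normed_vector"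
  assumes "open S" "open T" "g ` S \<subseteq> T" "smooth_on T f" "smooth_on S g"
  shows "smooth_on S (\<lambda>x. f (g x))"
  using C_k_on_compose[OF assms(1-3)] assms(4,5) by (auto simp only: smooth_on_def)

lemma smooth_on_mult:
  fixes f g :: "'a::real_normed_vector \<Rightarrow> 'b::real_normed_algebra"
  shows "open S \<Longrightarrow> smooth_on S f \<Longrightarrow> smooth_on S g \<Longrightarrow> smooth_on S (\<lambda>x. f x * g x)"
  by (rule smooth_on_bilinear[OF bounded_bilinear_mult])

lemma smooth_on_scaleR:
  "open S \<Longrightarrow> smooth_on S f \<Longrightarrow> smooth_on S g \<Longrightarrow> smooth_on S (\<lambda>x. f x *\<^sub>R g x)"
  by (rule smooth_on_bilinear[OF bounded_bilinear_scaleR])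

lemma smooth_on_minus: "open S \<Longrightarrow> smooth_on S f \<Longrightarrow> smooth_on S (\<lambda>x. - f x)"
  by (rule smooth_on_bounded_linear[OF bounded_linear_minus[OF bounded_linear_ident]])

lemma smooth_on_diff:
  "open S \<Longrightarrow> smooth_on S f \<Longrightarrow> smooth_on S g \<Longrightarrow> smooth_on S (\<lambda>x. f x - g x)"
  using smooth_on_add[of S f "\<lambda>x. - g x"] smooth_on_minus[of S g] by simp

lemma smooth_on_power:
  fixes f :: "'a::real_normed_vector \<Rightarrow> real"
  shows "open S \<Longrightarrow> smooth_on S f \<Longrightarrow> smooth_on S (\<lambda>x. f x ^ n)"
  by (induction n) (auto intro: smooth_on_const smooth_on_mult)

lemma smooth_on_sum:
  assumes "open S" "finite I" "\<And>i. i \<in> I \<Longrightarrow> smooth_on S (f i)"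
  shows "smooth_on S (\<lambda>x. \<Sum>i\<in>I. f i x)"
  using C_k_on_sum[OF assms(1,2)] assms(3) by (auto simp only: smooth_on_def)

lemma smooth_on_component: "open S \<Longrightarrow> smooth_on S f \<Longrightarrow> smooth_on S (\<lambda>x. f x $ i)"
  by (rule smooth_on_bounded_linear[OF bounded_linear_vec_nth])

lemma smooth_on_vecI:
  fixes f :: "'a::real_normed_vector \<Rightarrow> ('b::euclidean_space)^'n::finite"
  assumes "open S" "\<And>i. smooth_on S (\<lambda>x. f x $ i)"
  shows "smooth_on S f"
proof -
  have e: "(\<lambda>x. f x) = (\<lambda>x. \<Sum>i\<in>UNIV. axis i (f x $ i))"
    by (auto simp: vec_eq_iff axis_def)
  have "bounded_linear (axis i :: 'b \<Rightarrow> 'b^'n)" for i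
    unfolding linear_conv_bounded_linear[symmetric] by (rule linearI) (auto simp: axis_def vec_eq_iff)
  then have "smooth_on S (\<lambda>x. \<Sum>i\<in>UNIV. axis i (f x $ i))"
    by (intro smooth_on_sum assms(1) finite) (rule smooth_on_bounded_linear[OF _ assms(1,2)])
  then show ?thesis by (simp only: e[symmetric])
qed

text \<open>Real powers of a positive function cover reciprocals, square roots and cube roots.\<close>

lemma smooth_on_powr:
  fixes f :: "'a::real_normed_vector \<Rightarrow> real"
  assumes "open S" "smooth_on S f" "\<And>x. x \<in> S \<Longrightarrow> f x > 0"
  shows "smooth_on S (\<lambda>x. f x powr a)"
proof -
  have "C_k_on k {0<..} (\<lambda>x::real. x powr a)" for k a
  proof (induction k arbitrary: a)
    case 0 then show ?case by (auto intro!: continuous_intros)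
  next
    case (Suc k)
    show ?case
    proof (rule C_k_on_SucI[where f'="\<lambda>x v. v * (a * x powr (a - 1))"])
      show "((\<lambda>x. x powr a) has_derivative (\<lambda>v. v * (a * x powr (a - 1)))) (at x)"
        if "x \<in> {0<..}" for x :: real
        using has_real_derivative_powr[of x a] that
        by (simp add: has_field_derivative_def mult.commute[of _ "_ * _"])
      show "C_k_on k {0<..} (\<lambda>x. v * (a * x powr (a - 1)))" for v
        by (intro C_k_on_bilinear[OF bounded_bilinear_mult] C_k_on_const Suc.IH) auto
    qed auto
  qed
  then have "smooth_on {0<..} (\<lambda>x::real. x powr a)" by (simp add: smooth_on_def)
  from smooth_on_compose[OF assms(1) _ _ this assms(2)] assms(3) show ?thesis by auto
qed

text \<open>Passing through the square covers both signs.\<close>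

lemma smooth_on_inverse:
  fixes f :: "'a::real_normed_vector \<Rightarrow> real"
  assumes "open S" "smooth_on S f" "\<And>x. x \<in> S \<Longrightarrow> f x \<noteq> 0"
  shows "smooth_on S (\<lambda>x. inverse (f x))"
proof -
  have "smooth_on S (\<lambda>x. f x * (f x * f x) powr (-1))"
    by (intro smooth_on_mult smooth_on_powr assms)
      (use assms(3) in \<open>auto simp: zero_less_mult_iff linorder_neq_iff\<close>)
  then show ?thesis
    by (rule smooth_on_cong[OF assms(1), rotated])
      (use assms(3) in \<open>auto simp: powr_minus field_simps\<close>)
qed

lemma smooth_on_divide:
  fixes f g :: "'a::real_normed_vector \<Rightarrow> real"
  assumes "open S" "smooth_on S f" "smooth_on S g" "\<And>x. x \<in> S \<Longrightarrow> g x \<noteq> 0"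
  shows "smooth_on S (\<lambda>x. f x / g x)"
  unfolding divide_inverse by (intro smooth_on_mult smooth_on_inverse assms)

lemma smooth_on_sqrt:
  fixes f :: "'a::real_normed_vector \<Rightarrow> real"
  assumes "open S" "smooth_on S f" "\<And>x. x \<in> S \<Longrightarrow> f x > 0"
  shows "smooth_on S (\<lambda>x. sqrt (f x))"
  by (rule smooth_on_cong[OF assms(1) _ smooth_on_powr[OF assms, of "1/2"]])
    (use assms(3) in \<open>auto simp: powr_half_sqrt less_imp_le\<close>)

lemmas smooth_intros = smooth_on_const smooth_on_id smooth_on_add smooth_on_mult smooth_on_scaleR
  smooth_on_minus smooth_on_diff smooth_on_power smooth_on_divide smooth_on_sqrt smooth_on_component

section \<open>The smooth inverse function theorem in the plane\<close>

lemma vec2_eq_axes: "(w::real^2) = (w $ 1) *\<^sub>R axis 1 1 + (w $ 2) *\<^sub>R axis 2 1"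
  by (simp add: vec_eq_iff forall_2 axis_def)

text \<open>The derivative of an inverse is given by Cramer's rule, a rational expression in the partial
  derivatives of the map at the inverse point. This gains one order of differentiability.\<close>

lemma smooth_on_inverse_map:
  fixes f g :: "real^2 \<Rightarrow> real^2"
  assumes "open U" "open V" "smooth_on U f" "g ` V \<subseteq> U" "\<And>y. y \<in> V \<Longrightarrow> f (g y) = y"
    and "\<And>y. y \<in> V \<Longrightarrow> (g has_derivative g' y) (at y)"
    and "\<And>x. x \<in> U \<Longrightarrow> det (jacobian f (at x)) \<noteq> 0"
  shows "smooth_on V g"
proof -
  define J where "J x i j = frechet_derivative f (at x) (axis j 1) $ i" for x and i j :: 2
  have sJ: "smooth_on U (\<lambda>x. J x i j)" for i j
    unfolding J_def by (intro smooth_on_component smooth_on_deriv assms)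
  define d where "d x = J x 1 1 * J x 2 2 - J x 1 2 * J x 2 1" for x
  have d: "d x \<noteq> 0" if "x \<in> U" for x
    using assms(7)[OF that] by (simp add: d_def J_def det_2 jacobian_def matrix_def)
  define M where "M v x = (vector [(J x 2 2 * v $ 1 - J x 1 2 * v $ 2) / d x,
       (J x 1 1 * v $ 2 - J x 2 1 * v $ 1) / d x] :: real^2)" for v :: "real^2" and x
  have sM: "smooth_on U (M v)" for v
  proof (rule smooth_on_vecI[OF assms(1)])
    fix i :: 2
    consider "i = 1" | "i = 2" using exhaust_2 by blast
    then show "smooth_on U (\<lambda>x. M v x $ i)"
      by cases (auto simp: M_def d_def intro!: smooth_intros sJ assms(1) d[unfolded d_def])
  qed
  have g': "g' y v = M v (g y)" if y: "y \<in> V" for y v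
  proof -
    have gy: "g y \<in> U" using assms(4) y by auto
    let ?F = "frechet_derivative f (at (g y))"
    have D: "((\<lambda>y. f (g y)) has_derivative (\<lambda>v. ?F (g' y v))) (at y)"
      by (rule has_derivative_compose[OF assms(6)[OF y] smooth_on_has_derivative[OF assms(3) gy]])
    have "((\<lambda>y. y) has_derivative (\<lambda>v. ?F (g' y v))) (at y)"
      by (rule has_derivative_transform_within_open[OF D assms(2) y]) (use assms(5) in auto)
    then have id: "?F (g' y v) = v"
      by (metis has_derivative_ident has_derivative_unique)
    have L: "linear ?F" using smooth_on_has_derivative[OF assms(3) gy] has_derivative_linear by blast
    have "?F w $ i = w $ 1 * J (g y) i 1 + w $ 2 * J (g y) i 2" for w i
      by (subst vec2_eq_axes[of w]) (simp add: linear_add[OF L] linear_cmul[OF L] J_def)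
    from this[of "g' y v" 1] this[of "g' y v" 2]
    have 1: "v $ 1 = (g' y v) $ 1 * J (g y) 1 1 + (g' y v) $ 2 * J (g y) 1 2"
      and 2: "v $ 2 = (g' y v) $ 1 * J (g y) 2 1 + (g' y v) $ 2 * J (g y) 2 2" by (auto simp: id)
    have "(g' y v) $ 1 * d (g y) = J (g y) 2 2 * v $ 1 - J (g y) 1 2 * v $ 2"
      "(g' y v) $ 2 * d (g y) = J (g y) 1 1 * v $ 2 - J (g y) 2 1 * v $ 1"
      unfolding d_def 1 2 by algebra+
    then show ?thesis using d[OF gy] by (simp add: M_def vec_eq_iff forall_2 field_simps)
  qed
  have "C_k_on k V g" for k
  proof (induction k)
    case 0 show ?case
      using assms(2,6) by (auto simp: continuous_on_eq_continuous_at intro: has_derivative_continuous)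
  next
    case (Suc k)
    show ?case
      by (rule C_k_on_SucI[OF assms(2,6)])
        (use C_k_on_compose[OF assms(2,1,4) _ Suc] sM in
          \<open>auto simp: smooth_on_def intro!: C_k_on_cong[OF assms(2) g'[symmetric]]\<close>)
  qed
  then show ?thesis by (simp add: smooth_on_def)
qed

text \<open>Invertibility of the derivative at one point is an open condition, so the inverse function theorem
  applies on the set where the Jacobian determinant does not vanish.\<close>

lemma smooth_local_inverse:
  fixes f :: "real^2 \<Rightarrow> real^2"
  assumes "open U" "smooth_on U f" "x0 \<in> U" "det (jacobian f (at x0)) \<noteq> 0"
  obtains U' g where "open U'" "U' \<subseteq> U" "x0 \<in> U'" "open (f ` U')"
    "homeomorphism U' (f ` U') f g" "smooth_on (f ` U') g"
    "\<And>x. x \<in> U' \<Longrightarrow> det (jacobian f (at x)) \<noteq> 0"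
proof -
  let ?d = "\<lambda>x. det (jacobian f (at x))"
  have "smooth_on U (\<lambda>x. frechet_derivative f (at x) (axis j 1) $ i)" for i j
    by (intro smooth_on_component smooth_on_deriv assms)
  then have "continuous_on U ?d"
    by (auto simp: det_2 jacobian_def matrix_def intro!: smooth_on_mult smooth_on_diff assms(1)
        smooth_on_continuous)
  then have oU: "open {x \<in> U. ?d x \<noteq> 0}" (is "open ?U")
    using continuous_open_preimage[OF _ assms(1), of ?d "- {0}"]
    by (simp add: open_Compl Collect_conj_eq vimage_def) (simp add: Int_def Compl_eq)?
  let ?f' = "\<lambda>x. Blinfun (frechet_derivative f (at x))"
  have bl: "bounded_linear (frechet_derivative f (at x))" if "x \<in> U" for x
    using smooth_on_has_derivative[OF assms(2) that] has_derivative_bounded_linear by blast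
  have der: "(f has_derivative blinfun_apply (?f' x)) (at x)" if "x \<in> U" for x
    by (simp add: bounded_linear_Blinfun_apply bl that smooth_on_has_derivative[OF assms(2)])
  have cont: "continuous_on ?U ?f'"
  proof (rule continuous_on_blinfun_componentwise)
    fix i :: "real^2"
    have "continuous_on ?U (\<lambda>x. frechet_derivative f (at x) i)"
      by (rule smooth_on_continuous[OF smooth_on_subset[OF smooth_on_deriv[OF assms(2)]]]) auto
    then show "continuous_on ?U (\<lambda>x. ?f' x i)"
      by (rule continuous_on_eq) (simp add: bounded_linear_Blinfun_apply bl)
  qed
  have "invertible (jacobian f (at x0))" using assms(4) by (simp add: invertible_det_nz)
  then obtain B where B: "B ** jacobian f (at x0) = mat 1" unfolding invertible_def by blast
  have "(f has_derivative (*v) (jacobian f (at x0))) (at x0)"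
    using jacobian_works[of f "at x0"] smooth_on_differentiable[OF assms(2,3)] by simp
  then have "(*v) (jacobian f (at x0)) = frechet_derivative f (at x0)"
    by (rule frechet_derivative_at)
  then have "B *v frechet_derivative f (at x0) v = v" for v
    by (metis B matrix_vector_mul_assoc matrix_vector_mul_lid)
  then have inv: "Blinfun ((*v) B) o\<^sub>L ?f' x0 = id_blinfun"
    by (intro blinfun_eqI) (simp add: bounded_linear_Blinfun_apply bl assms(3))
  obtain U' V g g' where *: "open U'" "U' \<subseteq> ?U" "x0 \<in> U'" "open V" "f x0 \<in> V" "homeomorphism U' V f g"
    "\<And>y. y \<in> V \<Longrightarrow> (g has_derivative (g' y)) (at y)"
    by (rule inverse_function_theorem[OF oU _ cont _ inv]) (use der assms in blast)+
  have V: "V = f ` U'" using *(6) by (simp add: homeomorphism_def)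
  have "smooth_on V g"
    by (rule smooth_on_inverse_map[OF *(1,4) smooth_on_subset[OF assms(2)] _ _ *(7)])
      (use *(2,6) in \<open>auto simp: homeomorphism_def\<close>)
  then show ?thesis using * that[of U' g] unfolding V by auto
qed

section \<open>Partial derivatives in the plane\<close>

definition pd :: "2 \<Rightarrow> (real^2 \<Rightarrow> real) \<Rightarrow> real^2 \<Rightarrow> real" where
  "pd i \<phi> w = frechet_derivative \<phi> (at w) (axis i 1)"

lemma d_u_eq_pd: "d_u = pd 1" and d_v_eq_pd: "d_v = pd 2"
  by (auto simp: d_u_def d_v_def pd_def fun_eq_iff)

lemma smooth_on_pd: "smooth_on S \<phi> \<Longrightarrow> smooth_on S (pd i \<phi>)"
  unfolding pd_def by (rule smooth_on_deriv)

text \<open>Relational form of \<open>pd\<close>, whose rules compute the derivative of a compound expression without separate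
  differentiability side conditions.\<close>

definition has_pd :: "2 \<Rightarrow> (real^2 \<Rightarrow> real) \<Rightarrow> real^2 \<Rightarrow> real \<Rightarrow> bool" where
  "has_pd i \<phi> w D \<longleftrightarrow> (\<exists>F. (\<phi> has_derivative F) (at w) \<and> F (axis i 1) = D)"

lemma has_pd_imp_pd: "has_pd i \<phi> w D \<Longrightarrow> pd i \<phi> w = D"
  by (metis frechet_derivative_at has_pd_def pd_def)

lemma has_pd_smooth: "smooth_on S \<phi> \<Longrightarrow> w \<in> S \<Longrightarrow> has_pd i \<phi> w (pd i \<phi> w)"
  using smooth_on_has_derivative[of S \<phi> w] unfolding has_pd_def pd_def by blast

lemma has_pdI: "(\<phi> has_derivative F) (at w) \<Longrightarrow> F (axis i 1) = D \<Longrightarrow> has_pd i \<phi> w D"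
  unfolding has_pd_def by blast

lemma has_pdE:
  assumes "has_pd i \<phi> w D"
  obtains F where "(\<phi> has_derivative F) (at w)" "F (axis i 1) = D"
  using assms unfolding has_pd_def by blast

lemma has_pd_const: "has_pd i (\<lambda>w. c) w 0"
  by (rule has_pdI[OF has_derivative_const]) simp

lemma has_pd_add:
  "has_pd i \<phi> w a \<Longrightarrow> has_pd i \<psi> w b \<Longrightarrow> has_pd i (\<lambda>w. \<phi> w + \<psi> w) w (a + b)"
  by (elim has_pdE, rule has_pdI, rule has_derivative_add, assumption+, simp)

lemma has_pd_diff:
  "has_pd i \<phi> w a \<Longrightarrow> has_pd i \<psi> w b \<Longrightarrow> has_pd i (\<lambda>w. \<phi> w - \<psi> w) w (a - b)"
  by (elim has_pdE, rule has_pdI, rule has_derivative_diff, assumption+, simp)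

lemma has_pd_mult:
  "has_pd i \<phi> w a \<Longrightarrow> has_pd i \<psi> w b \<Longrightarrow> has_pd i (\<lambda>w. \<phi> w * \<psi> w) w (\<phi> w * b + a * \<psi> w)"
  by (elim has_pdE, rule has_pdI, rule has_derivative_mult, assumption+, simp)

lemma has_pd_power2:
  "has_pd i \<phi> w a \<Longrightarrow> has_pd i (\<lambda>w. (\<phi> w)\<^sup>2) w (2 * \<phi> w * a)"
  using has_pd_mult[of i \<phi> w a \<phi> a] by (simp add: power2_eq_square algebra_simps)

lemma has_pd_cong:
  assumes "open S" "w \<in> S" "\<And>x. x \<in> S \<Longrightarrow> \<phi> x = \<psi> x" "has_pd i \<phi> w D"
  shows "has_pd i \<psi> w D"
  using assms(4)
  by (elim has_pdE, intro has_pdI, intro has_derivative_transform_within_open[OF _ assms(1,2,3)])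

lemma pd_cong:
  assumes "open S" "w \<in> S" "\<And>x. x \<in> S \<Longrightarrow> \<phi> x = \<psi> x" "has_pd i \<psi> w D"
  shows "pd i \<phi> w = D"
  using has_pd_cong[OF assms(1,2) _ assms(4)] assms(3) by (auto intro: has_pd_imp_pd)

lemma pd_eqI:
  assumes "open S" "w \<in> S" "\<And>x. x \<in> S \<Longrightarrow> \<phi> x = \<psi> x" "has_pd i \<psi> w D" "D = D'"
  shows "pd i \<phi> w = D'"
  using pd_cong[OF assms(1-4)] assms(5) by simp

lemma has_pd_chain:
  fixes \<Phi> :: "real^2 \<Rightarrow> real^2"
  assumes "smooth_on T \<phi>" "\<Phi> w \<in> T" "smooth_on S \<Phi>" "open S" "w \<in> S"
  shows "has_pd i (\<lambda>w. \<phi> (\<Phi> w)) w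
    (pd 1 \<phi> (\<Phi> w) * pd i (\<lambda>w. \<Phi> w $ 1) w + pd 2 \<phi> (\<Phi> w) * pd i (\<lambda>w. \<Phi> w $ 2) w)"
proof -
  let ?F = "frechet_derivative \<phi> (at (\<Phi> w))" and ?P = "frechet_derivative \<Phi> (at w)"
  note DF = smooth_on_has_derivative[OF assms(1,2)] and DP = smooth_on_has_derivative[OF assms(3,5)]
  have L: "linear ?F" using DF has_derivative_linear by blast
  have c: "pd i (\<lambda>w. \<Phi> w $ j) w = ?P (axis i 1) $ j" for j
    by (rule has_pd_imp_pd, rule has_pdI, rule bounded_linear.has_derivative[OF bounded_linear_vec_nth DP])
      simp
  have "?F v = pd 1 \<phi> (\<Phi> w) * v $ 1 + pd 2 \<phi> (\<Phi> w) * v $ 2" for v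
    by (subst vec2_eq_axes[of v]) (simp add: linear_add[OF L] linear_cmul[OF L] pd_def)
  then show ?thesis
    by (intro has_pdI[OF has_derivative_compose[OF DP DF]]) (simp add: c)
qed

lemma has_pd_component: "has_pd i (\<lambda>w. w $ j) w (if i = j then 1 else 0)"
  by (rule has_pdI[OF bounded_linear_imp_has_derivative[OF bounded_linear_vec_nth]]) (auto simp: axis_def)

text \<open>All conditions that define adapted coordinates hold along the first axis only; this is how they
  are differentiated.\<close>

lemma pd_1_zero_on_axis:
  assumes "open S" "smooth_on S \<phi>" "\<And>w. w \<in> S \<Longrightarrow> w $ 2 = 0 \<Longrightarrow> \<phi> w = c" "w \<in> S" "w $ 2 = 0"
  shows "pd 1 \<phi> w = 0"
proof -
  let ?g = "\<lambda>s. w + s *\<^sub>R axis 1 (1::real)"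
  have g: "(?g has_vector_derivative axis 1 1) (at 0)"
    by (auto intro!: derivative_eq_intros)
  have "(\<phi> has_derivative frechet_derivative \<phi> (at w)) (at (?g 0))"
    using smooth_on_has_derivative[OF assms(2,4)] by simp
  from vector_derivative_diff_chain_within[OF g, of \<phi>] this
  have 1: "((\<phi> \<circ> ?g) has_vector_derivative pd 1 \<phi> w) (at 0)"
    by (auto simp: pd_def has_derivative_at_withinI)
  have "open (?g -` S)"
    by (intro open_vimage assms(1) continuous_intros)
  then have "((\<lambda>s. c) has_vector_derivative pd 1 \<phi> w) (at 0)"
    by (intro has_vector_derivative_transform_within_open[OF 1, of "?g -` S"])
      (auto simp: assms(3-5) axis_def)
  then show ?thesis
    by (metis has_vector_derivative_const vector_derivative_at)
qed

lemma has_real_derivative_line: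
  fixes \<phi> :: "real^2 \<Rightarrow> real"
  assumes "smooth_on S \<phi>" "w + s *\<^sub>R axis i 1 \<in> S"
  shows "((\<lambda>s. \<phi> (w + s *\<^sub>R axis i 1)) has_real_derivative pd i \<phi> (w + s *\<^sub>R axis i 1)) (at s)"
proof -
  let ?g = "\<lambda>s. w + s *\<^sub>R axis i (1::real)"
  have g: "(?g has_vector_derivative axis i 1) (at s)"
    by (auto intro!: derivative_eq_intros)
  from vector_derivative_diff_chain_within[OF g, of \<phi>] smooth_on_has_derivative[OF assms]
  show ?thesis
    by (auto simp: pd_def has_derivative_at_withinI has_real_derivative_iff_has_vector_derivative o_def)
qed

text \<open>The second difference of \<open>\<phi>\<close> over a small square is symmetric in the two directions, and the
  mean value theorem applied twice makes it a value of the mixed derivative.\<close>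

lemma pd_commute:
  assumes "open S" "smooth_on S \<phi>" "w \<in> S"
  shows "pd i (pd j \<phi>) w = pd j (pd i \<phi>) w"
proof -
  define Q where "Q i j \<sigma> = \<phi> (w + \<sigma> *\<^sub>R axis i 1 + \<sigma> *\<^sub>R axis j 1) - \<phi> (w + \<sigma> *\<^sub>R axis i 1)
    - \<phi> (w + \<sigma> *\<^sub>R axis j 1) + \<phi> w" for i j :: 2 and \<sigma>
  have Q: "Q i j \<sigma> = Q j i \<sigma>" for i j \<sigma> by (simp add: Q_def add_ac)
  have lim: "\<exists>\<rho>>0. \<forall>\<sigma>. 0 < \<sigma> \<longrightarrow> \<sigma> < \<rho> \<longrightarrow> \<bar>Q i j \<sigma> / \<sigma>\<^sup>2 - pd j (pd i \<phi>) w\<bar> < e"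
    if e: "e > 0" for e i j
  proof -
    have "isCont (pd j (pd i \<phi>)) w"
      using smooth_on_continuous[OF smooth_on_pd[OF smooth_on_pd[OF assms(2)]]] assms
      by (simp add: continuous_on_eq_continuous_at)
    then obtain d where d: "d > 0" "\<And>x. dist x w < d \<Longrightarrow> \<bar>pd j (pd i \<phi>) x - pd j (pd i \<phi>) w\<bar> < e"
      using e unfolding continuous_at_eps_delta by (metis dist_real_def)
    obtain d' where d': "d' > 0" "ball w d' \<subseteq> S" using assms(1,3) open_contains_ball by blast
    show ?thesis
    proof (intro exI[of _ "min d d' / 2"] conjI allI impI)
      show "min d d' / 2 > 0" using d d' by simp
      fix \<sigma> :: real assume \<sigma>: "0 < \<sigma>" "\<sigma> < min d d' / 2"
      have near: "dist (w + s *\<^sub>R axis i 1 + t *\<^sub>R axis j 1) w < min d d'"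
        if "0 \<le> s" "s \<le> \<sigma>" "0 \<le> t" "t \<le> \<sigma>" for s t
      proof -
        have "dist (w + s *\<^sub>R axis i 1 + t *\<^sub>R axis j 1) w = norm (s *\<^sub>R axis i 1 + t *\<^sub>R axis j (1::real))"
          by (simp add: dist_norm add.assoc)
        also have "\<dots> \<le> s + t" using that
          by (intro order_trans[OF norm_triangle_ineq]) (simp add: norm_axis_1)
        finally show ?thesis using that \<sigma> by linarith
      qed
      have inS: "w + s *\<^sub>R axis i 1 + t *\<^sub>R axis j 1 \<in> S" if "0 \<le> s" "s \<le> \<sigma>" "0 \<le> t" "t \<le> \<sigma>" for s t
        using near[OF that] d'(2) by (auto simp: dist_commute)
      let ?g = "\<lambda>s. \<phi> (w + \<sigma> *\<^sub>R axis j 1 + s *\<^sub>R axis i 1) - \<phi> (w + s *\<^sub>R axis i 1)"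
      have "\<exists>z. 0 < z \<and> z < \<sigma> \<and> ?g \<sigma> - ?g 0 = (\<sigma> - 0) *
          (pd i \<phi> (w + \<sigma> *\<^sub>R axis j 1 + z *\<^sub>R axis i 1) - pd i \<phi> (w + z *\<^sub>R axis i 1))"
      proof (rule MVT2[OF \<sigma>(1)])
        fix s assume s: "0 \<le> s" "s \<le> \<sigma>"
        have "w + \<sigma> *\<^sub>R axis j 1 + s *\<^sub>R axis i 1 \<in> S" "w + s *\<^sub>R axis i 1 \<in> S"
          using inS[of s \<sigma>] inS[of s 0] s \<sigma> by (simp_all add: add_ac)
        then show "(?g has_real_derivative
            pd i \<phi> (w + \<sigma> *\<^sub>R axis j 1 + s *\<^sub>R axis i 1) - pd i \<phi> (w + s *\<^sub>R axis i 1)) (at s)"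
          by (intro DERIV_diff has_real_derivative_line[OF assms(2)])
      qed
      then obtain z where z: "0 < z" "z < \<sigma>" "?g \<sigma> - ?g 0 = \<sigma> *
          (pd i \<phi> (w + \<sigma> *\<^sub>R axis j 1 + z *\<^sub>R axis i 1) - pd i \<phi> (w + z *\<^sub>R axis i 1))" by auto
      let ?h = "\<lambda>t. pd i \<phi> (w + z *\<^sub>R axis i 1 + t *\<^sub>R axis j 1)"
      have "\<exists>y. 0 < y \<and> y < \<sigma> \<and> ?h \<sigma> - ?h 0 = (\<sigma> - 0) * pd j (pd i \<phi>) (w + z *\<^sub>R axis i 1 + y *\<^sub>R axis j 1)"
        by (rule MVT2[OF \<sigma>(1)])
          (use inS[of z] z \<sigma> in \<open>auto intro!: has_real_derivative_line[OF smooth_on_pd[OF assms(2)]]\<close>)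
      then obtain y where y: "0 < y" "y < \<sigma>"
        "?h \<sigma> - ?h 0 = \<sigma> * pd j (pd i \<phi>) (w + z *\<^sub>R axis i 1 + y *\<^sub>R axis j 1)" by auto
      have "Q i j \<sigma> = ?g \<sigma> - ?g 0" by (simp add: Q_def add_ac)
      also have "\<dots> = \<sigma>\<^sup>2 * pd j (pd i \<phi>) (w + z *\<^sub>R axis i 1 + y *\<^sub>R axis j 1)"
        using z(3) y(3) by (simp add: add_ac power2_eq_square)
      finally have "Q i j \<sigma> / \<sigma>\<^sup>2 = pd j (pd i \<phi>) (w + z *\<^sub>R axis i 1 + y *\<^sub>R axis j 1)"
        using \<sigma> by simp
      then show "\<bar>Q i j \<sigma> / \<sigma>\<^sup>2 - pd j (pd i \<phi>) w\<bar> < e"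
        using d(2)[of "w + z *\<^sub>R axis i 1 + y *\<^sub>R axis j 1"] near[of z y] z y by auto
    qed
  qed
  show ?thesis
  proof (rule ccontr)
    assume "\<not> ?thesis"
    then have e: "\<bar>pd i (pd j \<phi>) w - pd j (pd i \<phi>) w\<bar> / 2 > 0" (is "?e > 0") by simp
    obtain a where a: "a > 0" "\<And>\<sigma>. 0 < \<sigma> \<Longrightarrow> \<sigma> < a \<Longrightarrow> \<bar>Q i j \<sigma> / \<sigma>\<^sup>2 - pd j (pd i \<phi>) w\<bar> < ?e"
      using lim[OF e, of i j] by blast
    obtain b where b: "b > 0" "\<And>\<sigma>. 0 < \<sigma> \<Longrightarrow> \<sigma> < b \<Longrightarrow> \<bar>Q j i \<sigma> / \<sigma>\<^sup>2 - pd i (pd j \<phi>) w\<bar> < ?e"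
      using lim[OF e, of j i] by blast
    have "0 < min a b / 2" "min a b / 2 < a" "min a b / 2 < b" using a b by auto
    moreover have False if "\<bar>q - y\<bar> < \<bar>x - y\<bar> / 2" "\<bar>q - x\<bar> < \<bar>x - y\<bar> / 2" for q x y :: real
      using that by (cases "x \<le> y") (auto simp: abs_if split: if_splits)
    ultimately show False using a(2) b(2) unfolding Q[of j i] by blast
  qed
qed

section \<open>The balancing expression under a change of coordinates\<close>

text \<open>The algebra behind the formula for \<open>\<kappa>\<^sub>B\<close>. The coordinate change has components \<open>X, Y\<close> with the derivatives
  \<open>p = X\<^sub>u\<close>, \<open>m = X\<^sub>v\<close>, \<open>q = X\<^sub>u\<^sub>v\<close>, \<open>puu = X\<^sub>u\<^sub>u\<close>, \<open>xvv = X\<^sub>v\<^sub>v\<close>, and likewise \<open>yv, yuv, yvv\<close>, at the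
  origin; \<open>k, kx, Lyy\<close> are \<open>\<Lambda>\<^sub>y, \<Lambda>\<^sub>x\<^sub>y, \<Lambda>\<^sub>y\<^sub>y\<close>, \<open>D\<close> is the curl of the form \<open>b (dy + r dx)\<close>, \<open>J\<close> the Jacobian determinant.
  The hypotheses are the normalizations of a specially adapted system and their derivatives
  along the axis. They leave only \<open>xvv\<close> and \<open>yvv\<close> free, and the coefficient \<open>1/10\<close> in the balancing
  curvature makes the terms with \<open>yvv\<close> cancel; those with \<open>xvv\<close> cancel within the last factor.\<close>

lemma balancing_jet_identity:
  fixes r b rx ry bx bey Dx Dy k kx Lyy xvv yvv m p q puu yv yuv e D J Jv bv lvv Lnn Ev :: real
  assumes e: "e\<^sup>2 = 1" and b: "b \<noteq> 0" and p: "r * b * p = e"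
    and yv: "yv = - r * m" and k: "k * yv * m\<^sup>2 = 1"
    and puu: "(rx * b + r * bx) * p\<^sup>2 + r * b * puu = 0"
    and yuv: "yuv = - rx * p * m - r * q"
    and q: "(kx * p * yv + k * yuv) * m + 2 * (k * yv) * q = 0"
  defines "D \<equiv> (ry * b + r * bey) - bx"
    and "J \<equiv> p * yv"
    and "Jv \<equiv> q * yv + p * yvv - m * yuv"
    and "bv \<equiv> ((rx * b + r * bx) * m + (ry * b + r * bey) * yv) * m + r * b * xvv
        + (bx * m + bey * yv) * yv + b * yvv"
    and "lvv \<equiv> Lyy * yv\<^sup>2 + 2 * kx * m * yv + k * yvv"
    and "Lnn \<equiv> r\<^sup>2 * Lyy - 2 * r * kx"
    and "Ev \<equiv> 2 * e * (D * J) + k * yv * p\<^sup>2"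
  shows "- (D * J)\<^sup>2 - e * ((Dx * m + Dy * yv) * J + D * Jv) - lvv * p\<^sup>2 / 2 + (k * yv * puu * m - k * yv * p * q)
        + (kx * p * yv + k * yuv) * p * m
      + Ev / 10 * ((2 * bv\<^sup>2 + lvv * m\<^sup>2 + 4 * (k * yv) * m * xvv) - 2 * (e * bv + k * yv * p * m)\<^sup>2)
    = m\<^sup>2 / (r * b)\<^sup>2 * (- (D * r)\<^sup>2 + r\<^sup>2 * b * (Dx - r * Dy) - r * b * D * rx - Lnn / 2
        + r * (k * bx / b - kx)
        + (2 * r * b * D + k) / 10 * (Lnn / k + 4 * (rx - r * ry) - 2 * k / b\<^sup>2))"
proof -
  let ?P = "- (D * J)\<^sup>2 - e * ((Dx * m + Dy * yv) * J + D * Jv) - lvv * p\<^sup>2 / 2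
        + (k * yv * puu * m - k * yv * p * q) + (kx * p * yv + k * yuv) * p * m"
  let ?R = "(2 * bv\<^sup>2 + lvv * m\<^sup>2 + 4 * (k * yv) * m * xvv) - 2 * (e * bv + k * yv * p * m)\<^sup>2"
  have nz: "r \<noteq> 0" "m \<noteq> 0" "k \<noteq> 0" "e \<noteq> 0" using k yv e by auto
  have p': "p = e / (r * b)" using p nz b by (simp add: field_simps)
  have k': "k = - 1 / (r * m ^ 3)"
    using k nz by (simp add: yv field_simps power2_eq_square power3_eq_cube)
  have puu': "puu = - (rx * b + r * bx) * p\<^sup>2 / (r * b)"
    using puu nz b by (simp add: field_simps)
  have q': "q = - (kx * r + k * rx) * p * m / (3 * k * r)"
  proof -
    have "m * (3 * k * r * q + (kx * r + k * rx) * p * m) = 0"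
      using q unfolding yv yuv by (simp add: algebra_simps)
    then have "3 * k * r * q + (kx * r + k * rx) * p * m = 0"
      using nz by (simp only: mult_eq_0_iff) simp
    then show ?thesis using nz by (simp add: field_simps)
  qed
  have lv: "k * yv = 1 / m\<^sup>2" using k nz by (simp add: field_simps)
  have ee: "e * e = 1" using e by (simp add: power2_eq_square)
  have ekp: "e * p = 1 / (r * b)" using p' ee by simp
  have pp: "p\<^sup>2 = 1 / (r * b)\<^sup>2" using p' e by (simp add: power_divide)
  have Ev: "Ev = - m * (2 * D / b + k * r / (r * b)\<^sup>2)"
  proof -
    have "Ev = 2 * (e * p) * D * yv + k * yv * p\<^sup>2" by (simp add: Ev_def J_def algebra_simps)
    also have "\<dots> = - m * (2 * D / b + k * r / (r * b)\<^sup>2)"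
      unfolding ekp pp using nz b by (simp add: yv field_simps)
    finally show ?thesis .
  qed
  define bN where "bN = b * (rx - r * ry)"
  have bv: "bv = m\<^sup>2 * bN + r * b * xvv + b * yvv"
    unfolding bv_def bN_def yv by algebra
  have br: "?R
      = m ^ 4 * Lnn - 4 * m * bN / (r * b) + 2 * k * r * m / (r * b)\<^sup>2 - 5 * yvv / (r * m)"
  proof -
    have f1: "(e * bv + k * yv * p * m)\<^sup>2 = bv\<^sup>2 + 2 * (e * p) * bv * (1 / m) + p\<^sup>2 * (1 / m\<^sup>2)"
    proof -
      have "k * yv * p * m = p / m" unfolding lv using nz by (simp add: power2_eq_square)
      then have "(e * bv + k * yv * p * m)\<^sup>2 = e\<^sup>2 * bv\<^sup>2 + 2 * (e * p) * bv * (1 / m) + p\<^sup>2 * (1 / m\<^sup>2)"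
        by (simp add: power2_sum power_mult_distrib power_divide)
      then show ?thesis using e by simp
    qed
    have f2: "4 * (k * yv) * m * xvv = 4 * xvv / m" unfolding lv using nz by (simp add: power2_eq_square)
    have "lvv * m\<^sup>2 = m ^ 4 * Lnn + k * m\<^sup>2 * yvv"
      unfolding lvv_def Lnn_def yv by algebra
    moreover have "k * m\<^sup>2 * yvv = - yvv / (r * m)"
      unfolding k' using nz by (simp add: field_simps power2_eq_square power3_eq_cube)
    ultimately have f3: "lvv * m\<^sup>2 = m ^ 4 * Lnn - yvv / (r * m)" by simp
    have f4: "2 * k * r * m / (r * b)\<^sup>2 = - 2 / (m\<^sup>2 * (r * b)\<^sup>2)"
      unfolding k' using nz b by (simp add: field_simps power2_eq_square power3_eq_cube)
    have f5: "bv / (r * b * m) = m * bN / (r * b) + xvv / m + yvv / (r * m)"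
      unfolding bv using nz b by (simp add: field_simps power2_eq_square)
    have "?R
      = m ^ 4 * Lnn - yvv / (r * m) + 4 * xvv / m - 4 * (bv / (r * b * m)) - 2 / (m\<^sup>2 * (r * b)\<^sup>2)"
      unfolding f1 f2 f3 ekp pp by (simp add: algebra_simps)
    then show ?thesis unfolding f4 f5 by (simp add: algebra_simps)
  qed
  have eJ: "e * J = - m / b" and JJ: "(D * J)\<^sup>2 = D\<^sup>2 * m\<^sup>2 / b\<^sup>2"
  proof -
    have "e * J = - (e * p) * r * m" "(D * J)\<^sup>2 = D\<^sup>2 * p\<^sup>2 * r\<^sup>2 * m\<^sup>2"
      by (simp_all add: J_def yv power_mult_distrib)
    then show "e * J = - m / b" "(D * J)\<^sup>2 = D\<^sup>2 * m\<^sup>2 / b\<^sup>2"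
      unfolding ekp pp using nz by (simp_all add: power_mult_distrib field_simps)
  qed
  have Jv: "e * Jv = rx * m\<^sup>2 / (r * b) + yvv / (r * b)"
  proof -
    have "e * Jv = (e * p) * (rx * m\<^sup>2 + yvv)" by (simp add: Jv_def yv yuv power2_eq_square algebra_simps)
    then show ?thesis unfolding ekp by (simp add: add_divide_distrib)
  qed
  have lvvp: "lvv * p\<^sup>2 / 2 = (m\<^sup>2 * Lnn + k * yvv) / (2 * (r * b)\<^sup>2)"
  proof -
    have "lvv = m\<^sup>2 * Lnn + k * yvv" unfolding lvv_def Lnn_def yv by algebra
    then show ?thesis unfolding pp by simp
  qed
  have m1: "1 / m = - k * r * m\<^sup>2"
    unfolding k' using nz by (simp add: field_simps power2_eq_square power3_eq_cube)
  have x1: "k * yv * puu * m = (rx * b + r * bx) * k * m\<^sup>2 / (r\<^sup>2 * b ^ 3)"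
  proof -
    have "k * yv * puu * m = puu * (1 / m)" unfolding lv using nz by (simp add: power2_eq_square)
    also have "\<dots> = (rx * b + r * bx) * k * m\<^sup>2 / (r\<^sup>2 * b ^ 3)"
      unfolding m1 puu' pp using nz b by (simp add: field_simps power2_eq_square power3_eq_cube)
    finally show ?thesis .
  qed
  have x2: "(kx * p * yv + k * yuv) * p * m - k * yv * p * q = - (kx * r + k * rx) * m\<^sup>2 / (r * b)\<^sup>2"
  proof -
    have "(kx * p * yv + k * yuv) * p * m - k * yv * p * q = - 3 * (k * yv) * p * q"
      using q by algebra
    also have "\<dots> = (kx * r + k * rx) * p\<^sup>2 * (1 / m) / (k * r)"
      unfolding lv q' using nz by (simp add: field_simps power2_eq_square)
    also have "\<dots> = - (kx * r + k * rx) * m\<^sup>2 / (r * b)\<^sup>2"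
      unfolding m1 pp using nz b by (simp add: field_simps)
    finally show ?thesis .
  qed
  have "?P
      = - (D * J)\<^sup>2 - (m * (Dx - r * Dy) * (e * J) + D * (e * Jv)) - lvv * p\<^sup>2 / 2
        + k * yv * puu * m + ((kx * p * yv + k * yuv) * p * m - k * yv * p * q)"
    by (simp add: yv algebra_simps)
  also have "\<dots> = m\<^sup>2 * (- D\<^sup>2 / b\<^sup>2 + (Dx - r * Dy) / b - D * rx / (r * b) - Lnn / (2 * (r * b)\<^sup>2)
      + (rx * b + r * bx) * k / (r\<^sup>2 * b ^ 3) - (kx * r + k * rx) / (r * b)\<^sup>2)
      - yvv * (D / (r * b) + k / (2 * (r * b)\<^sup>2))"
    unfolding JJ eJ Jv lvvp x1 x2 by (simp add: power2_eq_square add_divide_distrib diff_divide_distrib algebra_simps)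
  finally have P: "?P = \<dots>" .
  have m4: "m ^ 4 = - m / (k * r)"
    unfolding k' using nz by (simp add: field_simps power2_eq_square power3_eq_cube power4_eq_xxxx)
  have P2: "Ev / 10 * ?R
      = m\<^sup>2 / 10 * (2 * D / b + k * r / (r * b)\<^sup>2) * (Lnn / (k * r) + 4 * bN / (r * b) - 2 * k * r / (r * b)\<^sup>2)
        + yvv * (D / (r * b) + k / (2 * (r * b)\<^sup>2))"
    unfolding br Ev m4 using nz b by (simp add: field_simps power2_eq_square)
  have gen: "M * U - Y + (M / 10 * V * W + Y) = M * (U + V / 10 * W)" for M U V W Y :: real
    by (simp add: algebra_simps)
  have "?P
      + Ev / 10 * ?R
    = m\<^sup>2 * ((- D\<^sup>2 / b\<^sup>2 + (Dx - r * Dy) / b - D * rx / (r * b) - Lnn / (2 * (r * b)\<^sup>2)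
      + (rx * b + r * bx) * k / (r\<^sup>2 * b ^ 3) - (kx * r + k * rx) / (r * b)\<^sup>2)
      + (2 * D / b + k * r / (r * b)\<^sup>2) / 10 * (Lnn / (k * r) + 4 * bN / (r * b) - 2 * k * r / (r * b)\<^sup>2))"
    unfolding P P2 by (rule gen)
  also have "\<dots> = m\<^sup>2 * ((- (D * r)\<^sup>2 + r\<^sup>2 * b * (Dx - r * Dy) - r * b * D * rx - Lnn / 2
        + r * (k * bx / b - kx)) / (r * b)\<^sup>2
        + (2 * r * b * D + k) / 10 * (Lnn / k + 4 * (rx - r * ry) - 2 * k / b\<^sup>2) / (r * b)\<^sup>2)"
  proof -
    have "- D\<^sup>2 / b\<^sup>2 + (Dx - r * Dy) / b - D * rx / (r * b) - Lnn / (2 * (r * b)\<^sup>2)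
      + (rx * b + r * bx) * k / (r\<^sup>2 * b ^ 3) - (kx * r + k * rx) / (r * b)\<^sup>2
      = (- (D * r)\<^sup>2 + r\<^sup>2 * b * (Dx - r * Dy) - r * b * D * rx - Lnn / 2
        + r * (k * bx / b - kx)) / (r * b)\<^sup>2"
      using nz b by (simp add: field_simps power2_eq_square power3_eq_cube)
    moreover have "2 * D / b + k * r / (r * b)\<^sup>2 = (2 * r * b * D + k) / (r * b\<^sup>2)"
      "Lnn / (k * r) + 4 * bN / (r * b) - 2 * k * r / (r * b)\<^sup>2
        = (Lnn / k + 4 * (rx - r * ry) - 2 * k / b\<^sup>2) / r"
      using nz b by (simp_all add: bN_def field_simps power2_eq_square)
    ultimately show ?thesis using nz b by (simp add: power2_eq_square)
  qed
  also have "\<dots> = m\<^sup>2 / (r * b)\<^sup>2 * (- (D * r)\<^sup>2 + r\<^sup>2 * b * (Dx - r * Dy) - r * b * D * rx - Lnn / 2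
        + r * (k * bx / b - kx)
        + (2 * r * b * D + k) / 10 * (Lnn / k + 4 * (rx - r * ry) - 2 * k / b\<^sup>2))"
  proof -
    have "M * (X / R + V / 10 * W / R) = M / R * (X + V / 10 * W)" for M X V W R :: real
      by (simp add: add_divide_distrib distrib_left)
    then show ?thesis .
  qed
  finally show ?thesis .
qed

text \<open>In a frame where the form is \<open>(\<alpha> du + \<beta> dv)\<^sup>2 + l (X\<^sub>u du + X\<^sub>v dv)\<^sup>2\<close>, the second derivatives of \<open>\<alpha>\<close> and \<open>\<beta>\<close> enter the
  balancing expression only through \<open>\<alpha>\<^sub>v\<^sub>v - \<beta>\<^sub>u\<^sub>v\<close>, the derivative of the curl of \<open>\<alpha> du + \<beta> dv\<close>.
  This removes the third derivatives of the coordinate change.\<close>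

lemma balancing_jets:
  fixes \<alpha> \<beta> l X E F G :: "real^2 \<Rightarrow> real"
  assumes S: "open S" "0 \<in> S"
    and sm: "smooth_on S \<alpha>" "smooth_on S \<beta>" "smooth_on S l" "smooth_on S X"
    and E: "\<And>w. w \<in> S \<Longrightarrow> E w = (\<alpha> w)\<^sup>2 + l w * (pd 1 X w)\<^sup>2"
    and F: "\<And>w. w \<in> S \<Longrightarrow> F w = \<alpha> w * \<beta> w + l w * (pd 1 X w * pd 2 X w)"
    and G: "\<And>w. w \<in> S \<Longrightarrow> G w = (\<beta> w)\<^sup>2 + l w * (pd 2 X w)\<^sup>2"
    and ax: "\<And>w. w \<in> S \<Longrightarrow> w $ 2 = 0 \<Longrightarrow> \<beta> w = 0" "\<And>w. w \<in> S \<Longrightarrow> w $ 2 = 0 \<Longrightarrow> l w = 0"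
    and ax\<alpha>: "\<And>w. w \<in> S \<Longrightarrow> w $ 2 = 0 \<Longrightarrow> (\<alpha> w)\<^sup>2 = 1"
  shows "- (1/2) * pd 2 (pd 2 E) 0 + pd 2 (pd 1 F) 0 + pd 2 E 0 / 10 * (pd 2 (pd 2 G) 0 - 2 * (pd 2 F 0)\<^sup>2)
    = - (pd 2 \<alpha> 0)\<^sup>2 - \<alpha> 0 * (pd 2 (pd 2 \<alpha>) 0 - pd 2 (pd 1 \<beta>) 0) - pd 2 (pd 2 l) 0 * (pd 1 X 0)\<^sup>2 / 2
      + (pd 2 l 0 * pd 1 (pd 1 X) 0 * pd 2 X 0 - pd 2 l 0 * pd 1 X 0 * pd 2 (pd 1 X) 0)
      + pd 1 (pd 2 l) 0 * pd 1 X 0 * pd 2 X 0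
      + (2 * \<alpha> 0 * pd 2 \<alpha> 0 + pd 2 l 0 * (pd 1 X 0)\<^sup>2) / 10 *
        ((2 * (pd 2 \<beta> 0)\<^sup>2 + pd 2 (pd 2 l) 0 * (pd 2 X 0)\<^sup>2 + 4 * pd 2 l 0 * pd 2 X 0 * pd 2 (pd 2 X) 0)
          - 2 * (\<alpha> 0 * pd 2 \<beta> 0 + pd 2 l 0 * pd 1 X 0 * pd 2 X 0)\<^sup>2)"
proof -
  note sp = smooth_on_pd
  note b0 = has_pd_smooth[OF sm(1)] has_pd_smooth[OF sm(2)] has_pd_smooth[OF sm(3)]
    has_pd_smooth[OF sp[OF sm(1)]] has_pd_smooth[OF sp[OF sm(2)]] has_pd_smooth[OF sp[OF sm(3)]]
    has_pd_smooth[OF sp[OF sm(4)]] has_pd_smooth[OF sp[OF sp[OF sm(4)]]]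
  note rules = has_pd_add has_pd_mult has_pd_power2 has_pd_const b0
  let ?z = "0 :: real^2"
  have z: "\<alpha> 0 * \<alpha> 0 = 1" "\<beta> 0 = 0" "l 0 = 0" using ax ax\<alpha> S(2) by (auto simp: power2_eq_square)
  have \<alpha>0: "\<alpha> 0 \<noteq> 0" using z(1) by auto
  have \<alpha>u: "pd 1 \<alpha> 0 = 0"
  proof -
    have "pd 1 (\<lambda>w. (\<alpha> w)\<^sup>2) 0 = 0"
      by (rule pd_1_zero_on_axis[OF S(1) smooth_on_power[OF S(1) sm(1)], of 2 1]) (use ax\<alpha> S in auto)
    moreover have "pd 1 (\<lambda>w. (\<alpha> w)\<^sup>2) 0 = 2 * \<alpha> 0 * pd 1 \<alpha> 0"
      by (rule has_pd_imp_pd, (rule rules S)+)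
    ultimately show ?thesis using \<alpha>0 by simp
  qed
  have \<beta>u: "pd 1 \<beta> 0 = 0" and lu: "pd 1 l 0 = 0"
    using pd_1_zero_on_axis[OF S(1) sm(2) ax(1) S(2)] pd_1_zero_on_axis[OF S(1) sm(3) ax(2) S(2)] by auto
  have E1: "pd 2 E w = 2 * \<alpha> w * pd 2 \<alpha> w + (l w * (2 * pd 1 X w * pd 2 (pd 1 X) w) + pd 2 l w * (pd 1 X w)\<^sup>2)"
    if "w \<in> S" for w
    by (rule pd_eqI[OF S(1) that], erule E, (rule rules that)+, simp)
  have E2: "pd 2 (pd 2 E) 0 = 2 * (pd 2 \<alpha> 0)\<^sup>2 + 2 * \<alpha> 0 * pd 2 (pd 2 \<alpha>) 0 + pd 2 (pd 2 l) 0 * (pd 1 X 0)\<^sup>2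
      + 4 * pd 2 l 0 * pd 1 X 0 * pd 2 (pd 1 X) 0"
    by (rule pd_eqI[OF S], erule E1, (rule rules S)+)
      (simp add: z power2_eq_square algebra_simps)
  have F1: "pd 2 F w = \<alpha> w * pd 2 \<beta> w + pd 2 \<alpha> w * \<beta> w
      + (l w * (pd 1 X w * pd 2 (pd 2 X) w + pd 2 (pd 1 X) w * pd 2 X w) + pd 2 l w * (pd 1 X w * pd 2 X w))"
    if "w \<in> S" for w
    by (rule pd_eqI[OF S(1) that], erule F, (rule rules that)+, simp)
  have sF: "smooth_on S F"
    by (rule smooth_on_eqI[OF S(1) _ F]) (intro smooth_on_add smooth_on_mult S(1) sm sp)
  have F2: "pd 2 (pd 1 F) 0 = \<alpha> 0 * pd 2 (pd 1 \<beta>) 0 + pd 1 (pd 2 l) 0 * pd 1 X 0 * pd 2 X 0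
      + pd 2 l 0 * (pd 1 (pd 1 X) 0 * pd 2 X 0 + pd 1 X 0 * pd 2 (pd 1 X) 0)"
    unfolding pd_commute[OF S(1) sF S(2), of 2 1]
    unfolding pd_commute[OF S(1) sm(2) S(2), of 2 1] pd_commute[OF S(1) sm(4) S(2), of 2 1]
    by (rule pd_eqI[OF S], erule F1, (rule rules S)+)
      (simp add: z \<alpha>u \<beta>u lu algebra_simps)
  have G1: "pd 2 G w = 2 * \<beta> w * pd 2 \<beta> w + (l w * (2 * pd 2 X w * pd 2 (pd 2 X) w) + pd 2 l w * (pd 2 X w)\<^sup>2)"
    if "w \<in> S" for w
    by (rule pd_eqI[OF S(1) that], erule G, (rule rules that)+, simp)
  have G2: "pd 2 (pd 2 G) 0 = 2 * (pd 2 \<beta> 0)\<^sup>2 + pd 2 (pd 2 l) 0 * (pd 2 X 0)\<^sup>2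
      + 4 * pd 2 l 0 * pd 2 X 0 * pd 2 (pd 2 X) 0"
    by (rule pd_eqI[OF S], erule G1, (rule rules S)+)
      (simp add: z power2_eq_square algebra_simps)
  show ?thesis
    unfolding E1[OF S(2)] F1[OF S(2)] E2 F2 G2 by (simp add: z algebra_simps)
qed

text \<open>The coefficient of \<open>dy \<and> dx\<close> in the exterior derivative of \<open>b (dy + r dx)\<close>.\<close>

definition curl :: "(real^2 \<Rightarrow> real) \<Rightarrow> (real^2 \<Rightarrow> real) \<Rightarrow> real^2 \<Rightarrow> real" where
  "curl r b z = pd 2 (\<lambda>z. r z * b z) z - pd 1 b z"

text \<open>The numerator \<open>Q\<close> of \<open>\<kappa>\<^sub>B\<close>. Here \<open>Lnn\<close> is, on the axis, the second derivative of \<open>\<Lambda>\<close> in the null direction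
  \<open>(1, - r)\<close>, where \<open>\<Lambda>\<^sub>x\<^sub>x = 0\<close>; the other differences \<open>\<phi>\<^sub>x - r \<phi>\<^sub>y\<close> are first derivatives in that direction.\<close>

definition balancing_numerator ::
    "(real^2 \<Rightarrow> real) \<Rightarrow> (real^2 \<Rightarrow> real) \<Rightarrow> (real^2 \<Rightarrow> real) \<Rightarrow> real^2 \<Rightarrow> real" where
  "balancing_numerator r b \<Lambda> z =
    (let k = pd 2 \<Lambda> z; kx = pd 1 (pd 2 \<Lambda>) z; D = curl r b z;
         Lnn = (r z)\<^sup>2 * pd 2 (pd 2 \<Lambda>) z - 2 * r z * kx
     in - (D * r z)\<^sup>2 + (r z)\<^sup>2 * b z * (pd 1 (curl r b) z - r z * pd 2 (curl r b) z)
        - r z * b z * D * pd 1 r z - Lnn / 2 + r z * (k * pd 1 b z / b z - kx)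
        + (2 * r z * b z * D + k) / 10 *
          (Lnn / k + 4 * (pd 1 r z - r z * pd 2 r z) - 2 * k / (b z)\<^sup>2))"

text \<open>The normalization \<open>\<lambda>\<^sub>v = 1\<close> fixes the cube of the scaling \<open>m\<close> of the null vector, while \<open>\<kappa>\<^sub>B\<close>
  contains its square: this is the origin of the fractional exponent.\<close>

lemma powr_two_thirds_cube:
  fixes c m :: real
  assumes "c * m ^ 3 = - 1"
  shows "m\<^sup>2 = 1 / \<bar>c\<bar> powr (2/3)"
proof -
  have m: "m \<noteq> 0" using assms by auto
  then have c: "c = - 1 / m ^ 3" using assms by (subst nonzero_eq_divide_eq) auto
  have "\<bar>c\<bar> = \<bar>m\<bar> powr (-3)" using m
    by (simp add: c power_abs powr_minus powr_realpow field_simps abs_divide)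
  then have "\<bar>c\<bar> powr (2/3) = \<bar>m\<bar> powr (-2)" by (simp add: powr_powr)
  then have *: "m\<^sup>2 * \<bar>c\<bar> powr (2/3) = 1" using m by (simp add: powr_minus powr_realpow field_simps)
  then have "\<bar>c\<bar> powr (2/3) \<noteq> 0" by auto
  with * show ?thesis by (subst nonzero_eq_divide_eq)
qed

text \<open>The form \<open>b\<^sup>2 (dy + r dx)\<^sup>2 + \<Lambda> dx\<^sup>2\<close> is pulled back by \<open>\<Phi> = (X, Y)\<close> to a specially adapted system, where \<open>\<alpha> du + \<beta> dv\<close> is the
  pullback of \<open>b (dy + r dx)\<close>. Along \<open>v = 0\<close> the conditions read \<open>Y = 0\<close>, \<open>\<beta> = 0\<close>, \<open>\<alpha>\<^sup>2 = 1\<close> and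
  \<open>(\<Lambda> \<circ> \<Phi>)\<^sub>v (X\<^sub>v)\<^sup>2 = 1\<close>. These and their derivatives by \<open>u\<close> feed the algebraic identity above.\<close>

lemma balancing_formula:
  fixes \<Phi> :: "real^2 \<Rightarrow> real^2" and r b \<Lambda> E F G X Y \<alpha> \<beta> :: "real^2 \<Rightarrow> real"
  assumes S: "open S" "0 \<in> S" and V: "open V" "\<Phi> ` S \<subseteq> V" "smooth_on S \<Phi>"
    and sm: "smooth_on V r" "smooth_on V b" "smooth_on V \<Lambda>"
    and b: "\<And>z. z \<in> V \<Longrightarrow> b z \<noteq> 0"
    and \<Lambda>0: "\<And>z. z \<in> V \<Longrightarrow> z $ 2 = 0 \<Longrightarrow> \<Lambda> z = 0"
    and \<Phi>0: "\<And>w. w \<in> S \<Longrightarrow> w $ 2 = 0 \<Longrightarrow> \<Phi> w $ 2 = 0"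
  defines "X \<equiv> \<lambda>w. \<Phi> w $ 1" and "Y \<equiv> \<lambda>w. \<Phi> w $ 2"
  defines "\<alpha> \<equiv> \<lambda>w. r (\<Phi> w) * b (\<Phi> w) * pd 1 X w + b (\<Phi> w) * pd 1 Y w"
    and "\<beta> \<equiv> \<lambda>w. r (\<Phi> w) * b (\<Phi> w) * pd 2 X w + b (\<Phi> w) * pd 2 Y w"
  assumes E: "\<And>w. w \<in> S \<Longrightarrow> E w = (\<alpha> w)\<^sup>2 + \<Lambda> (\<Phi> w) * (pd 1 X w)\<^sup>2"
    and F: "\<And>w. w \<in> S \<Longrightarrow> F w = \<alpha> w * \<beta> w + \<Lambda> (\<Phi> w) * (pd 1 X w * pd 2 X w)"
    and G: "\<And>w. w \<in> S \<Longrightarrow> G w = (\<beta> w)\<^sup>2 + \<Lambda> (\<Phi> w) * (pd 2 X w)\<^sup>2"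
    and ax: "\<And>w. w \<in> S \<Longrightarrow> w $ 2 = 0 \<Longrightarrow> E w = 1"
      "\<And>w. w \<in> S \<Longrightarrow> w $ 2 = 0 \<Longrightarrow> G w = 0"
      "\<And>w. w \<in> S \<Longrightarrow> w $ 2 = 0 \<Longrightarrow> pd 2 (\<lambda>w. E w * G w - (F w)\<^sup>2) w = 1"
  defines "z \<equiv> \<Phi> 0"
  shows "- (1/2) * pd 2 (pd 2 E) 0 + pd 2 (pd 1 F) 0 + pd 2 E 0 / 10 * (pd 2 (pd 2 G) 0 - 2 * (pd 2 F 0)\<^sup>2)
    = balancing_numerator r b \<Lambda> z / ((b z)\<^sup>2 * (r z)\<^sup>2 * \<bar>pd 2 \<Lambda> z * r z\<bar> powr (2/3))"
proof -
  define a where "a z = r z * b z" for z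
  define l where "l w = \<Lambda> (\<Phi> w)" for w
  note sp = smooth_on_pd
  have sa: "smooth_on V a" unfolding a_def by (intro smooth_on_mult V sm)
  have scu: "smooth_on V (curl r b)"
    unfolding curl_def[abs_def] using sa sm(2)
    by (intro smooth_on_diff V sp) (auto simp: a_def[abs_def])
  have comp: "smooth_on S (\<lambda>w. \<phi> (\<Phi> w))" if "smooth_on V \<phi>" for \<phi> :: "real^2 \<Rightarrow> real"
    by (rule smooth_on_compose[OF S(1) V(1,2) that V(3)])
  have sX: "smooth_on S X" "smooth_on S Y"
    unfolding X_def Y_def by (intro smooth_on_component S V)+
  have sl: "smooth_on S l" unfolding l_def[abs_def] by (rule comp[OF sm(3)])
  have s\<alpha>: "smooth_on S \<alpha>" and s\<beta>: "smooth_on S \<beta>"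
    unfolding \<alpha>_def \<beta>_def by (intro smooth_on_add smooth_on_mult comp sm sp sX S(1))+
  have inV: "\<Phi> w \<in> V" if "w \<in> S" for w using V(2) that by auto
  have zV: "z \<in> V" and z2: "z $ 2 = 0" using inV[OF S(2)] \<Phi>0[OF S(2)] by (auto simp: z_def)
  have chain: "has_pd i (\<lambda>w. \<phi> (\<Phi> w)) w (pd 1 \<phi> (\<Phi> w) * pd i X w + pd 2 \<phi> (\<Phi> w) * pd i Y w)"
    if "smooth_on V \<phi>" "w \<in> S" for i w \<phi>
    unfolding X_def Y_def by (rule has_pd_chain[OF that(1) inV[OF that(2)] V(3) S(1) that(2)])
  note rules = has_pd_add has_pd_diff has_pd_mult has_pd_power2 has_pd_const
    chain[OF sa] chain[OF sm(1)] chain[OF sm(2)] chain[OF sm(3)] chain[OF scu]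
    chain[OF sp[OF sm(3)]]
    has_pd_smooth[OF sp[OF sX(1)]] has_pd_smooth[OF sp[OF sX(2)]]
    has_pd_smooth[OF sp[OF s\<alpha>]] has_pd_smooth[OF sp[OF s\<beta>]]
    has_pd_smooth[OF s\<alpha>] has_pd_smooth[OF s\<beta>] has_pd_smooth[OF sl] has_pd_smooth[OF sp[OF sl]]
  have \<alpha>a: "\<alpha> w = a (\<Phi> w) * pd 1 X w + b (\<Phi> w) * pd 1 Y w"
    and \<beta>a: "\<beta> w = a (\<Phi> w) * pd 2 X w + b (\<Phi> w) * pd 2 Y w" for w
    by (auto simp: \<alpha>_def \<beta>_def a_def)
  have l0: "l w = 0" if "w \<in> S" "w $ 2 = 0" for w
    using \<Lambda>0[OF inV[OF that(1)] \<Phi>0[OF that]] by (simp add: l_def)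
  have \<beta>0: "\<beta> w = 0" and \<alpha>1: "(\<alpha> w)\<^sup>2 = 1" if "w \<in> S" "w $ 2 = 0" for w
    using G[OF that(1)] E[OF that(1)] ax(1,2)[OF that] l0[OF that] by (auto simp: l_def)
  have lv1: "pd 2 l w * (pd 2 X w)\<^sup>2 = 1" if w: "w \<in> S" "w $ 2 = 0" for w
  proof -
    have EG: "E w * G w - (F w)\<^sup>2 = l w * (\<alpha> w * pd 2 X w - \<beta> w * pd 1 X w)\<^sup>2" if "w \<in> S" for w
      unfolding E[OF that] F[OF that] G[OF that] l_def by algebra
    have "pd 2 (\<lambda>w. E w * G w - (F w)\<^sup>2) w = pd 2 l w * (\<alpha> w * pd 2 X w)\<^sup>2"
      by (rule pd_eqI[OF S(1) w(1)], erule EG, (rule rules w)+) (simp add: l0[OF w] \<beta>0[OF w])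
    then show ?thesis using ax(3)[OF w] \<alpha>1[OF w] by (simp add: power_mult_distrib)
  qed
  have Yu: "pd 1 Y w = 0" if "w \<in> S" "w $ 2 = 0" for w
    by (rule pd_1_zero_on_axis[OF S(1) sX(2) _ that]) (simp add: Y_def \<Phi>0)
  have Yuu: "pd 1 (pd 1 Y) 0 = 0"
    by (rule pd_1_zero_on_axis[OF S(1) sp[OF sX(2)] Yu S(2)]) auto
  have \<Lambda>x: "pd 1 \<Lambda> w = 0" if "w \<in> V" "w $ 2 = 0" for w
    by (rule pd_1_zero_on_axis[OF V(1) sm(3) \<Lambda>0 that])
  have \<Lambda>xx: "pd 1 (pd 1 \<Lambda>) z = 0"
    by (rule pd_1_zero_on_axis[OF V(1) sp[OF sm(3)] \<Lambda>x zV z2])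
  \<comment> \<open>Exterior derivatives commute with pullbacks.\<close>
  have curlM: "pd 2 \<alpha> w - pd 1 \<beta> w = curl r b (\<Phi> w) * (pd 1 X w * pd 2 Y w - pd 2 X w * pd 1 Y w)"
    if w: "w \<in> S" for w
  proof -
    have 1: "pd 2 \<alpha> w = a (\<Phi> w) * pd 2 (pd 1 X) w + (pd 1 a (\<Phi> w) * pd 2 X w + pd 2 a (\<Phi> w) * pd 2 Y w) * pd 1 X w
        + (b (\<Phi> w) * pd 2 (pd 1 Y) w + (pd 1 b (\<Phi> w) * pd 2 X w + pd 2 b (\<Phi> w) * pd 2 Y w) * pd 1 Y w)"
      by (rule pd_eqI[OF S(1) w], rule \<alpha>a, (rule rules w)+) simp
    have 2: "pd 1 \<beta> w = a (\<Phi> w) * pd 1 (pd 2 X) w + (pd 1 a (\<Phi> w) * pd 1 X w + pd 2 a (\<Phi> w) * pd 1 Y w) * pd 2 X w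
        + (b (\<Phi> w) * pd 1 (pd 2 Y) w + (pd 1 b (\<Phi> w) * pd 1 X w + pd 2 b (\<Phi> w) * pd 1 Y w) * pd 2 Y w)"
      by (rule pd_eqI[OF S(1) w], rule \<beta>a, (rule rules w)+) simp
    show ?thesis
      unfolding 1 2 curl_def a_def[symmetric] pd_commute[OF S(1) sX(1) w, of 1 2]
        pd_commute[OF S(1) sX(2) w, of 1 2] by algebra
  qed
  let ?p = "pd 1 X 0" and ?m = "pd 2 X 0" and ?q = "pd 2 (pd 1 X) 0" and ?yv = "pd 2 Y 0"
  let ?yuv = "pd 2 (pd 1 Y) 0" and ?k = "pd 2 \<Lambda> z" and ?kx = "pd 1 (pd 2 \<Lambda>) z"
  have pd_a: "pd 1 a z = pd 1 r z * b z + r z * pd 1 b z" "pd 2 a z = pd 2 r z * b z + r z * pd 2 b z"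
    by (rule pd_eqI[OF V(1) zV], rule a_def, (rule has_pd_mult has_pd_smooth[OF sm(1) zV] has_pd_smooth[OF sm(2) zV])+, simp)+
  have \<beta>u: "pd 1 \<beta> 0 = 0"
    by (rule pd_1_zero_on_axis[OF S(1) s\<beta> _ S(2)]) (use \<beta>0 in auto)
  note Yu0 = Yu[OF S(2) zero_index]
  have z0: "\<Phi> 0 = z" by (simp add: z_def)
  have e: "(\<alpha> 0)\<^sup>2 = 1" using \<alpha>1[OF S(2)] by simp
  have p: "r z * b z * ?p = \<alpha> 0" by (simp add: \<alpha>a Yu0 z0 a_def)
  have yv: "?yv = - r z * ?m"
  proof -
    have "b z * (r z * ?m + ?yv) = 0"
      using \<beta>0[OF S(2)] by (simp add: \<beta>a z0 a_def algebra_simps)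
    then show ?thesis using b[OF zV] by simp
  qed
  have lv: "pd 2 l w = pd 1 \<Lambda> (\<Phi> w) * pd 2 X w + pd 2 \<Lambda> (\<Phi> w) * pd 2 Y w" if "w \<in> S" for w
    by (rule pd_eqI[OF S(1) that], rule l_def, (rule rules that)+) simp
  have lv0: "pd 2 l 0 = ?k * ?yv" by (simp add: lv S(2) z0 \<Lambda>x zV z2)
  have k: "?k * ?yv * ?m\<^sup>2 = 1" using lv1[OF S(2)] by (simp add: lv0)
  have \<alpha>u: "pd 1 \<alpha> 0 = 0"
  proof -
    have "pd 1 (\<lambda>w. (\<alpha> w)\<^sup>2) 0 = 0"
      by (rule pd_1_zero_on_axis[OF S(1) smooth_on_power[OF S(1) s\<alpha>], of 2 1]) (use \<alpha>1 S in auto)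
    moreover have "pd 1 (\<lambda>w. (\<alpha> w)\<^sup>2) 0 = 2 * \<alpha> 0 * pd 1 \<alpha> 0"
      by (rule has_pd_imp_pd, (rule rules S)+)
    ultimately show ?thesis using e by auto
  qed
  have "pd 1 \<alpha> 0 = a z * pd 1 (pd 1 X) 0 + pd 1 a z * ?p * ?p"
    by (rule pd_eqI[OF S], rule \<alpha>a, (rule rules S)+) (simp add: Yu0 Yuu z0)
  then have puu: "(pd 1 r z * b z + r z * pd 1 b z) * ?p\<^sup>2 + r z * b z * pd 1 (pd 1 X) 0 = 0"
    unfolding \<alpha>u pd_a a_def by (simp add: power2_eq_square algebra_simps)
  have yuv: "?yuv = - pd 1 r z * ?p * ?m - r z * ?q"
  proof -
    have "pd 1 \<beta> 0 = a z * ?q + pd 1 a z * ?p * ?m + b z * ?yuv + pd 1 b z * ?p * ?yv"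
      unfolding pd_commute[OF S(1) sX(1) S(2), of 2 1] pd_commute[OF S(1) sX(2) S(2), of 2 1]
      by (rule pd_eqI[OF S], rule \<beta>a, (rule rules S)+) (simp add: Yu0 z0)
    then have "b z * (r z * ?q + pd 1 r z * ?p * ?m + ?yuv) = 0"
      unfolding \<beta>u pd_a a_def yv by algebra
    then have "r z * ?q + pd 1 r z * ?p * ?m + ?yuv = 0" using b[OF zV] by (simp only: mult_eq_0_iff) simp
    then show ?thesis by simp
  qed
  have luv: "pd 1 (pd 2 l) 0 = ?kx * ?p * ?yv + ?k * ?yuv"
    unfolding pd_commute[OF S(1) sX(2) S(2), of 2 1]
    by (rule pd_eqI[OF S], erule lv, (rule rules S)+) (simp add: Yu0 z0 \<Lambda>x zV z2 \<Lambda>xx)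
  have q: "(?kx * ?p * ?yv + ?k * ?yuv) * ?m + 2 * (?k * ?yv) * ?q = 0"
  proof -
    have "pd 1 (\<lambda>w. pd 2 l w * (pd 2 X w)\<^sup>2) 0 = 0"
      by (rule pd_1_zero_on_axis[OF S(1) _ lv1 S(2)])
        (auto intro!: smooth_on_mult smooth_on_power sp sl sX S(1))
    moreover have "pd 1 (\<lambda>w. pd 2 l w * (pd 2 X w)\<^sup>2) 0
        = pd 2 l 0 * (2 * ?m * ?q) + pd 1 (pd 2 l) 0 * ?m\<^sup>2"
      unfolding pd_commute[OF S(1) sX(1) S(2), of 2 1]
      by (rule has_pd_imp_pd, (rule rules S)+)
    ultimately have "?m * ((?kx * ?p * ?yv + ?k * ?yuv) * ?m + 2 * (?k * ?yv) * ?q) = 0"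
      unfolding lv0 luv by algebra
    moreover have "?m \<noteq> 0" using k by auto
    ultimately show ?thesis by (simp only: mult_eq_0_iff) simp
  qed
  have bv: "pd 2 \<beta> 0 = ((pd 1 r z * b z + r z * pd 1 b z) * ?m + (pd 2 r z * b z + r z * pd 2 b z) * ?yv) * ?m
      + r z * b z * pd 2 (pd 2 X) 0 + (pd 1 b z * ?m + pd 2 b z * ?yv) * ?yv + b z * pd 2 (pd 2 Y) 0"
    unfolding pd_a[symmetric] a_def[symmetric]
    by (rule pd_eqI[OF S], rule \<beta>a, (rule rules S)+) (simp add: z0)
  have lvv: "pd 2 (pd 2 l) 0 = pd 2 (pd 2 \<Lambda>) z * ?yv\<^sup>2 + 2 * ?kx * ?m * ?yv + ?k * pd 2 (pd 2 Y) 0"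
    by (rule pd_eqI[OF S], erule lv, (rule rules chain[OF sp[OF sm(3)]] S)+)
      (simp add: z0 \<Lambda>x zV z2 \<Lambda>xx pd_commute[OF V(1) sm(3) zV, of 2 1] power2_eq_square algebra_simps)
  define D where "D = (pd 2 r z * b z + r z * pd 2 b z) - pd 1 b z"
  have D: "curl r b z = D"
    unfolding D_def curl_def pd_a(2)[symmetric] a_def[abs_def] ..
  have \<alpha>v: "pd 2 \<alpha> 0 = D * (?p * ?yv)"
    using curlM[OF S(2)] \<beta>u by (simp add: Yu0 z0 D)
  have M: "pd 2 (pd 2 \<alpha>) 0 - pd 2 (pd 1 \<beta>) 0
      = (pd 1 (curl r b) z * ?m + pd 2 (curl r b) z * ?yv) * (?p * ?yv)
        + D * (?q * ?yv + ?p * pd 2 (pd 2 Y) 0 - ?m * ?yuv)"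
  proof -
    have "pd 2 (\<lambda>w. pd 2 \<alpha> w - pd 1 \<beta> w) 0
      = (pd 1 (curl r b) z * ?m + pd 2 (curl r b) z * ?yv) * (?p * ?yv)
        + D * (?q * ?yv + ?p * pd 2 (pd 2 Y) 0 - ?m * ?yuv)"
      by (rule pd_eqI[OF S], erule curlM, (rule rules S)+) (simp add: z0 D Yu0 algebra_simps)
    moreover have "pd 2 (\<lambda>w. pd 2 \<alpha> w - pd 1 \<beta> w) 0 = pd 2 (pd 2 \<alpha>) 0 - pd 2 (pd 1 \<beta>) 0"
      by (rule has_pd_imp_pd, (rule rules S)+)
    ultimately show ?thesis by simp
  qed
  have EFG: "E w = (\<alpha> w)\<^sup>2 + l w * (pd 1 X w)\<^sup>2" "F w = \<alpha> w * \<beta> w + l w * (pd 1 X w * pd 2 X w)"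
    "G w = (\<beta> w)\<^sup>2 + l w * (pd 2 X w)\<^sup>2" if "w \<in> S" for w
    using E F G that by (auto simp: l_def)
  have m: "?m\<^sup>2 = 1 / \<bar>?k * r z\<bar> powr (2/3)"
    by (rule powr_two_thirds_cube) (use k in \<open>simp add: yv power2_eq_square power3_eq_cube algebra_simps\<close>)
  note key = balancing_jet_identity[OF e b[OF zV] p yv k puu yuv q, where Dx = "pd 1 (curl r b) z"
      and ry = "pd 2 r z" and bey = "pd 2 b z" and Dy = "pd 2 (curl r b) z"
      and yvv = "pd 2 (pd 2 Y) 0" and xvv = "pd 2 (pd 2 X) 0" and Lyy = "pd 2 (pd 2 \<Lambda>) z",
      folded D_def]
  have "- (1/2) * pd 2 (pd 2 E) 0 + pd 2 (pd 1 F) 0 + pd 2 E 0 / 10 * (pd 2 (pd 2 G) 0 - 2 * (pd 2 F 0)\<^sup>2)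
      = ?m\<^sup>2 / (r z * b z)\<^sup>2 * balancing_numerator r b \<Lambda> z"
    apply (rule trans[OF balancing_jets[OF S s\<alpha> s\<beta> sl sX(1)]])
    apply (erule EFG, erule EFG, erule EFG, erule \<beta>0, assumption, erule l0, assumption,
      erule \<alpha>1, assumption)
    apply (unfold M \<alpha>v luv lv0 lvv bv balancing_numerator_def Let_def D)
    apply (rule key)
    done
  then show ?thesis unfolding m by (simp add: power_mult_distrib mult_ac)
qed

section \<open>Coordinate systems\<close>

lemma is_chartD:
  assumes "is_chart c"
  shows "open (fst c)" "open (snd c ` fst c)" "continuous_on (fst c) (snd c)"
    "continuous_on (snd c ` fst c) (chart_inv c)"
    "\<And>x. x \<in> fst c \<Longrightarrow> chart_inv c (snd c x) = x"
    "\<And>w. w \<in> snd c ` fst c \<Longrightarrow> chart_inv c w \<in> fst c"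
    "\<And>w. w \<in> snd c ` fst c \<Longrightarrow> snd c (chart_inv c w) = w"
  using assms by (auto simp: is_chart_def homeomorphism_def)

lemma chart_open_image:
  assumes "is_chart c" "open U" 
  shows "open (snd c ` (fst c \<inter> U))"
proof -
  have "snd c ` (fst c \<inter> U) = snd c ` fst c \<inter> chart_inv c -` U"
    using is_chartD(5-7)[OF assms(1)] by (auto simp: image_iff)
  then show ?thesis
    using continuous_open_preimage[OF is_chartD(4,2)[OF assms(1)] assms(2)] by simp
qed

lemma local_rep_id: "local_rep id c d w = snd d (chart_inv c w)"
  by (simp add: local_rep_def)

lemma coord_systems_chart: "c \<in> coord_systems A \<Longrightarrow> is_chart c"
  by (simp add: coord_systems_def)

lemma smooth_manifold_subset: "smooth_manifold A \<Longrightarrow> A \<subseteq> coord_systems A"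
  by (auto simp: smooth_manifold_def coord_systems_def)

lemma smooth_manifold_cover: "smooth_manifold A \<Longrightarrow> \<exists>c\<in>A. x \<in> fst c"
  by (auto simp: smooth_manifold_def)

text \<open>Smoothness of a map in all charts of the atlases passes to all coordinate systems of the
  source, because the change to a chart of the atlas is smooth.\<close>

lemma smooth_local_rep:
  fixes A :: "('a::{t2_space,second_countable_topology}, 'n::finite) chart set"
    and d :: "('b::topological_space, 'm::finite) chart"
  assumes A: "smooth_manifold A" and c: "c \<in> coord_systems A" and f: "continuous_on UNIV f" and d: "is_chart d"
    and sm: "\<And>a. a \<in> A \<Longrightarrow> smooth_on (snd a ` (fst a \<inter> f -` fst d)) (local_rep f a d)"
  shows "smooth_on (snd c ` (fst c \<inter> f -` fst d)) (local_rep f c d)"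
proof (rule smooth_on_local)
  fix w assume "w \<in> snd c ` (fst c \<inter> f -` fst d)"
  then obtain x where x: "x \<in> fst c" "f x \<in> fst d" "w = snd c x" by auto
  obtain a where a: "a \<in> A" "x \<in> fst a" using smooth_manifold_cover[OF A] by blast
  have ch: "is_chart c" "is_chart a"
    using c a smooth_manifold_subset[OF A] by (auto intro: coord_systems_chart)
  have of: "open (f -` fst d)" using f is_chartD(1)[OF d] by (simp add: open_vimage continuous_on_open_vimage)
  define T where "T = snd c ` (fst c \<inter> (fst a \<inter> f -` fst d))"
  have T: "open T" unfolding T_def by (intro chart_open_image open_Int of ch is_chartD(1))
  have o2: "open (snd a ` (fst a \<inter> f -` fst d))" by (intro chart_open_image of ch)
  have "compatible c a" using c a by (simp add: coord_systems_def)
  then have "smooth_on T (local_rep id c a)"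
    unfolding compatible_def T_def by (auto elim!: smooth_on_subset)
  moreover have "local_rep id c a ` T \<subseteq> snd a ` (fst a \<inter> f -` fst d)"
    unfolding T_def by (auto simp: local_rep_id is_chartD(5)[OF ch(1)])
  ultimately have "smooth_on T (\<lambda>w. local_rep f a d (local_rep id c a w))"
    using smooth_on_compose[OF T o2 _ sm[OF a(1)]] by blast
  then have "smooth_on T (local_rep f c d)"
    by (rule smooth_on_cong[OF T, rotated])
      (auto simp: T_def local_rep_def is_chartD(5)[OF ch(1)] is_chartD(5)[OF ch(2)])
  then show "\<exists>T. open T \<and> w \<in> T \<and> smooth_on T (local_rep f c d)"
    using T x a by (auto simp: T_def)
qed

lemma smooth_transition:
  assumes "smooth_manifold A" "c \<in> coord_systems A" "d \<in> coord_systems A"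
  shows "smooth_on (snd c ` (fst c \<inter> fst d)) (local_rep id c d)"
proof -
  have "smooth_on (snd a ` (fst a \<inter> id -` fst d)) (local_rep id a d)" if "a \<in> A" for a
    using assms(3) that by (auto simp: coord_systems_def compatible_def Int_commute)
  from smooth_local_rep[OF assms(1,2) _ coord_systems_chart[OF assms(3)] this]
  show ?thesis by (simp add: continuous_on_id')
qed

text \<open>The only source of new coordinate systems: the inverse function theorem turns any smooth
  map with invertible derivative into a coordinate change near a given point.\<close>

lemma coord_system_compose:
  fixes A :: "('a::{t2_space,second_countable_topology}, 2) chart set"
  assumes A: "smooth_manifold A" and c: "c \<in> coord_systems A" and x: "x \<in> fst c"
    and U: "open U" "U \<subseteq> snd c ` fst c" "snd c x \<in> U" and \<Psi>: "smooth_on U \<Psi>"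
    and det: "det (jacobian \<Psi> (at (snd c x))) \<noteq> 0"
  obtains d where "d \<in> coord_systems A" "x \<in> fst d" "fst d \<subseteq> fst c" "snd c ` fst d \<subseteq> U"
    "snd d = (\<lambda>y. \<Psi> (snd c y))" "\<And>w. w \<in> snd c ` fst d \<Longrightarrow> det (jacobian \<Psi> (at w)) \<noteq> 0"
proof -
  obtain U' g where U': "open U'" "U' \<subseteq> U" "snd c x \<in> U'" "open (\<Psi> ` U')"
    and hom: "homeomorphism U' (\<Psi> ` U') \<Psi> g" and sg: "smooth_on (\<Psi> ` U') g"
    and det': "\<And>w. w \<in> U' \<Longrightarrow> det (jacobian \<Psi> (at w)) \<noteq> 0"
    using smooth_local_inverse[OF U(1) \<Psi> U(3) det] by blast
  have ch: "is_chart c" using c by (rule coord_systems_chart)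
  note cD = is_chartD[OF ch]
  have g: "\<And>w. w \<in> U' \<Longrightarrow> g (\<Psi> w) = w" using hom by (auto simp: homeomorphism_def)
  define d where "d = (fst c \<inter> snd c -` U', \<lambda>y. \<Psi> (snd c y))"
  have fd: "fst d = fst c \<inter> snd c -` U'" and sd: "snd d = (\<lambda>y. \<Psi> (snd c y))"
    by (auto simp: d_def)
  have cd: "snd c ` fst d = U'" using U' U(2) by (auto simp: fd)
  have im: "snd d ` fst d = \<Psi> ` U'" unfolding sd cd[symmetric] by (simp add: image_image)
  have inj: "inj_on (snd d) (fst d)"
  proof (rule inj_onI)
    fix y y' assume y: "y \<in> fst d" "y' \<in> fst d" "snd d y = snd d y'"
    then have "snd c y = snd c y'" using g by (metis Int_iff fd sd vimageD)
    then show "y = y'" using y cD(5) unfolding fd by (metis IntD1)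
  qed
  have inv: "chart_inv d (snd d y) = y" if "y \<in> fst d" for y
    unfolding chart_inv_def by (rule inv_into_f_f[OF inj that])
  have inv': "chart_inv d v = chart_inv c (g v)" if "v \<in> \<Psi> ` U'" for v
  proof -
    have "v \<in> snd d ` fst d" using that im by simp
    then obtain y where y: "y \<in> fst d" "v = snd d y" by blast
    have "g v = snd c y" using y g by (simp add: fd sd)
    then show ?thesis using y inv cD(5) by (simp add: fd)
  qed
  have inv2: "chart_inv d v \<in> fst d \<and> snd d (chart_inv d v) = v" if "v \<in> \<Psi> ` U'" for v
  proof -
    have "v \<in> snd d ` fst d" using that im by simp
    then show ?thesis using inv by auto
  qed
  have opd: "open (fst d)" unfolding fd using continuous_open_preimage[OF cD(3,1) U'(1)] .
  have chd: "is_chart d" unfolding is_chart_def im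
  proof (intro conjI opd U' homeomorphismI)
    show "continuous_on (fst d) (snd d)" unfolding sd
      by (rule continuous_on_compose2[OF smooth_on_continuous[OF smooth_on_subset[OF \<Psi> U'(2)]]
          continuous_on_subset[OF cD(3)]]) (auto simp: fd)
    have "continuous_on (\<Psi> ` U') (\<lambda>v. chart_inv c (g v))"
      by (rule continuous_on_compose2[OF cD(4) smooth_on_continuous[OF sg]])
        (use g U'(2) U(2) in auto)
    then show "continuous_on (\<Psi> ` U') (chart_inv d)"
      by (rule continuous_on_eq) (simp add: inv')
  qed (use inv im inv2 in auto)
  have compat: "compatible d a" if a: "a \<in> A" for a
  proof -
    have cha: "is_chart a" and aA: "a \<in> coord_systems A"
      using a smooth_manifold_subset[OF A] by (auto intro: coord_systems_chart)
    have oa: "open (fst a)" by (rule is_chartD[OF cha])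
    have o1: "open (snd d ` (fst d \<inter> fst a))" by (rule chart_open_image[OF chd oa])
    have o2: "open (snd c ` (fst c \<inter> fst a))" by (rule chart_open_image[OF ch oa])
    have o3: "open (snd a ` (fst a \<inter> fst d))" by (rule chart_open_image[OF cha opd])
    have "smooth_on (snd d ` (fst d \<inter> fst a)) (\<lambda>v. local_rep id c a (g v))"
      by (rule smooth_on_compose[OF o1 o2 _ smooth_transition[OF A c aA] smooth_on_subset[OF sg]])
        (use im in \<open>auto simp: sd fd g\<close>)
    then have 1: "smooth_on (snd d ` (fst d \<inter> fst a)) (local_rep id d a)"
      by (rule smooth_on_cong[OF o1, rotated]) (use im inv' in \<open>force simp: local_rep_id\<close>)
    have "smooth_on (snd a ` (fst a \<inter> fst d)) (\<lambda>v. \<Psi> (local_rep id a c v))"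
      by (rule smooth_on_compose[OF o3 U'(1) _ smooth_on_subset[OF \<Psi> U'(2)]
            smooth_on_subset[OF smooth_transition[OF A aA c]]])
        (auto simp: local_rep_id is_chartD(5)[OF cha] fd)
    then have 2: "smooth_on (snd a ` (fst a \<inter> fst d)) (local_rep id a d)"
      by (rule smooth_on_cong[OF o3, rotated]) (auto simp: local_rep_id sd)
    show ?thesis using 1 2 by (simp add: compatible_def Int_commute)
  qed
  have "d \<in> coord_systems A" using chd compat by (simp add: coord_systems_def)
  then show ?thesis
    using that[of d] x U' det' cd by (auto simp: fd sd)
qed

section \<open>Jacobian matrices\<close>

lemma has_derivative_jacobian:
  fixes f :: "real^'n \<Rightarrow> real^'m"
  shows "smooth_on S f \<Longrightarrow> w \<in> S \<Longrightarrow> (f has_derivative (*v) (jacobian f (at w))) (at w)"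
  using jacobian_works[of f "at w"] smooth_on_differentiable by blast

lemma jacobian_eqI:
  fixes f :: "real^'n \<Rightarrow> real^'m"
  assumes "(f has_derivative (*v) M) (at w)"
  shows "jacobian f (at w) = M"
  using frechet_derivative_at[OF assms] by (metis jacobian_def matrix_of_matrix_vector_mul)

lemma has_derivative_chain_matrix:
  fixes f :: "real^'n \<Rightarrow> real^'m" and g :: "real^'m \<Rightarrow> real^'k"
  assumes "(f has_derivative (*v) M) (at w)" "(g has_derivative (*v) N) (at (f w))"
  shows "((\<lambda>w. g (f w)) has_derivative (*v) (N ** M)) (at w)"
  using has_derivative_compose[OF assms] by (simp add: matrix_vector_mul_assoc)

lemma jacobian_component:
  fixes \<Phi> :: "real^2 \<Rightarrow> real^2"
  assumes "smooth_on S \<Phi>" "w \<in> S"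
  shows "jacobian \<Phi> (at w) $ i $ j = pd j (\<lambda>w. \<Phi> w $ i) w"
proof -
  have "pd j (\<lambda>w. \<Phi> w $ i) w = frechet_derivative \<Phi> (at w) (axis j 1) $ i"
    by (rule has_pd_imp_pd, rule has_pdI,
        rule bounded_linear.has_derivative[OF bounded_linear_vec_nth smooth_on_has_derivative[OF assms]]) simp
  then show ?thesis by (simp add: jacobian_def matrix_def)
qed

lemma jacobian_local_rep_comp:
  fixes c :: "('a::topological_space, 'n::finite) chart" and d :: "('b::topological_space, 'm::finite) chart"
    and e :: "('c::topological_space, 'k::finite) chart"
  assumes c: "is_chart c" and d: "is_chart d" and e: "is_chart e"
    and f: "continuous_on UNIV f" and g: "continuous_on UNIV g"
    and x: "x \<in> fst c" "f x \<in> fst d" "g (f x) \<in> fst e"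
    and sf: "smooth_on (snd c ` (fst c \<inter> f -` fst d)) (local_rep f c d)"
    and sg: "smooth_on (snd d ` (fst d \<inter> g -` fst e)) (local_rep g d e)"
  shows "jacobian (local_rep (g \<circ> f) c e) (at (snd c x)) =
    jacobian (local_rep g d e) (at (snd d (f x))) ** jacobian (local_rep f c d) (at (snd c x))"
proof (rule jacobian_eqI)
  define T where "T = snd c ` (fst c \<inter> f -` fst d)"
  have T: "open T"
    unfolding T_def using chart_open_image[OF c] f is_chartD(1)[OF d]
    by (simp add: open_vimage continuous_on_open_vimage)
  have w: "snd c x \<in> T" using x by (auto simp: T_def)
  have "local_rep f c d (snd c x) = snd d (f x)"
    by (simp add: local_rep_def is_chartD(5)[OF c] x)
  then have "((\<lambda>w. local_rep g d e (local_rep f c d w)) has_derivative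
      (*v) (jacobian (local_rep g d e) (at (snd d (f x))) ** jacobian (local_rep f c d) (at (snd c x)))) (at (snd c x))"
    using x has_derivative_jacobian[OF sf, of "snd c x"] has_derivative_jacobian[OF sg, of "snd d (f x)"]
    by (intro has_derivative_chain_matrix) auto
  then show "(local_rep (g \<circ> f) c e has_derivative
      (*v) (jacobian (local_rep g d e) (at (snd d (f x))) ** jacobian (local_rep f c d) (at (snd c x)))) (at (snd c x))"
    by (rule has_derivative_transform_within_open[OF _ T w])
      (auto simp: T_def local_rep_def is_chartD(5)[OF c] is_chartD(5)[OF d])
qed

section \<open>The first fundamental form as a symmetric tensor\<close>

lemma smooth_on_matrix_mult:
  fixes M :: "'a::real_normed_vector \<Rightarrow> real^'n^'m" and N :: "'a \<Rightarrow> real^'k^'n"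
  assumes "open S" "smooth_on S M" "smooth_on S N"
  shows "smooth_on S (\<lambda>x. M x ** N x)"
proof -
  have "smooth_on S (\<lambda>x. (M x ** N x) $ i $ j)" for i j
    unfolding matrix_matrix_mult_def vec_lambda_beta
    by (intro smooth_on_sum smooth_on_mult smooth_on_component assms finite)
  then show ?thesis by (intro smooth_on_vecI assms)
qed

lemma smooth_on_transpose:
  fixes M :: "'a::real_normed_vector \<Rightarrow> real^'n^'m"
  assumes "open S" "smooth_on S M"
  shows "smooth_on S (\<lambda>x. transpose (M x))"
proof -
  have "smooth_on S (\<lambda>x. transpose (M x) $ i $ j)" for i j
    unfolding transpose_def vec_lambda_beta by (intro smooth_on_component assms)
  then show ?thesis by (intro smooth_on_vecI assms)
qed

lemma smooth_on_jacobian: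
  fixes f :: "real^'n \<Rightarrow> real^'m"
  assumes "open S" "smooth_on S f"
  shows "smooth_on S (\<lambda>x. jacobian f (at x))"
proof -
  have "smooth_on S (\<lambda>x. jacobian f (at x) $ i $ j)" for i j
    unfolding jacobian_def matrix_def vec_lambda_beta
    by (intro smooth_on_component smooth_on_deriv assms)
  then show ?thesis by (intro smooth_on_vecI assms)
qed

lemma symmetric_tensorD:
  assumes "symmetric_tensor A g"
  shows "c \<in> coord_systems A \<Longrightarrow> smooth_on (snd c ` fst c) (g c \<circ> chart_inv c)"
    "c \<in> coord_systems A \<Longrightarrow> x \<in> fst c \<Longrightarrow> transpose (g c x) = g c x"
    "c \<in> coord_systems A \<Longrightarrow> d \<in> coord_systems A \<Longrightarrow> x \<in> fst c \<Longrightarrow> x \<in> fst d \<Longrightarrow>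
      g c x = transpose (jacobian (local_rep id c d) (at (snd c x))) ** g d x **
        jacobian (local_rep id c d) (at (snd c x))"
  using assms unfolding symmetric_tensor_def Let_def by blast+

lemma smooth_map_local_rep:
  fixes A :: "('a::{t2_space,second_countable_topology}, 'n::finite) chart set"
    and B :: "('b::{t2_space,second_countable_topology}, 'm::finite) chart set"
  assumes "smooth_manifold A" "smooth_manifold B" "smooth_map A B f" "c \<in> coord_systems A" "d \<in> B"
  shows "smooth_on (snd c ` (fst c \<inter> f -` fst d)) (local_rep f c d)"
proof (rule smooth_local_rep[OF assms(1,4)])
  show "is_chart d" using assms(2,5) by (simp add: smooth_manifold_def)
qed (use assms(3,5) in \<open>auto simp: smooth_map_def\<close>)

text \<open>The chart of the target that the definition selects varies with the point without any regularity. By tensoriality of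
  \<open>g\<close> every chart gives the same matrix, so a fixed one can be used near a given point.\<close>

lemma first_fundamental_form_eq:
  fixes A :: "('a::{t2_space,second_countable_topology}, 'n::finite) chart set"
    and B :: "('b::{t2_space,second_countable_topology}, 'm::finite) chart set"
  assumes A: "smooth_manifold A" and B: "smooth_manifold B" and g: "symmetric_tensor B g"
    and f: "smooth_map A B f" and c: "c \<in> coord_systems A" "x \<in> fst c" and d: "d \<in> B" "f x \<in> fst d"
  shows "first_fundamental_form B g f c x =
    transpose (jacobian (local_rep f c d) (at (snd c x))) ** g d (f x) ** jacobian (local_rep f c d) (at (snd c x))"
proof -
  define d' where "d' = (SOME d. d \<in> B \<and> f x \<in> fst d)"
  have d': "d' \<in> B" "f x \<in> fst d'" unfolding d'_def using someI_ex[of "\<lambda>d. d \<in> B \<and> f x \<in> fst d"] d by blast+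
  have in_coord: "d \<in> coord_systems B" "d' \<in> coord_systems B"
    using d d' smooth_manifold_subset[OF B] by auto
  let ?J = "jacobian (local_rep f c d) (at (snd c x))"
  let ?J' = "jacobian (local_rep f c d') (at (snd c x))"
  let ?K = "jacobian (local_rep id d d') (at (snd d (f x)))"
  have "?J' = ?K ** ?J"
    using jacobian_local_rep_comp[of c d d' f id x] smooth_map_local_rep[OF A B f c(1) d(1)]
      smooth_transition[OF B in_coord] c d d' f in_coord
    by (simp add: coord_systems_chart smooth_map_def continuous_on_id')
  moreover have "g d (f x) = transpose ?K ** g d' (f x) ** ?K"
    by (rule symmetric_tensorD(3)[OF g in_coord d(2) d'(2)])
  ultimately show ?thesis
    unfolding first_fundamental_form_def Let_def d'_def[symmetric]
    by (simp add: matrix_transpose_mul matrix_mul_assoc)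
qed

lemma symmetric_tensor_first_fundamental_form:
  fixes A :: "('a::{t2_space,second_countable_topology}, 'n::finite) chart set"
    and B :: "('b::{t2_space,second_countable_topology}, 'm::finite) chart set"
  assumes A: "smooth_manifold A" and B: "smooth_manifold B" and g: "symmetric_tensor B g"
    and f: "smooth_map A B f"
  shows "symmetric_tensor A (first_fundamental_form B g f)"
proof -
  let ?h = "first_fundamental_form B g f"
  note eq = first_fundamental_form_eq[OF A B g f]
  have cf: "continuous_on UNIV f" using f by (simp add: smooth_map_def)
  have sm: "smooth_on (snd c ` fst c) (?h c \<circ> chart_inv c)" if c: "c \<in> coord_systems A" for c
  proof (rule smooth_on_local)
    fix w assume "w \<in> snd c ` fst c"
    then obtain x where x: "x \<in> fst c" "w = snd c x" by auto
    obtain d where d: "d \<in> B" "f x \<in> fst d" using smooth_manifold_cover[OF B] by blast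
    have dc: "d \<in> coord_systems B" using d smooth_manifold_subset[OF B] by auto
    have ch: "is_chart c" "is_chart d" using c dc by (auto intro: coord_systems_chart)
    define T where "T = snd c ` (fst c \<inter> f -` fst d)"
    have T: "open T"
      unfolding T_def using chart_open_image[OF ch(1)] cf is_chartD(1)[OF ch(2)]
      by (simp add: open_vimage continuous_on_open_vimage)
    note lr = smooth_map_local_rep[OF A B f c d(1), folded T_def]
    have "smooth_on T (\<lambda>w. (g d \<circ> chart_inv d) (local_rep f c d w))"
      by (rule smooth_on_compose[OF T is_chartD(2)[OF ch(2)] _ symmetric_tensorD(1)[OF g dc] lr])
        (auto simp: T_def local_rep_def is_chartD(5)[OF ch(1)])
    then have "smooth_on T (\<lambda>w. transpose (jacobian (local_rep f c d) (at w)) **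
        (g d \<circ> chart_inv d) (local_rep f c d w) ** jacobian (local_rep f c d) (at w))"
      by (intro smooth_on_matrix_mult smooth_on_transpose smooth_on_jacobian T lr)
    then have "smooth_on T (?h c \<circ> chart_inv c)"
    proof (rule smooth_on_cong[OF T, rotated])
      fix w assume "w \<in> T"
      then obtain y where y: "y \<in> fst c" "f y \<in> fst d" "w = snd c y" by (auto simp: T_def)
      then show "transpose (jacobian (local_rep f c d) (at w)) ** (g d \<circ> chart_inv d) (local_rep f c d w) **
          jacobian (local_rep f c d) (at w) = (?h c \<circ> chart_inv c) w"
        using eq[OF c y(1) d(1) y(2)] is_chartD(5)[OF ch(1)] is_chartD(5)[OF ch(2)]
        by (simp add: local_rep_def)
    qed
    then show "\<exists>T. open T \<and> w \<in> T \<and> smooth_on T (?h c \<circ> chart_inv c)"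
      using T x d by (auto simp: T_def)
  qed
  have sy: "transpose (?h c x) = ?h c x" if c: "c \<in> coord_systems A" "x \<in> fst c" for c x
  proof -
    obtain d where d: "d \<in> B" "f x \<in> fst d" using smooth_manifold_cover[OF B] by blast
    have "d \<in> coord_systems B" using d smooth_manifold_subset[OF B] by auto
    then have "transpose (g d (f x)) = g d (f x)" using symmetric_tensorD(2)[OF g] d by blast
    then show ?thesis
      unfolding eq[OF c d] by (simp add: matrix_transpose_mul matrix_mul_assoc transpose_transpose)
  qed
  have tr: "?h c x = transpose (jacobian (local_rep id c c') (at (snd c x))) ** ?h c' x **
        jacobian (local_rep id c c') (at (snd c x))"
    if c: "c \<in> coord_systems A" "c' \<in> coord_systems A" "x \<in> fst c" "x \<in> fst c'" for c c' x
  proof -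
    obtain d where d: "d \<in> B" "f x \<in> fst d" using smooth_manifold_cover[OF B] by blast
    have dc: "is_chart d" using B d by (simp add: smooth_manifold_def)
    have "jacobian (local_rep (f \<circ> id) c d) (at (snd c x)) =
        jacobian (local_rep f c' d) (at (snd c' (id x))) ** jacobian (local_rep id c c') (at (snd c x))"
      by (rule jacobian_local_rep_comp)
        (use c d dc cf smooth_transition[OF A c(1,2)] smooth_map_local_rep[OF A B f c(2) d(1)] in
          \<open>auto intro: coord_systems_chart continuous_on_id\<close>)
    then show ?thesis
      unfolding eq[OF c(1,3) d] eq[OF c(2,4) d] by (simp add: matrix_transpose_mul matrix_mul_assoc)
  qed
  show ?thesis unfolding symmetric_tensor_def Let_def using sm sy tr by blast
qed

section \<open>Degenerate planes in Minkowski space\<close>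

lemma inner_transpose_conj:
  fixes J :: "real^'n^'m" and M :: "real^'m^'m"
  shows "v \<bullet> ((transpose J ** M ** J) *v w) = (J *v v) \<bullet> (M *v (J *v w))"
proof -
  have "v \<bullet> (transpose J *v y) = (J *v v) \<bullet> y" for y
    by (metis dot_lmul_matrix vector_transpose_matrix)
  then show ?thesis by (simp add: matrix_vector_mul_assoc[symmetric])
qed

text \<open>A light cone and a plane tangent to it: if \<open>a \<noteq> 0\<close> is null and orthogonal to \<open>c\<close>, the Cauchy-Schwarz
  inequality in the first two coordinates shows that \<open>c\<close> is not timelike.\<close>

lemma lorentz_orthogonal_to_null:
  fixes a c :: "real^3"
  assumes "a \<noteq> 0" "(a$1)\<^sup>2 + (a$2)\<^sup>2 = (a$3)\<^sup>2" "a$1 * c$1 + a$2 * c$2 = a$3 * c$3"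
  shows "(c$3)\<^sup>2 \<le> (c$1)\<^sup>2 + (c$2)\<^sup>2"
proof -
  have a3: "a$3 \<noteq> 0"
    using assms(1,2) by (auto simp: vec_eq_iff forall_3)
  have "(a$3)\<^sup>2 * (c$3)\<^sup>2 = (a$1 * c$1 + a$2 * c$2)\<^sup>2" by (simp add: assms(3) power_mult_distrib)
  also have "\<dots> \<le> (a$1 * c$1 + a$2 * c$2)\<^sup>2 + (a$1 * c$2 - a$2 * c$1)\<^sup>2" by simp
  also have "\<dots> = ((a$1)\<^sup>2 + (a$2)\<^sup>2) * ((c$1)\<^sup>2 + (c$2)\<^sup>2)" by algebra
  also have "\<dots> = (a$3)\<^sup>2 * ((c$1)\<^sup>2 + (c$2)\<^sup>2)" by (simp add: assms(2))
  finally show ?thesis using a3 by simp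
qed

text \<open>The degenerate plane contains a nonzero null vector to which all its vectors are orthogonal, so none
  of them is timelike.\<close>

lemma lorentz_signature_degenerate_plane:
  fixes m :: "real^3^3" and J :: "real^2^3"
  assumes m: "lorentz_signature m" and J: "inj ((*v) J)" and deg: "degenerate_form (transpose J ** m ** J)"
  shows "w \<bullet> ((transpose J ** m ** J) *v w) \<ge> 0"
proof -
  obtain P :: "real^3^3" where P: "invertible P" and
    Pm: "transpose P ** m ** P = (\<chi> i j. if i = j then (if i = 3 then -1 else 1) else 0)" (is "_ = ?S")
    using m unfolding lorentz_signature_def by blast
  obtain P' where P': "P ** P' = mat 1" "P' ** P = mat 1" using P unfolding invertible_def by blast
  have Sab: "a \<bullet> (?S *v b) = a$1 * b$1 + a$2 * b$2 - a$3 * b$3" for a b :: "real^3"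
    by (simp add: inner_vec_def sum_3 matrix_vector_mult_def)
  have S: "x \<bullet> (m *v y) = (P' *v x)$1 * (P' *v y)$1 + (P' *v x)$2 * (P' *v y)$2 - (P' *v x)$3 * (P' *v y)$3" for x y
  proof -
    have "x \<bullet> (m *v y) = (P *v (P' *v x)) \<bullet> (m *v (P *v (P' *v y)))"
      by (simp add: matrix_vector_mul_assoc matrix_mul_assoc P')
    also have "\<dots> = (P' *v x) \<bullet> (?S *v (P' *v y))"
      unfolding inner_transpose_conj[symmetric] Pm ..
    also have "\<dots> = (P' *v x)$1 * (P' *v y)$1 + (P' *v x)$2 * (P' *v y)$2 - (P' *v x)$3 * (P' *v y)$3"
      by (rule Sab)
    finally show ?thesis .
  qed
  obtain v where v: "v \<noteq> 0" "\<And>w. v \<bullet> ((transpose J ** m ** J) *v w) = 0"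
    using deg unfolding degenerate_form_def null_vector_def by blast
  have Jv: "J *v v \<noteq> 0" using J v(1) by (metis injD matrix_vector_mult_0_right)
  let ?a = "P' *v (J *v v)" and ?c = "P' *v (J *v w)"
  have "?a \<noteq> 0"
  proof
    assume "?a = 0"
    then have "P *v ?a = 0" by (simp add: matrix_vector_mult_0_right)
    then show False using Jv by (simp add: matrix_vector_mul_assoc matrix_mul_assoc P')
  qed
  moreover have "(?a$1)\<^sup>2 + (?a$2)\<^sup>2 = (?a$3)\<^sup>2" "?a$1 * ?c$1 + ?a$2 * ?c$2 = ?a$3 * ?c$3"
    using v(2)[of v] v(2)[of w] unfolding inner_transpose_conj S by (simp_all add: power2_eq_square)
  ultimately have "(?c$3)\<^sup>2 \<le> (?c$1)\<^sup>2 + (?c$2)\<^sup>2" by (rule lorentz_orthogonal_to_null)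
  then show ?thesis unfolding inner_transpose_conj S by (simp add: power2_eq_square)
qed

section \<open>Lightlike points in coordinates\<close>

lemma degenerate_form_iff_det: "degenerate_form m \<longleftrightarrow> det m = 0"
proof -
  have "v \<bullet> (m *v w) = (transpose m *v v) \<bullet> w" for v w
    by (simp add: dot_lmul_matrix)
  then have "null_vector m v \<longleftrightarrow> v \<noteq> 0 \<and> transpose m *v v = 0" for v
    unfolding null_vector_def by (auto dest: spec[of _ "transpose m *v v"])
  then have "degenerate_form m \<longleftrightarrow> \<not> invertible (transpose m)"
    unfolding degenerate_form_def invertible_left_inverse matrix_left_invertible_ker by auto
  then show ?thesis by (simp only: invertible_det_nz det_transpose not_not)
qed

text \<open>What the arguments below need to know about the first fundamental form.\<close>

locale surface_metric =
  fixes A :: "('a::{t2_space, second_countable_topology}, 2) chart set"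
    and h :: "('a, 2) components"
  assumes manifold: "smooth_manifold A" and tensor: "symmetric_tensor A h"
begin

abbreviation "cs \<equiv> coord_systems A"

lemmas chD = is_chartD[OF coord_systems_chart, of _ A]

abbreviation jac :: "('a, 2) chart \<Rightarrow> ('a, 2) chart \<Rightarrow> 'a \<Rightarrow> real^2^2" where
  "jac c d x \<equiv> jacobian (local_rep id c d) (at (snd c x))"

lemma transform: "c \<in> cs \<Longrightarrow> d \<in> cs \<Longrightarrow> x \<in> fst c \<Longrightarrow> x \<in> fst d \<Longrightarrow>
    h c x = transpose (jac c d x) ** h d x ** jac c d x"
  by (rule symmetric_tensorD(3)[OF tensor])

lemma open_overlap: "c \<in> cs \<Longrightarrow> d \<in> cs \<Longrightarrow> open (snd c ` (fst c \<inter> fst d))"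
  by (intro chart_open_image coord_systems_chart[of _ A] chD(1))

lemma jac_inverse:
  assumes "c \<in> cs" "d \<in> cs" "x \<in> fst c" "x \<in> fst d"
  shows "jac d c x ** jac c d x = mat 1"
proof -
  have "jacobian (local_rep (id \<circ> id) c c) (at (snd c x)) = jac d c (id x) ** jac c d x"
    by (rule jacobian_local_rep_comp)
      (use assms smooth_transition[OF manifold] in \<open>auto intro: coord_systems_chart continuous_on_id\<close>)
  moreover have "jacobian (local_rep (id \<circ> id) c c) (at (snd c x)) = mat 1"
  proof (rule jacobian_eqI)
    have "((\<lambda>w. w) has_derivative (*v) (mat 1)) (at (snd c x))"
      by (simp add: matrix_vector_mul_lid[abs_def])
    then show "(local_rep (id \<circ> id) c c has_derivative (*v) (mat 1)) (at (snd c x))"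
      by (rule has_derivative_transform_within_open[OF _ chD(2)[OF assms(1)]])
        (use assms in \<open>auto simp: local_rep_id chD\<close>)
  qed
  ultimately show ?thesis by simp
qed

lemma det_jac: "c \<in> cs \<Longrightarrow> d \<in> cs \<Longrightarrow> x \<in> fst c \<Longrightarrow> x \<in> fst d \<Longrightarrow> det (jac c d x) \<noteq> 0"
  using jac_inverse[of c d x] by (metis det_I det_mul mult_zero_right zero_neq_one)

lemma lam_eq_det: "c \<in> cs \<Longrightarrow> x \<in> fst c \<Longrightarrow> lam h c (snd c x) = det (h c x)"
proof -
  assume c: "c \<in> cs" "x \<in> fst c"
  have "h c x $ 2 $ 1 = h c x $ 1 $ 2"
  proof -
    have "h c x $ 2 $ 1 = transpose (h c x) $ 2 $ 1" by (simp only: symmetric_tensorD(2)[OF tensor c])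
    then show ?thesis by (simp add: transpose_def)
  qed
  then show ?thesis
    by (simp add: lam_def coefE_def coefF_def coefG_def chD(5)[OF c] det_2 power2_eq_square)
qed

lemma lam_transform:
  assumes "c \<in> cs" "d \<in> cs" "x \<in> fst c" "x \<in> fst d"
  shows "lam h c (snd c x) = (det (jac c d x))\<^sup>2 * lam h d (snd d x)"
  using transform[OF assms] lam_eq_det assms
  by (simp add: det_mul det_transpose power2_eq_square)

lemma LD_iff_lam:
  assumes "c \<in> cs" "x \<in> fst c"
  shows "x \<in> LD A h \<longleftrightarrow> lam h c (snd c x) = 0"
proof
  assume "x \<in> LD A h"
  then obtain d where d: "d \<in> cs" "x \<in> fst d" "lam h d (snd d x) = 0"
    unfolding LD_def using degenerate_form_iff_det lam_eq_det by fastforce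
  then show "lam h c (snd c x) = 0"
    using lam_transform[OF d(1) assms(1) d(2) assms(2)] det_jac[OF d(1) assms(1) d(2) assms(2)] by simp
next
  assume "lam h c (snd c x) = 0"
  then have "degenerate_form (h c x)" using lam_eq_det[OF assms] degenerate_form_iff_det by simp
  then show "x \<in> LD A h" using assms unfolding LD_def by blast
qed

lemma null_vector_transform:
  assumes "c \<in> cs" "d \<in> cs" "x \<in> fst c" "x \<in> fst d" "null_vector (h c x) v"
  shows "null_vector (h d x) (jac c d x *v v)"
proof -
  let ?J = "jac c d x"
  have JK: "?J ** jac d c x = mat 1" "jac d c x ** ?J = mat 1" using jac_inverse assms by auto
  have v: "v \<noteq> 0" "\<And>w. (?J *v v) \<bullet> (h d x *v (?J *v w)) = 0"
    using assms(5) unfolding null_vector_def transform[OF assms(1-4)] inner_transpose_conj by auto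
  have w: "w = ?J *v (jac d c x *v w)" for w
    by (simp add: matrix_vector_mul_assoc JK)
  have "(?J *v v) \<bullet> (h d x *v w) = 0" for w
    using v(2)[of "jac d c x *v w"] by (simp flip: w)
  moreover have "?J *v v \<noteq> 0"
  proof
    assume "?J *v v = 0"
    then have "jac d c x *v (?J *v v) = 0" by (simp add: matrix_vector_mult_0_right)
    then show False using v(1) by (simp add: matrix_vector_mul_assoc JK)
  qed
  ultimately show ?thesis unfolding null_vector_def by blast
qed

lemma smooth_coef:
  assumes "c \<in> cs"
  shows "smooth_on (snd c ` fst c) (coefE h c)" "smooth_on (snd c ` fst c) (coefF h c)"
    "smooth_on (snd c ` fst c) (coefG h c)" "smooth_on (snd c ` fst c) (lam h c)"
proof -
  have "smooth_on (snd c ` fst c) (\<lambda>w. h c (chart_inv c w))"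
    using symmetric_tensorD(1)[OF tensor assms] by (simp add: o_def)
  then have *: "smooth_on (snd c ` fst c) (\<lambda>w. h c (chart_inv c w) $ i $ j)" for i j
    by (intro smooth_on_component chD[OF assms])
  show "smooth_on (snd c ` fst c) (coefE h c)" "smooth_on (snd c ` fst c) (coefF h c)"
    "smooth_on (snd c ` fst c) (coefG h c)"
    unfolding coefE_def[abs_def] coefF_def[abs_def] coefG_def[abs_def] by (rule *)+
  then show "smooth_on (snd c ` fst c) (lam h c)"
    unfolding lam_def[abs_def] by (intro smooth_on_diff smooth_on_mult smooth_on_power chD[OF assms])
qed

text \<open>The discriminants of two coordinate systems differ by the square of a Jacobian determinant, which
  does not vanish, so a regular zero of one is a regular zero of the other.\<close>

lemma nondegenerate_lam:
  assumes "nondegenerate_lightlike A h x" "c \<in> cs" "x \<in> fst c"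
  shows "pd 1 (lam h c) (snd c x) \<noteq> 0 \<or> pd 2 (lam h c) (snd c x) \<noteq> 0"
proof (rule ccontr)
  assume "\<not> ?thesis"
  then have z: "pd 1 (lam h c) (snd c x) = 0" "pd 2 (lam h c) (snd c x) = 0" by auto
  obtain d where d: "d \<in> cs" "x \<in> fst d" "frechet_derivative (lam h d) (at (snd d x)) \<noteq> (\<lambda>_. 0)"
    using assms(1) unfolding nondegenerate_lightlike_def by blast
  have x: "lam h c (snd c x) = 0"
    using assms LD_iff_lam unfolding nondegenerate_lightlike_def by blast
  define S where "S = snd d ` (fst d \<inter> fst c)"
  have S: "open S" "snd d x \<in> S" using open_overlap d assms by (auto simp: S_def)
  let ?t = "local_rep id d c"
  have tx: "?t (snd d x) = snd c x" by (simp add: local_rep_id chD(5)[OF d(1)] d)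
  have st: "smooth_on S ?t" unfolding S_def by (rule smooth_transition[OF manifold d(1) assms(2)])
  have "smooth_on S (\<lambda>w. jacobian ?t (at w) $ i $ j)" for i j
    by (intro smooth_on_component smooth_on_jacobian S st)
  then have sD: "smooth_on S (\<lambda>w. (det (jacobian ?t (at w)))\<^sup>2)"
    unfolding det_2 by (intro smooth_on_diff smooth_on_mult smooth_on_power S)
  have eq: "lam h d w = (det (jacobian ?t (at w)))\<^sup>2 * lam h c (?t w)" if "w \<in> S" for w
    using that lam_transform[OF d(1) assms(2)] by (auto simp: S_def local_rep_id chD(5)[OF d(1)])
  have "pd i (lam h d) (snd d x) = 0" for i
    by (rule pd_eqI[OF S], erule eq, rule has_pd_mult, rule has_pd_smooth[OF sD S(2)],
        rule has_pd_chain[OF smooth_coef(4)[OF assms(2)] _ st S])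
      (use assms in \<open>auto simp: tx x z\<close>)
  then have ax: "frechet_derivative (lam h d) (at (snd d x)) (axis i 1) = 0" for i by (simp add: pd_def)
  have "linear (frechet_derivative (lam h d) (at (snd d x)))"
    using smooth_on_has_derivative[OF smooth_coef(4)[OF d(1)], of "snd d x"] d has_derivative_linear by blast
  then have "frechet_derivative (lam h d) (at (snd d x)) v = 0" for v
    by (subst vec2_eq_axes[of v]) (simp add: linear_add linear_cmul ax)
  then show False using d(3) by auto
qed

text \<open>A coordinate system straightens the lightlike set if that set is its first axis. Such
  systems exist because the discriminant itself can serve as the second coordinate.\<close>

definition straight :: "('a, 2) chart \<Rightarrow> bool" where
  "straight d \<longleftrightarrow> d \<in> cs \<and> LD A h \<inter> fst d = {x \<in> fst d. snd d x $ 2 = 0}"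

lemma straightD: "straight d \<Longrightarrow> d \<in> cs" "straight d \<Longrightarrow> x \<in> fst d \<Longrightarrow> x \<in> LD A h \<longleftrightarrow> snd d x $ 2 = 0"
  by (auto simp: straight_def)

lemma straight_lam:
  assumes "straight d" "w \<in> snd d ` fst d" "w $ 2 = 0"
  shows "lam h d w = 0" "pd 1 (lam h d) w = 0"
proof -
  have *: "lam h d w = 0" if "w \<in> snd d ` fst d" "w $ 2 = 0" for w
    using that straightD[OF assms(1)] LD_iff_lam by auto
  show "lam h d w = 0" using * assms by blast
  show "pd 1 (lam h d) w = 0"
    using straightD(1)[OF assms(1)] *
    by (intro pd_1_zero_on_axis[OF chD(2) smooth_coef(4) _ assms(2,3)]) auto
qed

lemma nondegenerate_straight:
  assumes "straight d" "x \<in> fst d" "nondegenerate_lightlike A h x"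
  shows "snd d x $ 2 = 0" "pd 2 (lam h d) (snd d x) \<noteq> 0"
proof -
  show "snd d x $ 2 = 0"
    using assms straightD[OF assms(1)] by (auto simp: nondegenerate_lightlike_def)
  then show "pd 2 (lam h d) (snd d x) \<noteq> 0"
    using nondegenerate_lam[OF assms(3) straightD(1)[OF assms(1)] assms(2)]
      straight_lam(2)[OF assms(1)] assms(2) by auto
qed

lemma straight_exists:
  assumes "nondegenerate_lightlike A h p"
  obtains d where "straight d" "p \<in> fst d" "snd d p = 0"
proof -
  obtain c where c: "c \<in> cs" "p \<in> fst c"
    using assms unfolding nondegenerate_lightlike_def by blast
  let ?V = "snd c ` fst c" and ?w0 = "snd c p" and ?l = "lam h c"
  have V: "open ?V" "?w0 \<in> ?V" using c chD by auto
  define a b where "a = pd 1 ?l ?w0" and "b = pd 2 ?l ?w0"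
  have ab: "a\<^sup>2 + b\<^sup>2 \<noteq> 0"
    using nondegenerate_lam[OF assms c] by (auto simp: a_def b_def sum_power2_eq_zero_iff)
  \<comment> \<open>The first coordinate is linear, with differential orthogonal to that of the discriminant.\<close>
  define \<Psi> :: "real^2 \<Rightarrow> real^2" where
    "\<Psi> w = vector [b * (w $ 1 - ?w0 $ 1) - a * (w $ 2 - ?w0 $ 2), ?l w]" for w
  have s\<Psi>: "smooth_on ?V \<Psi>"
  proof (rule smooth_on_vecI[OF V(1)])
    fix i :: 2
    consider "i = 1" | "i = 2" using exhaust_2 by blast
    then show "smooth_on ?V (\<lambda>w. \<Psi> w $ i)"
      by cases (auto simp: \<Psi>_def intro!: smooth_on_diff smooth_on_mult smooth_on_const
          smooth_on_component smooth_on_id V(1) smooth_coef(4)[OF c(1)])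
  qed
  have "has_pd i (\<lambda>w. \<Psi> w $ 1) ?w0 (if i = 1 then b else - a)" for i
  proof -
    have "has_pd i (\<lambda>w. b * (w $ 1 - ?w0 $ 1) - a * (w $ 2 - ?w0 $ 2)) ?w0
      (b * ((if i = 1 then 1 else 0) - 0) + 0 * (?w0 $ 1 - ?w0 $ 1)
        - (a * ((if i = 2 then 1 else 0) - 0) + 0 * (?w0 $ 2 - ?w0 $ 2)))"
      by (intro has_pd_diff has_pd_mult has_pd_const has_pd_component)
    then show ?thesis using exhaust_2[of i] by (auto simp: \<Psi>_def)
  qed
  then have 1: "pd i (\<lambda>w. \<Psi> w $ 1) ?w0 = (if i = 1 then b else - a)" for i by (rule has_pd_imp_pd)
  have 2: "pd i (\<lambda>w. \<Psi> w $ 2) ?w0 = (if i = 1 then a else b)" for i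
    using exhaust_2[of i] by (auto simp: \<Psi>_def a_def b_def)
  have "det (jacobian \<Psi> (at ?w0)) = a\<^sup>2 + b\<^sup>2"
    unfolding det_2 jacobian_component[OF s\<Psi> V(2)] 1 2 by (simp add: power2_eq_square)
  then have "det (jacobian \<Psi> (at ?w0)) \<noteq> 0" using ab by simp
  from coord_system_compose[OF manifold c V(1) subset_refl V(2) s\<Psi> this]
  obtain d where d: "d \<in> cs" "p \<in> fst d" "fst d \<subseteq> fst c" "snd d = (\<lambda>y. \<Psi> (snd c y))" by metis
  have "straight d"
    unfolding straight_def using d LD_iff_lam[OF c(1)] by (auto simp: \<Psi>_def)
  moreover have "snd d p = 0"
    using assms LD_iff_lam[OF c] by (auto simp: d(4) \<Psi>_def vec_eq_iff forall_2 nondegenerate_lightlike_def)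
  ultimately show ?thesis using that d by blast
qed

end

section \<open>The kind of a lightlike point\<close>

lemma lin_indep2_iff: "x \<noteq> 0 \<Longrightarrow> lin_indep2 x y \<longleftrightarrow> \<not> (\<exists>s. y = s *\<^sub>R x)"
  unfolding lin_indep2_def insert_commute[of x y]
  by (auto simp: independent_insert span_singleton) (metis scaleR_one)

context surface_metric
begin

lemma component_coef:
  assumes "c \<in> cs" "x \<in> fst c"
  shows "h c x $ 1 $ 1 = coefE h c (snd c x)" "h c x $ 1 $ 2 = coefF h c (snd c x)"
    "h c x $ 2 $ 1 = coefF h c (snd c x)" "h c x $ 2 $ 2 = coefG h c (snd c x)"
proof -
  show "h c x $ 1 $ 1 = coefE h c (snd c x)" "h c x $ 2 $ 2 = coefG h c (snd c x)"
    and F: "h c x $ 1 $ 2 = coefF h c (snd c x)"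
    by (auto simp: coefE_def coefF_def coefG_def chD(5)[OF assms])
  have "h c x $ 2 $ 1 = transpose (h c x) $ 2 $ 1" by (simp only: symmetric_tensorD(2)[OF tensor assms])
  then show "h c x $ 2 $ 1 = coefF h c (snd c x)" by (simp add: transpose_def F)
qed

lemma null_vector_coef:
  assumes "c \<in> cs" "x \<in> fst c"
  shows "null_vector (h c x) v \<longleftrightarrow> v \<noteq> 0 \<and>
    v $ 1 * coefE h c (snd c x) + v $ 2 * coefF h c (snd c x) = 0 \<and>
    v $ 1 * coefF h c (snd c x) + v $ 2 * coefG h c (snd c x) = 0"
proof -
  let ?e = "v $ 1 * coefE h c (snd c x) + v $ 2 * coefF h c (snd c x)"
  let ?f = "v $ 1 * coefF h c (snd c x) + v $ 2 * coefG h c (snd c x)"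
  have "v \<bullet> (h c x *v w) = w $ 1 * ?e + w $ 2 * ?f" for w
    by (simp add: inner_vec_def matrix_vector_mult_def sum_2 component_coef[OF assms] algebra_simps)
  then have "(\<forall>w. v \<bullet> (h c x *v w) = 0) \<longleftrightarrow> (\<forall>w::real^2. w $ 1 * ?e + w $ 2 * ?f = 0)" by simp
  also have "\<dots> \<longleftrightarrow> ?e = 0 \<and> ?f = 0"
  proof (intro iffI conjI)
    assume *: "\<forall>w::real^2. w $ 1 * ?e + w $ 2 * ?f = 0"
    show "?e = 0" using *[rule_format, of "vector [1, 0]"] by simp
    show "?f = 0" using *[rule_format, of "vector [0, 1]"] by simp
  qed auto
  finally show ?thesis by (simp add: null_vector_def)
qed

text \<open>A characteristic curve stays on the axis of a straightening coordinate system, so its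
  velocity is a multiple of the first coordinate direction.\<close>

lemma velocity_straight:
  assumes d: "straight d" "q \<in> fst d" and cc: "characteristic_curve A h c q \<gamma>"
  obtains a where "a \<noteq> 0" "velocity c \<gamma> 0 = jac d c q *v axis 1 a"
proof -
  have c: "c \<in> cs" and g0: "\<gamma> 0 = q" using cc by (auto simp: characteristic_curve_def)
  obtain e W where e: "e > 0" and gI: "\<gamma> ` {-e<..<e} \<subseteq> fst c"
    and sk: "smooth_on {-e<..<e} (snd c \<circ> \<gamma>)" and v0: "\<forall>t\<in>{-e<..<e}. velocity c \<gamma> t \<noteq> 0"
    and W: "LD A h \<inter> W = \<gamma> ` {-e<..<e}"
    using cc by (auto simp: characteristic_curve_def)
  have dc: "d \<in> cs" using straightD d by auto
  have I0: "0 \<in> {-e<..<e}" using e by simp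
  have qc: "q \<in> fst c" using gI g0 I0 by auto
  define T where "T = snd c ` (fst c \<inter> fst d)"
  have T: "open T" "snd c q \<in> T" using open_overlap c dc qc d by (auto simp: T_def)
  let ?k = "snd c \<circ> \<gamma>" and ?t = "local_rep id c d" and ?v = "velocity c \<gamma> 0"
  have "(?k has_vector_derivative ?v) (at 0)"
    unfolding velocity_def using smooth_on_differentiable[OF sk I0] by (simp flip: vector_derivative_works)
  moreover have "(?t has_derivative (*v) (jac c d q)) (at (?k 0))"
    using has_derivative_jacobian[OF smooth_transition[OF manifold c dc]] T by (simp add: g0 T_def)
  ultimately have D: "((?t \<circ> ?k) has_vector_derivative jac c d q *v ?v) (at 0)"
    using vector_derivative_diff_chain_within[of ?k ?v 0 UNIV ?t "(*v) (jac c d q)"]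
    by (simp add: has_derivative_at_withinI)
  then have D2: "((\<lambda>t. (?t \<circ> ?k) t $ 2) has_vector_derivative (jac c d q *v ?v) $ 2) (at 0)"
    by (rule bounded_linear.has_vector_derivative[OF bounded_linear_vec_nth])
  define N where "N = {-e<..<e} \<inter> ?k -` T"
  have N: "open N" "0 \<in> N"
    unfolding N_def using continuous_open_preimage[OF smooth_on_continuous[OF sk] _ T(1)] I0 T(2) g0 by auto
  have "(?t \<circ> ?k) t $ 2 = 0" if t: "t \<in> N" for t
  proof -
    have "\<gamma> t \<in> fst c" "\<gamma> t \<in> LD A h" using t gI W by (auto simp: N_def)
    moreover from this obtain y where "y \<in> fst c" "y \<in> fst d" "snd c (\<gamma> t) = snd c y"
      using t by (auto simp: N_def T_def)
    then have "\<gamma> t \<in> fst d" using chD(5)[OF c] \<open>\<gamma> t \<in> fst c\<close> by metis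
    ultimately show ?thesis
      using straightD(2)[OF d(1)] by (simp add: local_rep_id chD(5)[OF c])
  qed
  then have "((\<lambda>t. 0) has_vector_derivative (jac c d q *v ?v) $ 2) (at 0)"
    by (intro has_vector_derivative_transform_within_open[OF D2 N]) auto
  then have "(jac c d q *v ?v) $ 2 = 0"
    using vector_derivative_at has_vector_derivative_const by metis
  then have ax: "jac c d q *v ?v = axis 1 ((jac c d q *v ?v) $ 1)"
    by (simp add: vec_eq_iff forall_2 axis_def)
  have "jac d c q *v (jac c d q *v ?v) = ?v"
    by (simp add: matrix_vector_mul_assoc jac_inverse[OF c dc qc d(2)])
  then have v: "?v = jac d c q *v axis 1 ((jac c d q *v ?v) $ 1)" using ax by simp
  moreover have "(jac c d q *v ?v) $ 1 \<noteq> 0"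
  proof
    assume *: "(jac c d q *v ?v) $ 1 = 0"
    have "axis 1 0 = (0 :: real^2)" by (simp add: vec_eq_iff axis_def)
    with v have "?v = 0" by (simp only: * matrix_vector_mult_0_right)
    then show False using v0 I0 by auto
  qed
  ultimately show ?thesis using that by blast
qed

lemma char_data_null:
  assumes "char_data A h q c \<gamma> \<eta>" "q \<in> LD A h"
  shows "null_vector (h c q) (\<eta> (\<gamma> 0))" "c \<in> cs" "q \<in> fst c"
  using assms by (auto simp: char_data_def null_vector_field_def characteristic_curve_def)

lemma axis_scale: "axis 1 a = a *\<^sub>R (axis 1 1 :: real^2)"
  by (simp add: vec_eq_iff axis_def)

lemma second_kind_null_axis:
  assumes p: "second_kind A h p" and d: "straight d" "p \<in> fst d"
  shows "null_vector (h d p) (axis 1 1)"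
proof -
  obtain c \<gamma> \<eta> where cd: "char_data A h p c \<gamma> \<eta>" and dep: "\<not> lin_indep2 (velocity c \<gamma> 0) (\<eta> (\<gamma> 0))"
    and LD: "p \<in> LD A h"
    using p by (auto simp: second_kind_def nondegenerate_lightlike_def)
  note n = char_data_null[OF cd LD]
  have dc: "d \<in> cs" using straightD d by auto
  have "characteristic_curve A h c p \<gamma>" using cd by (simp add: char_data_def)
  from velocity_straight[OF d this]
  obtain a where a: "a \<noteq> 0" "velocity c \<gamma> 0 = jac d c p *v axis 1 a" .
  have inv: "jac c d p *v (jac d c p *v w) = w" for w
    by (simp add: matrix_vector_mul_assoc jac_inverse[OF dc n(2) d(2) n(3)])
  have "velocity c \<gamma> 0 \<noteq> 0" using a inv[of "axis 1 a"]
    by (auto simp: matrix_vector_mult_0_right axis_eq_0_iff)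
  then obtain s where s: "\<eta> (\<gamma> 0) = s *\<^sub>R velocity c \<gamma> 0"
    using dep lin_indep2_iff by blast
  have "null_vector (h d p) (jac c d p *v \<eta> (\<gamma> 0))"
    by (rule null_vector_transform[OF n(2) dc n(3) d(2) n(1)])
  moreover have "jac c d p *v \<eta> (\<gamma> 0) = (s * a) *\<^sub>R axis 1 1"
    by (simp add: s a(2) matrix_vector_mult_scaleR inv axis_scale[of a])
  ultimately show ?thesis by (auto simp: null_vector_def)
qed

text \<open>If \<open>F\<close> vanishes, then \<open>\<partial>\<^sub>x\<close> spans the null direction and the characteristic curve, which runs along the axis, is
  tangent to it.\<close>

lemma first_kind_coefF:
  assumes q: "first_kind A h q" and d: "straight d" "q \<in> fst d" and G: "coefG h d (snd d q) \<noteq> 0"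
  shows "coefF h d (snd d q) \<noteq> 0"
proof
  assume F: "coefF h d (snd d q) = 0"
  obtain c \<gamma> \<eta> where cd: "char_data A h q c \<gamma> \<eta>" and ind: "lin_indep2 (velocity c \<gamma> 0) (\<eta> (\<gamma> 0))"
    and LD: "q \<in> LD A h"
    using q by (auto simp: first_kind_def nondegenerate_lightlike_def)
  note n = char_data_null[OF cd LD]
  have dc: "d \<in> cs" using straightD d by auto
  have "characteristic_curve A h c q \<gamma>" using cd by (simp add: char_data_def)
  from velocity_straight[OF d this]
  obtain a where a: "a \<noteq> 0" "velocity c \<gamma> 0 = jac d c q *v axis 1 a" .
  let ?K = "jac c d q *v \<eta> (\<gamma> 0)"
  have "null_vector (h d q) ?K"
    by (rule null_vector_transform[OF n(2) dc n(3) d(2) n(1)])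
  then have "?K $ 2 = 0" using G F by (simp add: null_vector_coef[OF dc d(2)])
  then have K: "?K = (?K $ 1 / a) *\<^sub>R axis 1 a"
    using a(1) by (simp add: vec_eq_iff forall_2 axis_def)
  have "\<eta> (\<gamma> 0) = jac d c q *v ?K"
    by (simp add: matrix_vector_mul_assoc jac_inverse[OF n(2) dc n(3) d(2)])
  also have "\<dots> = jac d c q *v ((?K $ 1 / a) *\<^sub>R axis 1 a)" by (rule arg_cong[OF K])
  also have "\<dots> = (?K $ 1 / a) *\<^sub>R velocity c \<gamma> 0" by (simp only: matrix_vector_mult_scaleR a(2))
  finally have "\<eta> (\<gamma> 0) = (?K $ 1 / a) *\<^sub>R velocity c \<gamma> 0" .
  moreover have "velocity c \<gamma> 0 \<noteq> 0" using ind by (auto simp: lin_indep2_def dependent_zero)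
  ultimately show False using ind lin_indep2_iff by blast
qed

end

locale semidefinite_surface_metric = surface_metric +
  assumes degenerate_nonneg: "\<And>c x v. c \<in> coord_systems A \<Longrightarrow> x \<in> fst c \<Longrightarrow>
    degenerate_form (h c x) \<Longrightarrow> v \<bullet> (h c x *v v) \<ge> 0"
begin

text \<open>At a point of the second kind the first coordinate direction is null, so regularity of the
  discriminant and semidefiniteness make the second one spacelike, also nearby.\<close>

lemma second_kind_chart:
  assumes p: "second_kind A h p"
  obtains d where "straight d" "p \<in> fst d" "snd d p = 0" "coefF h d 0 = 0"
    "\<And>w. w \<in> snd d ` fst d \<Longrightarrow> coefG h d w > 0"
proof -
  have nd: "nondegenerate_lightlike A h p" using p by (simp add: second_kind_def)
  obtain c where c: "straight c" "p \<in> fst c" "snd c p = 0" using straight_exists[OF nd] by blast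
  have cc: "c \<in> cs" using straightD c by auto
  note V = chD(2)[OF cc]
  have V0: "0 \<in> snd c ` fst c" using c by force
  have nu: "coefE h c 0 = 0" "coefF h c 0 = 0"
    using second_kind_null_axis[OF p c(1,2)] by (simp_all add: null_vector_coef[OF cc c(2)] c(3) axis_def)
  note sm = smooth_coef[OF cc]
  have "pd 2 (lam h c) 0 = pd 2 (coefE h c) 0 * coefG h c 0"
    by (rule pd_eqI[OF V V0], rule lam_def, rule has_pd_diff, rule has_pd_mult,
        rule has_pd_smooth[OF sm(1) V0], rule has_pd_smooth[OF sm(3) V0], rule has_pd_power2,
        rule has_pd_smooth[OF sm(2) V0]) (simp add: nu)
  then have "coefG h c 0 \<noteq> 0" using nondegenerate_straight(2)[OF c(1,2) nd] c(3) by auto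
  moreover have "degenerate_form (h c p)"
    using second_kind_null_axis[OF p c(1,2)] by (auto simp: degenerate_form_def)
  then have "axis 2 1 \<bullet> (h c p *v axis 2 1) \<ge> 0" by (rule degenerate_nonneg[OF cc c(2)])
  then have "coefG h c 0 \<ge> 0"
    by (simp add: inner_vec_def matrix_vector_mult_def sum_2 axis_def component_coef[OF cc c(2)] c(3))
  ultimately have G0: "coefG h c 0 > 0" by simp
  define U where "U = snd c ` fst c \<inter> coefG h c -` {0<..}"
  have U: "open U" "U \<subseteq> snd c ` fst c" "snd c p \<in> U"
    unfolding U_def using continuous_open_preimage[OF smooth_on_continuous[OF sm(3)] V] G0 V0 c(3) by auto
  have jid: "jacobian (\<lambda>w. w) (at (w::real^2)) = mat 1" for w
    by (rule jacobian_eqI) (simp add: matrix_vector_mul_lid[abs_def])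
  obtain d where d: "d \<in> cs" "p \<in> fst d" "fst d \<subseteq> fst c" "snd c ` fst d \<subseteq> U" "snd d = (\<lambda>y. snd c y)"
    by (rule coord_system_compose[OF manifold cc c(2) U smooth_on_id[OF U(1)]]) (auto simp: jid)
  have inv: "chart_inv d (snd c x) = x" if "x \<in> fst d" for x
    using chD(5)[OF d(1) that] d(5) by simp
  have J: "jac d c x = mat 1" if "x \<in> fst d" for x
  proof (rule jacobian_eqI)
    have "((\<lambda>w. w) has_derivative (*v) (mat 1)) (at (snd d x))"
      by (simp add: matrix_vector_mul_lid[abs_def])
    then show "(local_rep id d c has_derivative (*v) (mat 1)) (at (snd d x))"
      by (rule has_derivative_transform_within_open[OF _ chD(2)[OF d(1)]])
        (use that in \<open>auto simp: local_rep_id d(5) inv\<close>)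
  qed
  have h: "h d x = h c x" if "x \<in> fst d" for x
    using transform[OF d(1) cc that] that d(3) J[OF that] by (auto simp: transpose_mat)
  have G: "coefG h d w = coefG h c w" "coefF h d w = coefF h c w" if "w \<in> snd d ` fst d" for w
    using that chD(5)[OF cc] d(3) by (auto simp: coefG_def coefF_def d(5) inv h)
  have "straight d"
    using c(1) d by (auto simp: straight_def)
  moreover have "snd d p = 0" using c(3) d(5) by simp
  moreover from this have "0 \<in> snd d ` fst d" using d(2) by force
  then have "coefF h d 0 = 0" using G nu by simp
  moreover have "coefG h d w > 0" if "w \<in> snd d ` fst d" for w
    using that d(4,5) G(1)[OF that] by (auto simp: U_def)
  ultimately show ?thesis using that d(2) by blast
qed

end

section \<open>The balancing curvature in a straightening coordinate system\<close>

context surface_metric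
begin

text \<open>Completing the square: with \<open>r, b, \<Lambda>\<close> the next three functions, the form is \<open>b\<^sup>2 (dy + r dx)\<^sup>2 + \<Lambda> dx\<^sup>2\<close>, and
  \<open>(1, - r)\<close> is null where \<open>\<Lambda> = 0\<close>.\<close>

definition slope :: "('a, 2) chart \<Rightarrow> real^2 \<Rightarrow> real" where
  "slope d w = coefF h d w / coefG h d w"

definition rootG :: "('a, 2) chart \<Rightarrow> real^2 \<Rightarrow> real" where
  "rootG d w = sqrt (coefG h d w)"

definition lamG :: "('a, 2) chart \<Rightarrow> real^2 \<Rightarrow> real" where
  "lamG d w = lam h d w / coefG h d w"

definition spacelike_straight :: "('a, 2) chart \<Rightarrow> bool" where
  "spacelike_straight d \<longleftrightarrow> straight d \<and> (\<forall>w\<in>snd d ` fst d. coefG h d w > 0)"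

lemma spacelike_straightD:
  assumes "spacelike_straight d"
  shows "straight d" "d \<in> cs" "\<And>w. w \<in> snd d ` fst d \<Longrightarrow> coefG h d w > 0"
  using assms straightD(1) by (auto simp: spacelike_straight_def)

lemma smooth_square_coefs:
  assumes "spacelike_straight d"
  shows "smooth_on (snd d ` fst d) (slope d)" "smooth_on (snd d ` fst d) (rootG d)"
    "smooth_on (snd d ` fst d) (lamG d)"
proof -
  note d = spacelike_straightD[OF assms]
  note o = chD(2)[OF d(2)] and sm = smooth_coef[OF d(2)]
  have "coefG h d w \<noteq> 0" if "w \<in> snd d ` fst d" for w using d(3)[OF that] by simp
  then show "smooth_on (snd d ` fst d) (slope d)" "smooth_on (snd d ` fst d) (lamG d)"
    unfolding slope_def[abs_def] lamG_def[abs_def] by (intro smooth_on_divide o sm; assumption)+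
  show "smooth_on (snd d ` fst d) (rootG d)"
    unfolding rootG_def[abs_def] by (intro smooth_on_sqrt o sm d(3))
qed

lemma coef_complete_square:
  assumes "spacelike_straight d" "w \<in> snd d ` fst d"
  shows "coefE h d w = (slope d w * rootG d w)\<^sup>2 + lamG d w" "coefF h d w = slope d w * (rootG d w)\<^sup>2"
    "coefG h d w = (rootG d w)\<^sup>2" "rootG d w > 0"
proof -
  have G: "coefG h d w > 0" using spacelike_straightD[OF assms(1)] assms(2) by blast
  then show 1: "coefF h d w = slope d w * (rootG d w)\<^sup>2" "coefG h d w = (rootG d w)\<^sup>2" "rootG d w > 0"
    by (auto simp: slope_def rootG_def)
  have "(slope d w * rootG d w)\<^sup>2 = (coefF h d w)\<^sup>2 / coefG h d w"
    unfolding power_mult_distrib 1(2)[symmetric] using G by (simp add: slope_def power2_eq_square)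
  then have "(slope d w * rootG d w)\<^sup>2 + lamG d w = ((coefF h d w)\<^sup>2 + lam h d w) / coefG h d w"
    by (simp add: lamG_def add_divide_distrib)
  then show "coefE h d w = (slope d w * rootG d w)\<^sup>2 + lamG d w"
    using G by (simp add: lam_def)
qed

lemma lamG_axis:
  assumes "spacelike_straight d" "w \<in> snd d ` fst d" "w $ 2 = 0"
  shows "lamG d w = 0" "pd 2 (lamG d) w = pd 2 (lam h d) w / coefG h d w"
proof -
  note d = spacelike_straightD[OF assms(1)]
  show r: "lamG d w = 0" using straight_lam[OF d(1) assms(2,3)] by (simp add: lamG_def)
  have "pd 2 (lam h d) w = pd 2 (lamG d) w * coefG h d w"
    by (rule pd_eqI[OF chD(2)[OF d(2)] assms(2), where \<psi> = "\<lambda>w. lamG d w * coefG h d w"],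
        use d(3) in \<open>force simp: lamG_def\<close>, rule has_pd_mult, rule has_pd_smooth[OF smooth_square_coefs(3)[OF assms(1)] assms(2)],
        rule has_pd_smooth[OF smooth_coef(3)[OF d(2)] assms(2)]) (simp add: r)
  then show "pd 2 (lamG d) w = pd 2 (lam h d) w / coefG h d w" using d(3)[OF assms(2)] by simp
qed

text \<open>The transition map from \<open>c\<close> to \<open>d\<close> satisfies the hypotheses of \<open>balancing_formula\<close>, and \<open>c\<close> has left the right-hand
  side: all specially adapted systems centered at \<open>q\<close> give the same value.\<close>

lemma special_formula:
  assumes d: "spacelike_straight d" "q \<in> fst d" and c: "specially_adapted A h q c"
  defines "z \<equiv> snd d q"
  shows "balancing_expr h c = balancing_numerator (slope d) (rootG d) (lamG d) z /
    ((rootG d z)\<^sup>2 * (slope d z)\<^sup>2 * \<bar>pd 2 (lamG d) z * slope d z\<bar> powr (2/3))"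
proof -
  note dD = spacelike_straightD[OF d(1)]
  have cc: "c \<in> cs" "q \<in> fst c" "snd c q = 0"
    and nf: "null_vector_field A h c (fst c) (\<lambda>_. axis 2 1)"
    and LDc: "LD A h \<inter> fst c = {x \<in> fst c. snd c x $ 2 = 0}"
    and sp: "\<And>w. w \<in> snd c ` fst c \<Longrightarrow> w $ 2 = 0 \<Longrightarrow> coefE h c w = 1 \<and> d_v (lam h c) w = 1"
    using c by (auto simp: specially_adapted_def adapted_def)
  define S where "S = snd c ` (fst c \<inter> fst d)"
  define V where "V = snd d ` fst d"
  let ?\<Phi> = "local_rep id c d"
  let ?Xu = "pd 1 (\<lambda>w. ?\<Phi> w $ 1)" and ?Xv = "pd 2 (\<lambda>w. ?\<Phi> w $ 1)"
    and ?Yu = "pd 1 (\<lambda>w. ?\<Phi> w $ 2)" and ?Yv = "pd 2 (\<lambda>w. ?\<Phi> w $ 2)"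
  have S: "open S" "0 \<in> S" using open_overlap[OF cc(1) dD(2)] cc d(2) by (auto simp: S_def image_iff intro!: bexI[of _ q])
  have V: "open V" using chD(2)[OF dD(2)] by (simp add: V_def)
  have s\<Phi>: "smooth_on S ?\<Phi>" unfolding S_def by (rule smooth_transition[OF manifold cc(1) dD(2)])
  have \<Phi>V: "?\<Phi> ` S \<subseteq> V" by (auto simp: S_def V_def local_rep_id chD(5)[OF cc(1)])
  have pt: "\<exists>x. x \<in> fst c \<and> x \<in> fst d \<and> w = snd c x \<and> ?\<Phi> w = snd d x" if "w \<in> S" for w
    using that by (auto simp: S_def local_rep_id chD(5)[OF cc(1)])
  have axc: "x \<in> LD A h \<longleftrightarrow> snd c x $ 2 = 0" if "x \<in> fst c" for x using LDc that by auto
  have axS: "?\<Phi> w $ 2 = 0" if w: "w \<in> S" "w $ 2 = 0" for w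
  proof -
    obtain x where x: "x \<in> fst c" "x \<in> fst d" "w = snd c x" "?\<Phi> w = snd d x" using pt[OF w(1)] by blast
    then have "x \<in> LD A h" using axc w(2) by blast
    then show ?thesis using straightD(2)[OF dD(1) x(2)] x(4) by simp
  qed
  have z: "?\<Phi> 0 = z" using cc by (simp add: z_def local_rep_id chD(5)[OF cc(1,2), unfolded cc(3)])
  have coef: "coefE h c w = coefE h d (?\<Phi> w) * (?Xu w)\<^sup>2
        + 2 * coefF h d (?\<Phi> w) * ?Xu w * ?Yu w
        + coefG h d (?\<Phi> w) * (?Yu w)\<^sup>2"
      "coefF h c w = coefE h d (?\<Phi> w) * (?Xu w * ?Xv w)
        + coefF h d (?\<Phi> w) * (?Xu w * ?Yv w
            + ?Yu w * ?Xv w)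
        + coefG h d (?\<Phi> w) * (?Yu w * ?Yv w)"
      "coefG h c w = coefE h d (?\<Phi> w) * (?Xv w)\<^sup>2
        + 2 * coefF h d (?\<Phi> w) * ?Xv w * ?Yv w
        + coefG h d (?\<Phi> w) * (?Yv w)\<^sup>2" if w: "w \<in> S" for w
  proof -
    obtain x where x: "x \<in> fst c" "x \<in> fst d" "w = snd c x" "?\<Phi> w = snd d x" using pt[OF w] by blast
    note t = transform[OF cc(1) dD(2) x(1,2)]
    have J: "jac c d x $ i $ j = pd j (\<lambda>w. ?\<Phi> w $ i) w" for i j
      unfolding x(3)[symmetric] by (rule jacobian_component[OF s\<Phi> w])
    have "h c x $ i $ j = (\<Sum>k\<in>UNIV. \<Sum>l\<in>UNIV. jac c d x $ l $ i * h d x $ l $ k * jac c d x $ k $ j)" for i j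
      unfolding t by (simp add: matrix_matrix_mult_def transpose_def sum_distrib_right)
    note hc = this[unfolded sum_2 J component_coef[OF dD(2) x(2)] x(4)[symmetric]]
    show "coefE h c w = coefE h d (?\<Phi> w) * (?Xu w)\<^sup>2
        + 2 * coefF h d (?\<Phi> w) * ?Xu w * ?Yu w
        + coefG h d (?\<Phi> w) * (?Yu w)\<^sup>2"
      using hc[of 1 1] component_coef(1)[OF cc(1) x(1)] x(3) by (simp add: power2_eq_square algebra_simps)
    show "coefF h c w = coefE h d (?\<Phi> w) * (?Xu w * ?Xv w)
        + coefF h d (?\<Phi> w) * (?Xu w * ?Yv w
            + ?Yu w * ?Xv w)
        + coefG h d (?\<Phi> w) * (?Yu w * ?Yv w)"
      using hc[of 1 2] component_coef(2)[OF cc(1) x(1)] x(3) by (simp add: power2_eq_square algebra_simps)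
    show "coefG h c w = coefE h d (?\<Phi> w) * (?Xv w)\<^sup>2
        + 2 * coefF h d (?\<Phi> w) * ?Xv w * ?Yv w
        + coefG h d (?\<Phi> w) * (?Yv w)\<^sup>2"
      using hc[of 2 2] component_coef(4)[OF cc(1) x(1)] x(3) by (simp add: power2_eq_square algebra_simps)
  qed
  have inV: "?\<Phi> w \<in> snd d ` fst d" if "w \<in> S" for w using \<Phi>V that by (auto simp: V_def)
  have null: "coefG h c w = 0" if w: "w \<in> S" "w $ 2 = 0" for w
  proof -
    obtain x where x: "x \<in> fst c" "w = snd c x" using pt[OF w(1)] by blast
    then have "null_vector (h c x) (axis 2 1)"
      using nf axc w by (auto simp: null_vector_field_def)
    then show ?thesis by (simp add: null_vector_coef[OF cc(1) x(1)] x(2) axis_def)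
  qed
  have Sc: "w \<in> snd c ` fst c" if "w \<in> S" for w using that by (auto simp: S_def)
  have "- (1/2) * pd 2 (pd 2 (coefE h c)) 0 + pd 2 (pd 1 (coefF h c)) 0 + pd 2 (coefE h c) 0 / 10 *
      (pd 2 (pd 2 (coefG h c)) 0 - 2 * (pd 2 (coefF h c) 0)\<^sup>2)
    = balancing_numerator (slope d) (rootG d) (lamG d) (?\<Phi> 0) /
    ((rootG d (?\<Phi> 0))\<^sup>2 * (slope d (?\<Phi> 0))\<^sup>2 * \<bar>pd 2 (lamG d) (?\<Phi> 0) * slope d (?\<Phi> 0)\<bar> powr (2/3))"
  proof (rule balancing_formula[OF S V \<Phi>V s\<Phi>])
    show "smooth_on V (slope d)" "smooth_on V (rootG d)" "smooth_on V (lamG d)"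
      unfolding V_def by (rule smooth_square_coefs[OF d(1)])+
    show "rootG d w \<noteq> 0" if "w \<in> V" for w using coef_complete_square(4)[OF d(1)] that by (force simp: V_def)
    show "lamG d w = 0" if "w \<in> V" "w $ 2 = 0" for w using lamG_axis(1)[OF d(1)] that by (simp add: V_def)
    show "coefE h c w = 1" if "w \<in> S" "w $ 2 = 0" for w using sp Sc that by blast
    show "coefG h c w = 0" if "w \<in> S" "w $ 2 = 0" for w using null that by blast
    show "pd 2 (\<lambda>w. coefE h c w * coefG h c w - (coefF h c w)\<^sup>2) w = 1" if "w \<in> S" "w $ 2 = 0" for w
      using sp[OF Sc[OF that(1)] that(2)] unfolding lam_def[abs_def] d_v_eq_pd by blast
  qed (use axS in \<open>simp_all add: coef coef_complete_square(1,2,3)[OF d(1) inV] power2_eq_square algebra_simps\<close>)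
  then show ?thesis unfolding balancing_expr_def d_u_eq_pd d_v_eq_pd z .
qed

text \<open>With \<open>r, b, \<Lambda>\<close> evaluated at \<open>(x, 0)\<close> and \<open>a = r b\<close>, the new coordinates are \<open>u = S(x) + y b\<close> and \<open>v = y n\<close>, where \<open>S' = a\<close> and
  \<open>n\<^sup>3 = \<lambda>\<^sub>y / a\<^sup>2\<close>. On the axis \<open>du = b (dy + r dx)\<close>, so the form is \<open>du\<^sup>2\<close> there; the choice of \<open>n\<close> gives
  \<open>\<lambda>\<^sub>v = 1\<close>, because the discriminant scales with the square of the Jacobian determinant \<open>a n\<close>.\<close>

lemma specially_adapted_exists:
  assumes gc: "spacelike_straight d" and q: "q \<in> fst d" "snd d q $ 2 = 0"
    and F0: "coefF h d (snd d q) \<noteq> 0" and l0: "pd 2 (lam h d) (snd d q) \<noteq> 0"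
  obtains c where "specially_adapted A h q c"
proof -
  note dD = spacelike_straightD[OF gc]
  note V = chD(2)[OF dD(2)]
  define w0 where "w0 = snd d q"
  let ?V = "snd d ` fst d" and ?l = "lam h d" and ?t0 = "w0 $ 1"
  have w0V: "w0 \<in> ?V" using q by (simp add: w0_def)
  note sl = smooth_coef[OF dD(2)]
  have cont: "continuous_on ?V (\<lambda>w. coefF h d w * pd 2 ?l w)"
    by (intro smooth_on_continuous smooth_on_mult V sl(2) smooth_on_pd sl(4))
  have "open (?V \<inter> (\<lambda>w. coefF h d w * pd 2 ?l w) -` (- {0}))"
    by (rule continuous_open_preimage[OF cont V]) (simp add: open_Compl)
  then obtain \<rho> where \<rho>: "\<rho> > 0" and "ball w0 \<rho> \<subseteq> ?V \<inter> (\<lambda>w. coefF h d w * pd 2 ?l w) -` (- {0})"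
    using w0V F0 l0 open_contains_ball unfolding w0_def by (metis (no_types, lifting) Compl_iff IntI mult_eq_0_iff singletonD vimageI)
  then have B: "w \<in> ?V" "coefF h d w \<noteq> 0" "pd 2 ?l w \<noteq> 0" if "w \<in> ball w0 \<rho>" for w
    using that by auto
  define U where "U = ball w0 (\<rho>/2)"
  have U: "open U" "w0 \<in> U" "U \<subseteq> ball w0 \<rho>" using \<rho> by (auto simp: U_def)
  \<comment> \<open>The projection to the axis.\<close>
  define pr :: "real^2 \<Rightarrow> real^2" where "pr w = vector [w $ 1, 0]" for w
  have pr: "pr w \<in> ball w0 \<rho>" if "w \<in> U" for w
  proof -
    have "norm (pr w - w0) \<le> norm (w - w0)"
    proof (rule norm_le_componentwise_cart)
      fix i :: 2 show "norm ((pr w - w0) $ i) \<le> norm ((w - w0) $ i)"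
        using exhaust_2[of i] q by (auto simp: pr_def w0_def)
    qed
    then show ?thesis using that \<rho> by (auto simp: U_def dist_norm norm_minus_commute)
  qed
  have prw: "pr w = w" if "w $ 2 = 0" for w using that by (simp add: pr_def vec_eq_iff forall_2)
  have spr: "smooth_on U pr"
  proof (rule smooth_on_vecI[OF U(1)])
    fix i :: 2 show "smooth_on U (\<lambda>w. pr w $ i)"
      using exhaust_2[of i] smooth_on_component[OF U(1) smooth_on_id[OF U(1)], of 1]
      by (auto simp: pr_def smooth_on_const)
  qed
  have comp: "smooth_on U (\<lambda>w. \<phi> (pr w))" if "smooth_on ?V \<phi>" for \<phi> :: "real^2 \<Rightarrow> real"
    by (rule smooth_on_compose[OF U(1) V _ that spr]) (use pr B in auto)
  define b where "b w = rootG d (pr w)" for w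
  define a where "a w = slope d (pr w) * b w" for w
  define k where "k w = pd 2 ?l (pr w) / (a w)\<^sup>2" for w
  \<comment> \<open>The cube root of \<open>k\<close>, for both signs of \<open>k\<close>.\<close>
  define n where "n w = k w * ((k w)\<^sup>2) powr (-1/3)" for w
  have b0: "b w > 0" if "w \<in> U" for w using coef_complete_square(4)[OF gc] B pr that by (auto simp: b_def)
  have a0: "a w \<noteq> 0" if "w \<in> U" for w
    using b0[OF that] B[OF pr[OF that]] dD(3) by (force simp: a_def slope_def)
  have k0: "k w \<noteq> 0" if "w \<in> U" for w using a0[OF that] B[OF pr[OF that]] by (simp add: k_def)
  have n0: "n w \<noteq> 0" if "w \<in> U" for w using k0[OF that] by (simp add: n_def)
  have n3: "(n w) ^ 3 = k w" if "w \<in> U" for w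
  proof -
    have "(((k w)\<^sup>2) powr (-1/3)) ^ 3 = ((k w)\<^sup>2) powr (-1)"
      by (simp add: powr_powr flip: powr_numeral)
    then show ?thesis
      using k0[OF that] by (simp add: n_def power_mult_distrib powr_minus field_simps power2_eq_square power3_eq_cube)
  qed
  have sb: "smooth_on U b" unfolding b_def[abs_def] by (intro comp smooth_square_coefs[OF gc])
  have sa: "smooth_on U a" unfolding a_def[abs_def] by (intro smooth_on_mult U sb comp smooth_square_coefs[OF gc])
  have sk: "smooth_on U k" unfolding k_def[abs_def]
    by (intro smooth_on_divide smooth_on_power U sa comp smooth_on_pd sl(4)) (use a0 in auto)
  have sn: "smooth_on U n" unfolding n_def[abs_def]
    by (intro smooth_on_mult smooth_on_powr smooth_on_power U sk) (use k0 in auto)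
  define I where "I = {?t0 - \<rho>/2..?t0 + \<rho>/2}"
  have inI: "w $ 1 \<in> interior I" if "w \<in> U" for w
  proof -
    have "\<bar>(w - w0) $ 1\<bar> < \<rho>/2"
      using that component_le_norm_cart[of "w - w0" 1] by (simp add: U_def dist_norm norm_minus_commute)
    then have "?t0 - \<rho>/2 < w $ 1" "w $ 1 < ?t0 + \<rho>/2" unfolding vector_minus_component by linarith+
    then show ?thesis by (simp add: I_def)
  qed
  have v2: "continuous_on UNIV (\<lambda>x. vector [x, 0] :: real^2)"
  proof -
    have e: "(\<lambda>x. vector [x, 0] :: real^2) = (\<lambda>x. x *\<^sub>R axis 1 1)"
      by (simp add: fun_eq_iff vec_eq_iff forall_2 axis_def)
    show ?thesis unfolding e by (intro continuous_intros)
  qed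
  have vb: "vector [x, 0] \<in> ball w0 \<rho>" if "x \<in> I" for x
  proof -
    have "norm (vector [x, 0] - w0) \<le> norm ((x - ?t0) *\<^sub>R (axis 1 1 :: real^2))"
    proof (rule norm_le_componentwise_cart)
      fix i :: 2
      show "norm ((vector [x, 0] - w0) $ i) \<le> norm (((x - ?t0) *\<^sub>R (axis 1 1 :: real^2)) $ i)"
        using exhaust_2[of i] q by (auto simp: w0_def axis_def)
    qed
    also have "\<dots> = \<bar>x - ?t0\<bar>" by simp
    also have "\<dots> \<le> \<rho>/2" using that unfolding I_def atLeastAtMost_iff by linarith
    finally show ?thesis using \<rho> by (simp add: dist_norm norm_minus_commute)
  qed
  have "smooth_on ?V (\<lambda>w. slope d w * rootG d w)" by (intro smooth_on_mult V smooth_square_coefs[OF gc])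
  from smooth_on_continuous[OF this]
  have "continuous_on I (\<lambda>x. slope d (vector [x, 0]) * rootG d (vector [x, 0]))"
    by (rule continuous_on_compose2[OF _ continuous_on_subset[OF v2]]) (use vb B in auto)
  then obtain P where P: "\<And>x. x \<in> I \<Longrightarrow>
      (P has_vector_derivative (slope d (vector [x, 0]) * rootG d (vector [x, 0]))) (at x within I)"
    unfolding I_def by (rule antiderivative_continuous) blast
  define S where "S x = P x - P ?t0" for x
  have DS: "((\<lambda>w. S (w $ 1)) has_derivative (\<lambda>v. v $ 1 * a w)) (at w)" if w: "w \<in> U" for w
  proof -
    have "w $ 1 \<in> I" by (rule subsetD[OF interior_subset inI[OF w]])
    note P[OF this]
    moreover have "slope d (vector [w $ 1, 0]) * rootG d (vector [w $ 1, 0]) = a w"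
      by (simp only: a_def b_def pr_def)
    ultimately have "(P has_vector_derivative a w) (at (w $ 1))"
      by (simp only: at_within_interior[OF inI[OF w]])
    from has_vector_derivative_diff[OF this has_vector_derivative_const[of "P ?t0"]]
    have "(S has_vector_derivative a w) (at (w $ 1))" by (simp add: S_def[abs_def])
    then have "(S has_derivative (\<lambda>x. x *\<^sub>R a w)) (at (w $ 1))"
      by (simp add: has_vector_derivative_def)
    from has_derivative_compose[OF bounded_linear_imp_has_derivative[OF bounded_linear_vec_nth] this]
    show ?thesis by simp
  qed
  have sS: "smooth_on U (\<lambda>w. S (w $ 1))"
    by (rule smooth_onI[OF U(1) DS]) (auto intro!: smooth_on_mult smooth_on_const U sa)
  define \<Psi> :: "real^2 \<Rightarrow> real^2" where "\<Psi> w = vector [S (w $ 1) + w $ 2 * b w, w $ 2 * n w]" for w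
  have s\<Psi>: "smooth_on U \<Psi>"
  proof (rule smooth_on_vecI[OF U(1)])
    have s2: "smooth_on U (\<lambda>w. w $ 2)" by (intro smooth_on_component smooth_on_id U)
    have "smooth_on U (\<lambda>w. S (w $ 1) + w $ 2 * b w)" "smooth_on U (\<lambda>w. w $ 2 * n w)"
      by (intro smooth_on_add smooth_on_mult s2 U sS sb sn)+
    then show "smooth_on U (\<lambda>w. \<Psi> w $ i)" for i
      using exhaust_2[of i] by (auto simp: \<Psi>_def)
  qed
  have p\<Psi>: "pd 1 (\<lambda>w. \<Psi> w $ 1) w = a w" "pd 2 (\<lambda>w. \<Psi> w $ 1) w = b w"
    "pd 1 (\<lambda>w. \<Psi> w $ 2) w = 0" "pd 2 (\<lambda>w. \<Psi> w $ 2) w = n w" if w: "w \<in> U" "w $ 2 = 0" for w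
  proof -
    have "has_pd i (\<lambda>w. S (w $ 1)) w (if i = 1 then a w else 0)" for i
      by (rule has_pdI[OF DS[OF w(1)]]) (auto simp: axis_def)
    then have 1: "has_pd i (\<lambda>w. \<Psi> w $ 1) w ((if i = 1 then a w else 0) + (w $ 2 * pd i b w + (if i = 2 then 1 else 0) * b w))" for i
      unfolding \<Psi>_def vector_2
      by (intro has_pd_add has_pd_mult has_pd_component has_pd_smooth[OF sb w(1)])
    have 2: "has_pd i (\<lambda>w. \<Psi> w $ 2) w (w $ 2 * pd i n w + (if i = 2 then 1 else 0) * n w)" for i
      unfolding \<Psi>_def vector_2 by (intro has_pd_mult has_pd_component has_pd_smooth[OF sn w(1)])
    show "pd 1 (\<lambda>w. \<Psi> w $ 1) w = a w" "pd 2 (\<lambda>w. \<Psi> w $ 1) w = b w"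
      "pd 1 (\<lambda>w. \<Psi> w $ 2) w = 0" "pd 2 (\<lambda>w. \<Psi> w $ 2) w = n w"
      using has_pd_imp_pd[OF 1] has_pd_imp_pd[OF 2] w(2) by auto
  qed
  have J\<Psi>: "jacobian \<Psi> (at w) $ i $ j = pd j (\<lambda>w. \<Psi> w $ i) w" if "w \<in> U" for w i j
    by (rule jacobian_component[OF s\<Psi> that])
  have detJ: "det (jacobian \<Psi> (at w)) = a w * n w" if w: "w \<in> U" "w $ 2 = 0" for w
    unfolding det_2 J\<Psi>[OF w(1)] p\<Psi>[OF w] by simp
  have det0: "det (jacobian \<Psi> (at (snd d q))) \<noteq> 0"
    using detJ[OF U(2)] a0[OF U(2)] n0[OF U(2)] q(2) by (simp add: w0_def)
  have UV: "U \<subseteq> ?V" using U(3) B by auto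
  obtain c where c: "c \<in> cs" "q \<in> fst c" "fst c \<subseteq> fst d" "snd d ` fst c \<subseteq> U" "snd c = (\<lambda>y. \<Psi> (snd d y))"
    by (rule coord_system_compose[OF manifold dD(2) q(1) U(1) UV _ s\<Psi> det0]) (use U in \<open>auto simp: w0_def\<close>)
  have inU: "snd d x \<in> U" if "x \<in> fst c" for x using c(4) that by auto
  have c2: "snd c x $ 2 = 0 \<longleftrightarrow> snd d x $ 2 = 0" if "x \<in> fst c" for x
    using n0[OF inU[OF that]] by (simp add: c(5) \<Psi>_def)
  have strc: "straight c"
    using dD(1) c c2 by (auto simp: straight_def)
  define T where "T = snd d ` (fst d \<inter> fst c)"
  have T: "open T" "T \<subseteq> U" using open_overlap[OF dD(2) c(1)] inU by (auto simp: T_def)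
  have lr: "local_rep id d c w = \<Psi> w" if "w \<in> T" for w
    using that by (auto simp: T_def local_rep_id chD(5)[OF dD(2)] c(5))
  have J: "jac d c x = jacobian \<Psi> (at (snd d x))" if x: "x \<in> fst c" for x
  proof (rule jacobian_eqI)
    have "snd d x \<in> T" using x c(3) by (auto simp: T_def)
    then show "(local_rep id d c has_derivative (*v) (jacobian \<Psi> (at (snd d x)))) (at (snd d x))"
      using has_derivative_transform_within_open[OF has_derivative_jacobian[OF s\<Psi> inU[OF x]] T(1)] lr by metis
  qed
  have hc: "coefE h c (snd c x) = 1" "coefF h c (snd c x) = 0" "coefG h c (snd c x) = 0"
    "pd 2 (lam h c) (snd c x) = 1" if x: "x \<in> fst c" "snd d x $ 2 = 0" for x
  proof -
    let ?w = "snd d x"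
    have xd: "x \<in> fst d" and wU: "?w \<in> U" and wV: "?w \<in> ?V" and wT: "?w \<in> T"
      using x c(3) inU by (auto simp: T_def)
    note pw = prw[OF x(2)]
    note t = transform[OF dD(2) c(1) xd x(1)]
    have "h d x $ i $ j = (\<Sum>k\<in>UNIV. \<Sum>l\<in>UNIV. jac d c x $ l $ i * h c x $ l $ k * jac d c x $ k $ j)" for i j
      unfolding t by (simp add: matrix_matrix_mult_def transpose_def sum_distrib_right)
    note hd = this[unfolded sum_2 J[OF x(1)] J\<Psi>[OF wU] component_coef[OF c(1) x(1)]]
    have d1: "coefE h d ?w = (a ?w)\<^sup>2" "coefF h d ?w = a ?w * b ?w" "coefG h d ?w = (b ?w)\<^sup>2"
      using coef_complete_square[OF gc wV] lamG_axis(1)[OF gc wV x(2)] by (simp_all add: a_def b_def pw power2_eq_square)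
    have e: "(a ?w)\<^sup>2 = (a ?w)\<^sup>2 * coefE h c (snd c x)"
      using hd[of 1 1] unfolding component_coef[OF dD(2) xd] d1 p\<Psi>[OF wU x(2)] by (simp add: power2_eq_square)
    show E: "coefE h c (snd c x) = 1" using e a0[OF wU] by simp
    have f: "a ?w * b ?w = a ?w * (b ?w + n ?w * coefF h c (snd c x))"
      using hd[of 1 2] unfolding component_coef[OF dD(2) xd] d1 p\<Psi>[OF wU x(2)] E by (simp add: algebra_simps)
    show F: "coefF h c (snd c x) = 0" using f a0[OF wU] n0[OF wU] by simp
    have g: "(b ?w)\<^sup>2 = (b ?w)\<^sup>2 + (n ?w)\<^sup>2 * coefG h c (snd c x)"
      using hd[of 2 2] unfolding component_coef[OF dD(2) xd] d1 p\<Psi>[OF wU x(2)] E F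
      by (simp add: power2_eq_square algebra_simps)
    show "coefG h c (snd c x) = 0" using g n0[OF wU] by simp
    have lc: "lam h c (\<Psi> ?w) = 0" "pd 1 (lam h c) (\<Psi> ?w) = 0"
      using straight_lam[OF strc, of "snd c x"] x c2 by (auto simp: c(5))
    have eq: "?l w = (det (jacobian \<Psi> (at w)))\<^sup>2 * lam h c (\<Psi> w)" if w: "w \<in> T" for w
    proof -
      obtain y where y: "y \<in> fst d" "y \<in> fst c" "w = snd d y" using w by (auto simp: T_def)
      show ?thesis using lam_transform[OF dD(2) c(1) y(1,2)] by (simp add: y(3) J[OF y(2)] c(5))
    qed
    have "smooth_on T (\<lambda>w. jacobian \<Psi> (at w) $ i $ j)" for i j
      by (intro smooth_on_component smooth_on_jacobian T smooth_on_subset[OF s\<Psi>])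
    then have sD: "smooth_on T (\<lambda>w. (det (jacobian \<Psi> (at w)))\<^sup>2)"
      unfolding det_2 by (intro smooth_on_diff smooth_on_mult smooth_on_power T)
    have "pd 2 ?l ?w = (det (jacobian \<Psi> (at ?w)))\<^sup>2 * (pd 2 (lam h c) (\<Psi> ?w) * n ?w)"
      by (rule pd_eqI[OF T(1) wT], erule eq, rule has_pd_mult, rule has_pd_smooth[OF sD wT],
          rule has_pd_chain[OF smooth_coef(4)[OF c(1)] _ s\<Psi> U(1) wU])
        (use x(1) in \<open>auto simp: lc c(5) p\<Psi>[OF wU x(2)]\<close>)
    then have "pd 2 ?l ?w = (a ?w)\<^sup>2 * n ?w ^ 3 * pd 2 (lam h c) (\<Psi> ?w)"
      unfolding detJ[OF wU x(2)] by (simp add: power_mult_distrib power2_eq_square power3_eq_cube)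
    also have "(a ?w)\<^sup>2 * n ?w ^ 3 = pd 2 ?l ?w"
      unfolding n3[OF wU] using a0[OF wU] by (simp add: k_def pw)
    finally show "pd 2 (lam h c) (snd c x) = 1"
      using B(3)[of ?w] wU U(3) by (auto simp: c(5))
  qed
  have "null_vector_field A h c (fst c) (\<lambda>_. axis 2 1)"
    unfolding null_vector_field_def
  proof (intro conjI ballI)
    show "smooth_on (snd c ` fst c) ((\<lambda>_. axis 2 1) \<circ> chart_inv c)" by (simp add: o_def smooth_on_const)
    show "null_vector (h c x) (axis 2 1)" if "x \<in> LD A h \<inter> fst c" for x
    proof -
      have x: "x \<in> fst c" "snd d x $ 2 = 0" using that straightD(2)[OF strc] c2 by auto
      show ?thesis using hc[OF x] by (simp add: null_vector_coef[OF c(1) x(1)] axis_eq_0_iff) (simp add: axis_def)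
    qed
  qed (use c chD(1)[OF c(1)] in auto)
  moreover have "snd c q = 0"
    using q(2) by (simp add: c(5) \<Psi>_def S_def w0_def vec_eq_iff forall_2)
  moreover have "coefE h c w = 1 \<and> d_v (lam h c) w = 1" if w: "w \<in> snd c ` fst c" "w $ 2 = 0" for w
    using w hc c2 by (auto simp: d_v_eq_pd)
  ultimately have "specially_adapted A h q c"
    unfolding specially_adapted_def adapted_def using c strc by (auto simp: straight_def)
  then show ?thesis by (rule that)
qed

lemma balancing_curvature_formula:
  assumes gc: "spacelike_straight d" and q: "q \<in> fst d" "first_kind A h q"
  defines "z \<equiv> snd d q"
  shows "balancing_curvature A h q = balancing_numerator (slope d) (rootG d) (lamG d) z /
    ((rootG d z)\<^sup>2 * (slope d z)\<^sup>2 * \<bar>pd 2 (lamG d) z * slope d z\<bar> powr (2/3))"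
proof -
  note dD = spacelike_straightD[OF gc]
  have nd: "nondegenerate_lightlike A h q" using q by (simp add: first_kind_def)
  have "coefF h d (snd d q) \<noteq> 0"
    by (rule first_kind_coefF[OF q(2) dD(1) q(1)]) (use dD(3) q(1) in force)
  from specially_adapted_exists[OF gc q(1) nondegenerate_straight(1)[OF dD(1) q(1) nd] this
      nondegenerate_straight(2)[OF dD(1) q(1) nd]]
  obtain c where c: "specially_adapted A h q c" by blast
  show ?thesis unfolding balancing_curvature_def z_def
  proof (rule the_equality)
    show "\<exists>c. specially_adapted A h q c \<and> balancing_numerator (slope d) (rootG d) (lamG d) (snd d q) /
        ((rootG d (snd d q))\<^sup>2 * (slope d (snd d q))\<^sup>2 *
          \<bar>pd 2 (lamG d) (snd d q) * slope d (snd d q)\<bar> powr (2/3)) = balancing_expr h c"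
      using c special_formula[OF gc q(1) c] by (intro exI[of _ c] conjI) simp_all
  qed (use special_formula[OF gc q(1)] in blast)
qed

text \<open>The axis as characteristic curve and \<open>(1, - r)\<close> as null vector field give \<open>\<delta> = - r\<close>.\<close>

lemma L3_point_of_slope:
  assumes gc: "spacelike_straight d" and p: "p \<in> fst d" "snd d p = 0" and nd: "nondegenerate_lightlike A h p"
    and s0: "slope d 0 = 0" and s1: "pd 1 (slope d) 0 \<noteq> 0"
  shows "L3_point A h p"
proof -
  note dD = spacelike_straightD[OF gc]
  note V = chD(2)[OF dD(2)]
  let ?V = "snd d ` fst d"
  define \<gamma> where "\<gamma> t = chart_inv d (t *\<^sub>R axis 1 1)" for t
  define \<eta> :: "'a \<Rightarrow> real^2" where "\<eta> x = vector [1, - slope d (snd d x)]" for x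
  have "0 \<in> ?V" using p by force
  then obtain e where e: "e > 0" "ball 0 e \<subseteq> ?V" using V open_contains_ball by blast
  let ?I = "{-e<..<e}"
  have I: "t *\<^sub>R axis 1 1 \<in> ?V" if "t \<in> ?I" for t
    using that e(2) by (auto simp: subset_iff dist_norm abs_less_iff)
  have gd: "\<gamma> t \<in> fst d" "snd d (\<gamma> t) = t *\<^sub>R axis 1 1" if "t \<in> ?I" for t
    using chD(6,7)[OF dD(2) I[OF that]] by (auto simp: \<gamma>_def)
  have g0: "\<gamma> 0 = p" using chD(5)[OF dD(2) p(1)] p(2) by (simp add: \<gamma>_def)
  have sl: "smooth_on ?I (\<lambda>t. t *\<^sub>R axis 1 (1::real) :: real^2)"
    by (intro smooth_on_scaleR smooth_on_id smooth_on_const) auto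
  have vel: "velocity d \<gamma> t = axis 1 1" if "t \<in> ?I" for t
  proof -
    have "((\<lambda>t. t *\<^sub>R axis 1 (1::real) :: real^2) has_vector_derivative axis 1 1) (at t)"
      by (auto intro!: derivative_eq_intros)
    then have "((snd d \<circ> \<gamma>) has_vector_derivative axis 1 1) (at t)"
      by (rule has_vector_derivative_transform_within_open[of _ _ _ ?I]) (use that gd in auto)
    then show ?thesis unfolding velocity_def by (rule vector_derivative_at)
  qed
  have cc: "characteristic_curve A h d p \<gamma>"
    unfolding characteristic_curve_def
  proof (intro conjI exI[of _ e])
    show "\<gamma> ` ?I \<subseteq> fst d" using gd by auto
    show "smooth_on ?I (snd d \<circ> \<gamma>)"
      by (rule smooth_on_cong[OF _ _ sl]) (auto simp: gd)
    show "\<forall>t\<in>?I. velocity d \<gamma> t \<noteq> 0" using vel by (auto simp: axis_eq_0_iff)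
    have oW: "open (fst d \<inter> snd d -` ball 0 e)"
      by (rule continuous_open_preimage[OF chD(3,1)[OF dD(2)] open_ball])
    have W: "LD A h \<inter> (fst d \<inter> snd d -` ball 0 e) = \<gamma> ` ?I"
    proof (intro equalityI subsetI)
      fix x assume x: "x \<in> LD A h \<inter> (fst d \<inter> snd d -` ball 0 e)"
      then have "snd d x $ 2 = 0" using straightD(2)[OF dD(1), of x] by blast
      then have "snd d x = (snd d x $ 1) *\<^sub>R axis 1 1"
        by (simp add: vec_eq_iff forall_2 axis_def)
      moreover have "\<bar>snd d x $ 1\<bar> < e"
        using x component_le_norm_cart[of "snd d x" 1] by simp
      ultimately show "x \<in> \<gamma> ` ?I"
        using x chD(5)[OF dD(2)] by (intro image_eqI[of _ _ "snd d x $ 1"]) (auto simp: \<gamma>_def)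
    next
      fix x assume "x \<in> \<gamma> ` ?I"
      then obtain t where t: "t \<in> ?I" "x = \<gamma> t" by auto
      then have "x \<in> LD A h" using straightD(2)[OF dD(1)] gd[OF t(1)] by (simp add: axis_def)
      then show "x \<in> LD A h \<inter> (fst d \<inter> snd d -` ball 0 e)" using t gd[OF t(1)] by auto
    qed
    show "\<exists>W. open W \<and> p \<in> W \<and> LD A h \<inter> W = \<gamma> ` ?I"
      using oW W p e by (intro exI[of _ "fst d \<inter> snd d -` ball 0 e"]) auto
  qed (use dD g0 e in auto)
  have sv: "smooth_on ?V (\<lambda>w. vector [1, - slope d w] :: real^2)"
  proof (rule smooth_on_vecI[OF V])
    fix i :: 2 show "smooth_on ?V (\<lambda>w. vector [1, - slope d w] $ i)"
      using exhaust_2[of i] by (auto intro!: smooth_on_const smooth_on_minus V smooth_square_coefs[OF gc])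
  qed
  have nf: "null_vector_field A h d (fst d) \<eta>"
    unfolding null_vector_field_def
  proof (intro conjI ballI)
    show "smooth_on ?V (\<eta> \<circ> chart_inv d)"
      by (rule smooth_on_cong[OF V _ sv]) (auto simp: \<eta>_def chD(5)[OF dD(2)])
    fix x assume x: "x \<in> LD A h \<inter> fst d"
    then have w: "snd d x \<in> ?V" "snd d x $ 2 = 0" using straightD(2)[OF dD(1)] by auto
    have "vector [1, - slope d (snd d x)] \<noteq> (0 :: real^2)" by (simp add: vec_eq_iff forall_2)
    then show "null_vector (h d x) (\<eta> x)"
      using x lamG_axis(1)[OF gc w] by (simp add: null_vector_coef[OF dD(2)] \<eta>_def coef_complete_square(1-3)[OF gc w(1)] power2_eq_square)
  qed (use dD chD(1)[OF dD(2)] in auto)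
  have del: "delta d \<gamma> \<eta> t = - slope d (0 + t *\<^sub>R axis 1 1)" if "t \<in> ?I" for t
    by (simp add: delta_def vel[OF that] \<eta>_def gd[OF that] det_2 axis_def)
  have I0: "0 \<in> ?I" using e by simp
  have "((\<lambda>t. - slope d (0 + t *\<^sub>R axis 1 1)) has_real_derivative - pd 1 (slope d) (0 + 0 *\<^sub>R axis 1 1)) (at 0)"
    by (intro DERIV_minus has_real_derivative_line[OF smooth_square_coefs(1)[OF gc]]) (use I[OF I0] in simp)
  then have D: "((\<lambda>t. - slope d (0 + t *\<^sub>R axis 1 1)) has_real_derivative - pd 1 (slope d) 0) (at 0)"
    by simp
  have "(delta d \<gamma> \<eta> has_real_derivative - pd 1 (slope d) 0) (at 0)"
    by (rule has_field_derivative_transform_within_open[OF D, of ?I]) (use I0 del in auto)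
  then have "deriv (delta d \<gamma> \<eta>) 0 \<noteq> 0" using s1 DERIV_imp_deriv by fastforce
  moreover have "delta d \<gamma> \<eta> 0 = 0" using del[OF I0] s0 by simp
  moreover have "char_data A h p d \<gamma> \<eta>" unfolding char_data_def using cc nf p by blast
  ultimately show ?thesis unfolding L3_point_def using nd by blast
qed

end

section \<open>The limit at a point of the second kind\<close>

lemma taylor_order_3:
  fixes N :: "real \<Rightarrow> real"
  assumes "open I" "0 \<in> I" "smooth_on I N"
  obtains n1 n2 C e where "e > 0"
    "\<And>t. \<bar>t\<bar> < e \<Longrightarrow> \<exists>R. \<bar>R\<bar> \<le> C \<and> N t = N 0 + t * n1 + t\<^sup>2 * n2 + t ^ 3 * R"
proof -
  define D where "D m = ((\<lambda>\<phi> t. frechet_derivative \<phi> (at t) (1::real)) ^^ m) N" for m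
  have D0: "D 0 = N" and DS: "D (Suc m) = (\<lambda>t. frechet_derivative (D m) (at t) 1)" for m
    by (simp_all add: D_def)
  have sD: "smooth_on I (D m)" for m
    by (induction m) (use assms(3) in \<open>auto simp: D0 DS intro: smooth_on_deriv\<close>)
  have DD: "DERIV (D m) t :> D (Suc m) t" if "t \<in> I" for m t
  proof -
    have "(D m has_derivative frechet_derivative (D m) (at t)) (at t)"
      by (rule smooth_on_has_derivative[OF sD that])
    moreover from this have "frechet_derivative (D m) (at t) v = v * D (Suc m) t" for v
      using linear_cmul[OF has_derivative_linear, of "D m" _ "at t" v 1] by (simp add: DS)
    then have "frechet_derivative (D m) (at t) = (*) (D (Suc m) t)" by (simp add: fun_eq_iff)
    ultimately show ?thesis by (simp add: has_field_derivative_def)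
  qed
  have "isCont (D 3) 0"
    using smooth_on_continuous[OF sD] assms by (simp add: continuous_on_eq_continuous_at)
  then obtain d where d: "d > 0" "\<And>t. \<bar>t\<bar> < d \<Longrightarrow> \<bar>D 3 t - D 3 0\<bar> < 1"
    unfolding continuous_at_eps_delta by (metis diff_zero dist_real_def zero_less_one)
  obtain d' where d': "d' > 0" "ball 0 d' \<subseteq> I" using assms open_contains_ball by blast
  have "\<exists>R. \<bar>R\<bar> \<le> \<bar>D 3 0\<bar> + 1 \<and> N t = N 0 + t * D 1 0 + t\<^sup>2 * (D 2 0 / 2) + t ^ 3 * R"
    if t: "\<bar>t\<bar> < min d d'" for t
  proof -
    have "\<forall>m x. m < 3 \<and> \<bar>x\<bar> \<le> \<bar>t\<bar> \<longrightarrow> DERIV (D m) x :> D (Suc m) x"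
      using DD d'(2) t by (auto simp: subset_iff)
    from Maclaurin_bi_le[OF D0 this]
    obtain x where x: "\<bar>x\<bar> \<le> \<bar>t\<bar>" "N t = (\<Sum>m<3. D m 0 / fact m * t ^ m) + D 3 x / fact 3 * t ^ 3" by blast
    have "\<bar>D 3 x\<bar> \<le> \<bar>D 3 0\<bar> + 1" using d(2)[of x] x(1) t by linarith
    then have "\<bar>D 3 x / fact 3\<bar> \<le> \<bar>D 3 0\<bar> + 1" by (simp add: fact_numeral)
    moreover have "N t = N 0 + t * D 1 0 + t\<^sup>2 * (D 2 0 / 2) + t ^ 3 * (D 3 x / fact 3)"
    proof -
      have "(\<Sum>m<3. f m) = f 0 + f 1 + f 2" for f :: "nat \<Rightarrow> real"
        by (simp add: numeral_3_eq_3 numeral_2_eq_2)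
      then show ?thesis using x(2) by (simp add: D0 fact_numeral mult.commute)
    qed
    ultimately show ?thesis by blast
  qed
  then show ?thesis using that[of "min d d'" "\<bar>D 3 0\<bar> + 1" "D 1 0" "D 2 0 / 2"] d(1) d'(1) by simp
qed

text \<open>A smooth function behaves like an integral power of \<open>t\<close> or is \<open>O(t\<^sup>3)\<close>; no integer equals
  \<open>8/3\<close>, so no finite nonzero limit can occur.\<close>

lemma smooth_over_fractional_power:
  fixes N :: "real \<Rightarrow> real"
  assumes "open I" "0 \<in> I" "smooth_on I N"
  shows "((\<lambda>t. N t / \<bar>t\<bar> powr (8/3)) \<longlongrightarrow> 0) (at 0) \<or>
    filterlim (\<lambda>t. \<bar>N t / \<bar>t\<bar> powr (8/3)\<bar>) at_top (at 0)"
proof -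
  obtain n1 n2 C e where e: "e > 0"
    and T: "\<And>t. \<bar>t\<bar> < e \<Longrightarrow> \<exists>R. \<bar>R\<bar> \<le> C \<and> N t = N 0 + t * n1 + t\<^sup>2 * n2 + t ^ 3 * R"
    by (rule taylor_order_3[OF assms]) (rule that)
  define n0 where "n0 = N 0"
  note T = T[folded n0_def]
  define R where "R t = (SOME R. \<bar>R\<bar> \<le> C \<and> N t = n0 + t * n1 + t\<^sup>2 * n2 + t ^ 3 * R)" for t
  have R: "\<bar>R t\<bar> \<le> C" "N t = n0 + t * n1 + t\<^sup>2 * n2 + t ^ 3 * R t" if "\<bar>t\<bar> < e" for t
    using someI_ex[OF T[OF that]] by (auto simp: R_def)
  have ev: "\<forall>\<^sub>F t in at 0. \<bar>t\<bar> < e \<and> t \<noteq> 0"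
    using e by (auto simp: eventually_at intro!: exI[of _ e])
  have tR: "((\<lambda>t. t * R t) \<longlongrightarrow> 0) (at 0)"
  proof (rule Lim_null_comparison)
    show "\<forall>\<^sub>F t in at 0. norm (t * R t) \<le> \<bar>t\<bar> * C"
      using ev by eventually_elim (auto simp: abs_mult intro!: mult_left_mono R(1))
    show "((\<lambda>t. \<bar>t\<bar> * C) \<longlongrightarrow> 0) (at (0::real))" by (auto intro!: tendsto_eq_intros)
  qed
  define Q where "Q t = t * R t" for t
  have tQ: "(Q \<longlongrightarrow> 0) (at 0)" using tR by (simp add: Q_def[abs_def])
  have inf: "filterlim (\<lambda>t. \<bar>N t / \<bar>t\<bar> powr (8/3)\<bar>) at_top (at 0)"
    if j: "j \<le> 2" and L: "((\<lambda>t. N t / t ^ j) \<longlongrightarrow> L) (at 0)" "L \<noteq> 0" for j :: nat and L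
  proof -
    have "((\<lambda>t. \<bar>t\<bar> powr (8/3 - real j)) \<longlongrightarrow> 0) (at (0::real))"
      by (rule tendsto_eq_rhs[OF tendsto_powr'[OF tendsto_rabs[OF tendsto_ident_at] tendsto_const]])
        (use j in auto)
    moreover have "\<forall>\<^sub>F t in at (0::real). \<bar>t\<bar> powr (8/3 - real j) > 0"
      by (simp add: eventually_at_filter)
    ultimately have "filterlim (\<lambda>t. \<bar>t\<bar> powr (8/3 - real j)) (at_right 0) (at (0::real))"
      by (rule tendsto_imp_filterlim_at_right)
    then have "filterlim (\<lambda>t. inverse (\<bar>t\<bar> powr (8/3 - real j))) at_top (at (0::real))"
      by (rule filterlim_compose[OF filterlim_inverse_at_top_right])
    then have "filterlim (\<lambda>t. \<bar>t\<bar> powr (real j - 8/3)) at_top (at (0::real))"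
      by (simp flip: powr_minus)
    from filterlim_tendsto_pos_mult_at_top[OF tendsto_rabs[OF L(1)] _ this]
    have lim: "filterlim (\<lambda>t. \<bar>N t / t ^ j\<bar> * \<bar>t\<bar> powr (real j - 8/3)) at_top (at 0)"
      using L(2) by simp
    have "\<forall>\<^sub>F t in at 0. \<bar>N t / t ^ j\<bar> * \<bar>t\<bar> powr (real j - 8/3) = \<bar>N t / \<bar>t\<bar> powr (8/3)\<bar>"
      using ev by eventually_elim (simp add: powr_diff powr_realpow power_abs abs_divide)
    from iffD1[OF filterlim_cong[OF refl refl this] lim] show ?thesis .
  qed
  show ?thesis
  proof (cases "n0 = 0 \<and> n1 = 0 \<and> n2 = 0")
    case True
    have "((\<lambda>t. N t / \<bar>t\<bar> powr (8/3)) \<longlongrightarrow> 0) (at 0)"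
    proof (rule Lim_null_comparison)
      show "\<forall>\<^sub>F t in at 0. norm (N t / \<bar>t\<bar> powr (8/3)) \<le> C * \<bar>t\<bar> powr (1/3)"
        using ev
      proof eventually_elim
        case (elim t)
        have "N t = t ^ 3 * R t" using R(2)[of t] elim True by simp
        then have "\<bar>N t\<bar> = \<bar>t\<bar> ^ 3 * \<bar>R t\<bar>" by (simp add: abs_mult power_abs)
        also have "\<dots> \<le> \<bar>t\<bar> ^ 3 * C" by (intro mult_left_mono R(1)) (use elim in auto)
        also have "\<dots> = C * \<bar>t\<bar> powr (1/3) * \<bar>t\<bar> powr (8/3)"
          using powr_add[of "\<bar>t\<bar>" "1/3" "8/3"] elim by simp
        finally show ?case using elim by (simp add: abs_divide divide_le_eq)
      qed
      show "((\<lambda>t. C * \<bar>t\<bar> powr (1/3)) \<longlongrightarrow> 0) (at (0::real))"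
        by (rule tendsto_eq_rhs[OF tendsto_mult[OF tendsto_const
              tendsto_powr'[OF tendsto_rabs[OF tendsto_ident_at] tendsto_const]]]) auto
    qed
    then show ?thesis by blast
  next
    case False
    then consider "n0 \<noteq> 0" | "n0 = 0" "n1 \<noteq> 0" | "n0 = 0" "n1 = 0" "n2 \<noteq> 0" by blast
    then show ?thesis
    proof cases
      case 1
      have lim: "((\<lambda>t. n0 + t * n1 + t * t * n2 + t * t * Q t) \<longlongrightarrow> n0) (at 0)"
        by (auto intro!: tendsto_eq_intros tQ)
      moreover have "\<forall>\<^sub>F t in at 0. n0 + t * n1 + t * t * n2 + t * t * Q t = N t / t ^ 0"
        using ev by eventually_elim (simp add: R(2) Q_def power2_eq_square power3_eq_cube)
      from inf[OF _ iffD1[OF tendsto_cong[OF this] lim]] 1 show ?thesis by simp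
    next
      case 2
      have lim: "((\<lambda>t. n1 + t * n2 + t * Q t) \<longlongrightarrow> n1) (at 0)"
        by (auto intro!: tendsto_eq_intros tQ)
      moreover have "\<forall>\<^sub>F t in at 0. n1 + t * n2 + t * Q t = N t / t ^ 1"
        using ev by eventually_elim (simp add: R(2) Q_def 2 power2_eq_square power3_eq_cube field_simps)
      from inf[OF _ iffD1[OF tendsto_cong[OF this] lim]] 2 show ?thesis by simp
    next
      case 3
      have lim: "((\<lambda>t. n2 + Q t) \<longlongrightarrow> n2) (at 0)"
        by (auto intro!: tendsto_eq_intros tQ)
      moreover have "\<forall>\<^sub>F t in at 0. n2 + Q t = N t / t ^ 2"
        using ev by eventually_elim (simp add: R(2) Q_def 3 power2_eq_square power3_eq_cube field_simps)
      from inf[OF _ iffD1[OF tendsto_cong[OF this] lim]] 3 show ?thesis by simp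
    qed
  qed
qed

lemma smooth_balancing_numerator:
  assumes V: "open V" and sm: "smooth_on V r" "smooth_on V b" "smooth_on V \<Lambda>"
    and nz: "\<And>z. z \<in> V \<Longrightarrow> b z \<noteq> 0" "\<And>z. z \<in> V \<Longrightarrow> pd 2 \<Lambda> z \<noteq> 0"
  shows "smooth_on V (balancing_numerator r b \<Lambda>)"
proof -
  have "smooth_on V (\<lambda>z. r z * b z)" by (intro smooth_on_mult V sm)
  then have sc: "smooth_on V (curl r b)"
    unfolding curl_def[abs_def] by (intro smooth_on_diff V smooth_on_pd sm)
  have "(b z)\<^sup>2 \<noteq> 0" if "z \<in> V" for z using nz(1)[OF that] by simp
  then show ?thesis
    unfolding balancing_numerator_def[abs_def] Let_def
    by (intro smooth_on_add smooth_on_diff smooth_on_minus smooth_on_mult smooth_on_divide smooth_on_power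
        smooth_on_const smooth_on_pd sm sc V nz) auto
qed

text \<open>This sign makes \<open>\<kappa>\<^sub>B\<close> tend to minus infinity at points that are not \<open>L\<^sub>3\<close>-points.\<close>

lemma balancing_numerator_slope_zero:
  assumes "r z = 0" "b z \<noteq> 0" "pd 1 r z = 0" "pd 2 \<Lambda> z \<noteq> 0"
  shows "balancing_numerator r b \<Lambda> z < 0"
proof -
  have "balancing_numerator r b \<Lambda> z = - (pd 2 \<Lambda> z)\<^sup>2 / (5 * (b z)\<^sup>2)"
    using assms by (simp add: balancing_numerator_def Let_def power2_eq_square field_simps)
  then show ?thesis using assms by simp
qed

text \<open>The restriction to \<open>s t \<noteq> 0\<close> matters: the slope \<open>s\<close> may vanish at points that accumulate at \<open>0\<close>, and these are
  not of the first kind.\<close>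

lemma quotient_at_bot:
  fixes N s k b :: "real \<Rightarrow> real"
  assumes "isCont N 0" "isCont s 0" "isCont k 0" "isCont b 0" "s 0 = 0" "N 0 < 0"
    and "b 0 \<noteq> 0" "k 0 \<noteq> 0"
  shows "filterlim (\<lambda>t. N t / ((b t)\<^sup>2 * (s t)\<^sup>2 * \<bar>k t * s t\<bar> powr (2/3))) at_bot (at 0 within {t. s t \<noteq> 0})"
    (is "filterlim _ _ ?G")
proof -
  let ?D = "\<lambda>t. (b t)\<^sup>2 * (s t)\<^sup>2 * \<bar>k t * s t\<bar> powr (2/3)"
  have G: "?G \<le> at 0" by (rule at_le) simp
  have lim: "(f \<longlongrightarrow> f 0) ?G" if "isCont f 0" for f :: "real \<Rightarrow> real"
    using that G unfolding isCont_def by (rule tendsto_mono[rotated])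
  have "(?D \<longlongrightarrow> (b 0)\<^sup>2 * (s 0)\<^sup>2 * \<bar>k 0 * s 0\<bar> powr (2/3)) ?G"
    by (intro tendsto_intros lim assms) auto
  then have D0: "(?D \<longlongrightarrow> 0) ?G" by (simp add: assms)
  have "\<forall>\<^sub>F t in ?G. k t \<noteq> 0"
    by (rule tendsto_imp_eventually_ne[OF lim[OF assms(3)] assms(8)])
  moreover have "\<forall>\<^sub>F t in ?G. s t \<noteq> 0" by (simp add: eventually_at_filter)
  moreover have "\<forall>\<^sub>F t in ?G. b t \<noteq> 0"
    by (rule tendsto_imp_eventually_ne[OF lim[OF assms(4)] assms(7)])
  ultimately have "\<forall>\<^sub>F t in ?G. ?D t > 0"
    by eventually_elim simp
  with D0 have "filterlim ?D (at_right 0) ?G"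
    by (rule tendsto_imp_filterlim_at_right)
  then have "filterlim (\<lambda>t. inverse (?D t)) at_top ?G"
    by (rule filterlim_compose[OF filterlim_inverse_at_top_right])
  then show ?thesis
    unfolding divide_inverse by (intro filterlim_tendsto_neg_mult_at_bot[OF lim[OF assms(1)] assms(6)])
qed

text \<open>A simple zero of \<open>s\<close> makes the denominator comparable to \<open>\<bar>t\<bar> powr (8/3)\<close>.\<close>

lemma quotient_dichotomy:
  fixes N s k b :: "real \<Rightarrow> real"
  assumes I: "open I" "0 \<in> I" "smooth_on I N" and s: "(s has_real_derivative c) (at 0)" "s 0 = 0" "c \<noteq> 0"
    and "isCont k 0" "isCont b 0" "b 0 \<noteq> 0" "k 0 \<noteq> 0"
  defines "K \<equiv> \<lambda>t. N t / ((b t)\<^sup>2 * (s t)\<^sup>2 * \<bar>k t * s t\<bar> powr (2/3))"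
  shows "(K \<longlongrightarrow> 0) (at 0) \<or> filterlim (\<lambda>t. \<bar>K t\<bar>) at_top (at 0)"
proof -
  let ?M = "\<lambda>t. 1 / ((b t)\<^sup>2 * (s t / t)\<^sup>2 * \<bar>k t * (s t / t)\<bar> powr (2/3))"
  let ?L = "1 / ((b 0)\<^sup>2 * c\<^sup>2 * \<bar>k 0 * c\<bar> powr (2/3))"
  have st: "((\<lambda>t. s t / t) \<longlongrightarrow> c) (at 0)"
    using s(1) by (simp add: has_field_derivative_iff s(2))
  have M: "(?M \<longlongrightarrow> ?L) (at 0)"
    using assms by (intro tendsto_intros st) (auto simp: isCont_def)
  have L: "?L \<noteq> 0" using assms by simp
  have "K t = ?M t * (N t / \<bar>t\<bar> powr (8/3))" if "t \<noteq> 0" for t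
  proof -
    have *: "\<bar>t\<bar> powr (8/3) = t\<^sup>2 * \<bar>t\<bar> powr (2/3)"
      using powr_add[of "\<bar>t\<bar>" 2 "2/3"] that by simp
    have "\<bar>k t * s t\<bar> powr (2/3) = \<bar>k t * (s t / t)\<bar> powr (2/3) * \<bar>t\<bar> powr (2/3)"
      using that by (simp add: abs_mult abs_divide flip: powr_mult)
    moreover have "(s t)\<^sup>2 = (s t / t)\<^sup>2 * t\<^sup>2" using that by (simp add: power_divide)
    ultimately have "(b t)\<^sup>2 * (s t)\<^sup>2 * \<bar>k t * s t\<bar> powr (2/3)
        = ((b t)\<^sup>2 * (s t / t)\<^sup>2 * \<bar>k t * (s t / t)\<bar> powr (2/3)) * \<bar>t\<bar> powr (8/3)"
      unfolding * by simp
    then show ?thesis unfolding K_def by simp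
  qed
  then have ev: "\<forall>\<^sub>F t in at 0. ?M t * (N t / \<bar>t\<bar> powr (8/3)) = K t"
    by (auto simp: eventually_at_filter)
  from smooth_over_fractional_power[OF I] show ?thesis
  proof
    assume "((\<lambda>t. N t / \<bar>t\<bar> powr (8/3)) \<longlongrightarrow> 0) (at 0)"
    from tendsto_mult[OF M this] have "(K \<longlongrightarrow> 0) (at 0)"
      using tendsto_cong[OF ev] by simp
    then show ?thesis ..
  next
    assume "filterlim (\<lambda>t. \<bar>N t / \<bar>t\<bar> powr (8/3)\<bar>) at_top (at 0)"
    moreover have "\<bar>?L\<bar> > 0" using L by (simp only: zero_less_abs_iff not_False_eq_True)
    ultimately have lim: "filterlim (\<lambda>t. \<bar>?M t\<bar> * \<bar>N t / \<bar>t\<bar> powr (8/3)\<bar>) at_top (at 0)"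
      by (intro filterlim_tendsto_pos_mult_at_top[OF tendsto_rabs[OF M]])
    have "\<forall>\<^sub>F t in at 0. \<bar>?M t\<bar> * \<bar>N t / \<bar>t\<bar> powr (8/3)\<bar> = \<bar>K t\<bar>"
      using ev by eventually_elim (metis abs_mult)
    from iffD1[OF filterlim_cong[OF refl refl this] lim] have "filterlim (\<lambda>t. \<bar>K t\<bar>) at_top (at 0)" .
    then show ?thesis ..
  qed
qed

context semidefinite_surface_metric
begin

text \<open>Points of the first kind near \<open>p\<close> lie on the axis, so the limit is one in the variable \<open>x\<close>, approaching \<open>0\<close>
  through values where the slope does not vanish.\<close>

lemma second_kind_limit:
  assumes p: "second_kind A h p"
  defines "F \<equiv> at p within {q. first_kind A h q}" and "\<kappa> \<equiv> balancing_curvature A h"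
  shows "((\<kappa> \<longlongrightarrow> 0) F \<or> filterlim (\<lambda>q. \<bar>\<kappa> q\<bar>) at_top F) \<and> (\<not> L3_point A h p \<longrightarrow> filterlim \<kappa> at_bot F)"
proof -
  obtain d where d: "straight d" "p \<in> fst d" "snd d p = 0" "coefF h d 0 = 0"
    "\<And>w. w \<in> snd d ` fst d \<Longrightarrow> coefG h d w > 0" by (rule second_kind_chart[OF p]) (rule that)
  have gc: "spacelike_straight d" using d by (simp add: spacelike_straight_def)
  have dc: "d \<in> cs" using d straightD by blast
  have nd: "nondegenerate_lightlike A h p" using p by (simp add: second_kind_def)
  define V where "V = snd d ` fst d"
  have V: "open V" "0 \<in> V" using chD(2)[OF dc] d(2,3) by (auto simp: V_def image_iff intro!: bexI[of _ p])
  note sm = smooth_square_coefs[OF gc, folded V_def]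
  have r0: "slope d 0 = 0" using d(4) by (simp add: slope_def)
  have b0: "rootG d w \<noteq> 0" if "w \<in> V" for w using coef_complete_square(4)[OF gc] that by (force simp: V_def)
  have k0: "pd 2 (lamG d) 0 \<noteq> 0"
    using nondegenerate_straight(2)[OF d(1,2) nd] lamG_axis(2)[OF gc V(2)[unfolded V_def]] d(5)[OF V(2)[unfolded V_def]] d(3)
    by simp
  define V' where "V' = V \<inter> pd 2 (lamG d) -` (- {0})"
  have V': "open V'" "0 \<in> V'" "V' \<subseteq> V"
    unfolding V'_def using V k0
      continuous_open_preimage[OF smooth_on_continuous[OF smooth_on_pd[OF sm(3)]] V(1), of "- {0}" 2]
    by (auto simp: open_Compl)
  define L :: "real \<Rightarrow> real^2" where "L t = t *\<^sub>R axis 1 1" for t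
  have L0: "L 0 = 0" by (simp add: L_def)
  have cL: "continuous_on UNIV L" unfolding L_def by (intro continuous_intros)
  define I where "I = L -` V'"
  have I: "open I" "0 \<in> I" using V' cL L0 by (auto simp: I_def open_vimage continuous_on_open_vimage)
  have sL: "smooth_on I L"
    unfolding L_def[abs_def] by (intro smooth_on_scaleR smooth_on_id smooth_on_const I)
  define N where "N t = balancing_numerator (slope d) (rootG d) (lamG d) (L t)" for t
  have sV': "smooth_on V' (balancing_numerator (slope d) (rootG d) (lamG d))"
    by (rule smooth_balancing_numerator[OF V'(1)])
      (use b0 V'(3) sm in \<open>auto simp: V'_def intro: smooth_on_subset\<close>)
  have sN: "smooth_on I N" unfolding N_def[abs_def]
    by (rule smooth_on_compose[OF I(1) V'(1) _ sV' sL]) (auto simp: I_def)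
  have cont: "isCont (\<lambda>t. \<phi> (L t)) 0" if "smooth_on V \<phi>" for \<phi> :: "real^2 \<Rightarrow> real"
  proof (rule isCont_o2[of _ L])
    show "isCont L 0" using cL by (simp add: continuous_on_eq_continuous_at)
    show "isCont \<phi> (L 0)" using smooth_on_continuous[OF that] V by (simp add: L0 continuous_on_eq_continuous_at)
  qed
  define s where "s t = slope d (L t)" for t
  define k where "k t = pd 2 (lamG d) (L t)" for t
  define b where "b t = rootG d (L t)" for t
  define c where "c = pd 1 (slope d) 0"
  have s: "(s has_real_derivative c) (at 0)" "s 0 = 0"
    using has_real_derivative_line[OF sm(1), of 0 0 1] V(2) r0
    by (simp_all add: s_def[abs_def] L_def c_def)
  have cs: "isCont s 0" "isCont k 0" "isCont b 0"
    unfolding s_def[abs_def] k_def[abs_def] b_def[abs_def] by (intro cont sm smooth_on_pd)+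
  have kb: "k 0 \<noteq> 0" "b 0 \<noteq> 0" using k0 b0[OF V(2)] by (simp_all add: k_def b_def L0)
  define K where "K t = N t / ((b t)\<^sup>2 * (s t)\<^sup>2 * \<bar>k t * s t\<bar> powr (2/3))" for t
  define x where "x q = snd d q $ 1" for q
  have pt: "\<kappa> q = K (x q) \<and> s (x q) \<noteq> 0" if q: "q \<in> fst d" "first_kind A h q" for q
  proof -
    have "snd d q $ 2 = 0"
      by (rule nondegenerate_straight(1)[OF d(1) q(1)]) (use q(2) in \<open>simp add: first_kind_def\<close>)
    then have Lx: "snd d q = L (x q)" by (simp add: L_def x_def vec_eq_iff forall_2 axis_def)
    have G: "coefG h d (snd d q) > 0" using d(5) q(1) by blast
    have "coefF h d (snd d q) \<noteq> 0" by (rule first_kind_coefF[OF q(2) d(1) q(1)]) (use G in simp)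
    then have "s (x q) \<noteq> 0" using G by (simp add: s_def slope_def flip: Lx)
    then show ?thesis
      using balancing_curvature_formula[OF gc q] unfolding \<kappa>_def Lx
      by (simp add: K_def N_def s_def k_def b_def)
  qed
  have ev: "\<forall>\<^sub>F q in F. \<kappa> q = K (x q) \<and> s (x q) \<noteq> 0"
    unfolding F_def eventually_at_topological
    using pt d(2) chD(1)[OF dc] by (intro exI[of _ "fst d"]) blast
  have "continuous (at p) (snd d)"
    using chD(3,1)[OF dc] d(2) by (simp add: continuous_on_eq_continuous_at)
  then have "((\<lambda>q. snd d q) \<longlongrightarrow> 0) (at p)" by (simp add: continuous_at d(3))
  then have "((\<lambda>q. snd d q) \<longlongrightarrow> 0) F" unfolding F_def by (rule tendsto_mono[OF at_le, rotated]) simp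
  from tendsto_vec_nth[OF this, of 1] have "(x \<longlongrightarrow> 0) F" by (simp add: x_def[abs_def])
  moreover have "\<forall>\<^sub>F q in F. x q \<in> {t. s t \<noteq> 0} \<and> x q \<noteq> 0"
    using ev by eventually_elim (use s(2) in auto)
  ultimately have T: "filterlim x (at 0 within {t. s t \<noteq> 0}) F" by (simp add: filterlim_at)
  have ev\<kappa>: "\<forall>\<^sub>F q in F. K (x q) = \<kappa> q" using ev by eventually_elim simp
  have ev_abs: "\<forall>\<^sub>F q in F. \<bar>K (x q)\<bar> = \<bar>\<kappa> q\<bar>" using ev by eventually_elim simp
  show ?thesis
  proof (cases "c = 0")
    case True
    have "N 0 < 0" unfolding N_def L0
      by (rule balancing_numerator_slope_zero) (use r0 b0[OF V(2)] k0 True in \<open>auto simp: c_def\<close>)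
    moreover have "isCont N 0"
      using smooth_on_continuous[OF sN] I by (simp add: continuous_on_eq_continuous_at)
    ultimately have "filterlim K at_bot (at 0 within {t. s t \<noteq> 0})"
      unfolding K_def[abs_def] using quotient_at_bot[of N s k b] cs kb s(2) by blast
    from filterlim_compose[OF this T] have bot: "filterlim \<kappa> at_bot F"
      by (rule iffD1[OF filterlim_cong[OF refl refl ev\<kappa>]])
    then have "filterlim (\<lambda>q. - \<kappa> q) at_top F" by (simp add: filterlim_uminus_at_top)
    then have "filterlim (\<lambda>q. \<bar>\<kappa> q\<bar>) at_top F"
      by (rule filterlim_at_top_mono) (simp add: abs_ge_minus_self)
    then show ?thesis using bot by blast
  next
    case False
    then have "L3_point A h p"
      using L3_point_of_slope[OF gc d(2,3) nd r0] by (simp add: c_def)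
    have "(K \<longlongrightarrow> 0) (at 0) \<or> filterlim (\<lambda>t. \<bar>K t\<bar>) at_top (at 0)"
      unfolding K_def[abs_def] by (rule quotient_dichotomy[OF I sN s False cs(2,3) kb(2,1)])
    moreover have T0: "filterlim x (at 0) F"
      by (rule filterlim_mono[OF T at_le order_refl]) simp
    ultimately have "((\<lambda>q. K (x q)) \<longlongrightarrow> 0) F \<or> filterlim (\<lambda>q. \<bar>K (x q)\<bar>) at_top F"
      using filterlim_compose[of K _ "at 0" x F] filterlim_compose[of "\<lambda>t. \<bar>K t\<bar>" _ "at 0" x F] by blast
    then have "(\<kappa> \<longlongrightarrow> 0) F \<or> filterlim (\<lambda>q. \<bar>\<kappa> q\<bar>) at_top F"
      unfolding filterlim_cong[OF refl refl ev\<kappa>] filterlim_cong[OF refl refl ev_abs] .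
    then show ?thesis using \<open>L3_point A h p\<close> by blast
  qed
qed

end

text \<open>Semidefiniteness is known in charts of the atlas, where the map is an immersion, and passes to
  other coordinate systems by the transformation rule.\<close>

lemma semidefinite_first_fundamental_form:
  fixes A :: "('a::{t2_space, second_countable_topology}, 2) chart set"
    and B :: "('b::{t2_space, second_countable_topology}, 3) chart set"
  assumes A: "smooth_manifold A" and B: "smooth_manifold B" and g: "lorentzian_metric B g"
    and f: "immersion A B f"
  shows "semidefinite_surface_metric A (first_fundamental_form B g f)"
proof -
  let ?h = "first_fundamental_form B g f"
  have gt: "symmetric_tensor B g" and gs: "\<And>d y. d \<in> coord_systems B \<Longrightarrow> y \<in> fst d \<Longrightarrow> lorentz_signature (g d y)"
    using g by (auto simp: lorentzian_metric_def)
  have sf: "smooth_map A B f" using f by (simp add: immersion_def)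
  interpret surface_metric A ?h
    using A symmetric_tensor_first_fundamental_form[OF A B gt sf] by unfold_locales
  show ?thesis
  proof
    fix c x v assume c: "c \<in> cs" "x \<in> fst c" and deg: "degenerate_form (?h c x)"
    obtain a where a: "a \<in> A" "x \<in> fst a" using smooth_manifold_cover[OF A] by blast
    obtain d where d: "d \<in> B" "f x \<in> fst d" using smooth_manifold_cover[OF B] by blast
    have aA: "a \<in> cs" and dB: "d \<in> coord_systems B"
      using a d smooth_manifold_subset[OF A] smooth_manifold_subset[OF B] by auto
    let ?J = "jacobian (local_rep f a d) (at (snd a x))" and ?K = "jac c a x"
    have "snd a x \<in> snd a ` (fst a \<inter> f -` fst d)" using a d by auto
    then have "frechet_derivative (local_rep f a d) (at (snd a x)) = (*v) ?J"
      using has_derivative_jacobian[OF smooth_map_local_rep[OF A B sf aA d(1)]] frechet_derivative_at by metis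
    moreover have "inj (frechet_derivative (local_rep f a d) (at (snd a x)))"
      using f a d by (auto simp: immersion_def)
    ultimately have inj: "inj ((*v) ?J)" by simp
    have "det (?h a x) = 0"
      using deg lam_transform[OF c(1) aA c(2) a(2)] det_jac[OF c(1) aA c(2) a(2)]
      by (simp add: degenerate_form_iff_det lam_eq_det c a aA)
    then have dega: "degenerate_form (?h a x)" by (simp add: degenerate_form_iff_det)
    note ha = first_fundamental_form_eq[OF A B gt sf aA a(2) d]
    have "(?K *v v) \<bullet> (?h a x *v (?K *v v)) \<ge> 0"
      using lorentz_signature_degenerate_plane[OF gs[OF dB d(2)] inj] dega unfolding ha by blast
    then show "v \<bullet> (?h c x *v v) \<ge> 0"
      unfolding transform[OF c(1) aA c(2) a(2)] inner_transpose_conj .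
  qed
qed

theorem theorem4p10:
  fixes A :: "('a::{t2_space, second_countable_topology}, 2) chart set"
    and B :: "('b::{t2_space, second_countable_topology}, 3) chart set"
    and g :: "('b, 3) components"
    and f :: "'a \<Rightarrow> 'b"
    and p :: 'a
  defines "ds2 \<equiv> first_fundamental_form B g f"
  defines "\<kappa>\<^sub>B \<equiv> balancing_curvature A ds2"
  defines "at_p \<equiv> at p within {q. first_kind A ds2 q}"
  assumes "smooth_manifold A" and "connected (UNIV :: 'a set)"
    and "smooth_manifold B" and "lorentzian_metric B g"
    and "immersion A B f"
    and "mixed_type A ds2"
    and "admissible_second_kind A ds2 p"
  shows "((\<kappa>\<^sub>B \<longlongrightarrow> 0) at_p \<or> filterlim (\<lambda>q. \<bar>\<kappa>\<^sub>B q\<bar>) at_top at_p) \<and>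
         (\<not> L3_point A ds2 p \<longrightarrow> filterlim \<kappa>\<^sub>B at_bot at_p)"
proof -
  interpret semidefinite_surface_metric A ds2
    unfolding ds2_def by (rule semidefinite_first_fundamental_form) fact+
  have "second_kind A ds2 p"
    using \<open>admissible_second_kind A ds2 p\<close> by (simp add: admissible_second_kind_def)
  then show ?thesis unfolding \<kappa>\<^sub>B_def at_p_def by (rule second_kind_limit)
qed

end
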